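(* Let $n=2k$ be an even integer with $k\ge 2$, let $K$ be a field of characteristic not equal to $2$, let $X=(x_{ij})_{1\le i,j\le n}$ and $Y=(y_{ij})_{1\le i,j\le n}$ be matrices of independent indeterminates over $K$, let $R=K[X,Y]$ be the polynomial ring in all these $2n^2$ variables, and let $C=XY-YX=(c_{ij})$. Let $\mathcal{I}$ be the ideal of $R$ generated by all diagonal entries $c_{ii}$ and all anti-diagonal entries $c_{i,n+1-i}$ ($1\le i\le n$) of $C$. Let $$\Omega=\{(i,j): 1\le i\le k-1,\ 1\le j\le 2k\}\cup\{(k,k),(k,k+1),(k+1,k+1)\}\cup\{(k+1,j): k+3\le j\le 2k\}$$ $$\cup\,\{(i,k+1): k+3\le i\le 2k\}\cup\{(i,j): k+2\le i\le 2k,\ 1\le j\le k-1\}\cup\{(i,j): k+2\le i\le 2k,\ k+2\le j\le 2k\}.$$ Then the elements $$x_{ij},\ y_{ji}\quad\text{with }(i,j)\in\Omega,$$ $$x_{k,s}-y_{2k+1-s,k}\quad\text{with }1\le s\le 2k,\ s\ne k,\ s\neq k+1,$$ $$x_{k+1,s}-y_{s,k+1}\quad\text{with }1\le s\le k+2,\ s\ne k+1,$$ $$x_{k+2,k}-y_{k+1,k+2},\qquad x_{k+2,k+1}-y_{k,k+2},$$ $$x_{s,k}-y_{k,s}\quad\text{with }k+3\le s\le 2k$$ form a homogeneous system of parameters for $R/\mathcal{I}$.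
   Context: $R$ is graded by total degree with all variables of degree $1$. A homogeneous system of parameters for a quotient $R/\mathfrak a$ by a homogeneous ideal $\mathfrak a$ is a sequence of $\dim(R/\mathfrak a)$ homogeneous elements of positive degree such that the quotient of $R/\mathfrak a$ by the ideal they generate has Krull dimension $0$ (equivalently, together with $\mathfrak a$ they generate an ideal primary to the homogeneous maximal ideal of $R$). *)

theory Defs
  imports
    "HOL-Algebra.QuotRing"
    "HOL-Library.Poly_Mapping"
    "HOL-Library.Extended_Real"
begin

section \<open>Polynomial rings and their grading\<close>

text \<open>
  A monomial is a finitely supported exponent vector, and a polynomial is a finitely supported
  map from monomials to coefficients.  The multiplication of \<^type>\<open>poly_mapping\<close> is the convolution
  product, that is, the multiplication of polynomials.
\<close>

type_synonym ('v, 'k) mpoly = "('v \<Rightarrow>\<^sub>0 nat) \<Rightarrow>\<^sub>0 'k"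

definition poly_var :: "'v \<Rightarrow> ('v, 'k::comm_ring_1) mpoly" where
  "poly_var v = Poly_Mapping.single (Poly_Mapping.single v 1) 1"

definition poly_ring :: "'v set \<Rightarrow> ('v, 'k::comm_ring_1) mpoly ring" where
  "poly_ring V =
    \<lparr>carrier = {p. \<forall>m \<in> Poly_Mapping.keys p. Poly_Mapping.keys m \<subseteq> V},
     mult = (*), one = 1, zero = 0, add = (+)\<rparr>"

definition monom_degree :: "('v \<Rightarrow>\<^sub>0 nat) \<Rightarrow> nat" where
  "monom_degree m = (\<Sum>v \<in> Poly_Mapping.keys m. Poly_Mapping.lookup m v)"

text \<open>As usual, the zero polynomial is homogeneous of every degree.\<close>

definition homogeneous :: "nat \<Rightarrow> ('v, 'k::comm_ring_1) mpoly \<Rightarrow> bool" where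
  "homogeneous d p \<longleftrightarrow> (\<forall>m \<in> Poly_Mapping.keys p. monom_degree m = d)"

definition homogeneous_ideal :: "'v set \<Rightarrow> ('v, 'k::comm_ring_1) mpoly set \<Rightarrow> bool" where
  "homogeneous_ideal V I \<longleftrightarrow>
    (\<exists>S \<subseteq> carrier (poly_ring V). (\<forall>f \<in> S. \<exists>d. homogeneous d f) \<and> I = genideal (poly_ring V) S)"


section \<open>Krull dimension and homogeneous systems of parameters\<close>

text \<open>
  A chain of primes \<open>P\<^sub>0 \<subset> \<dots> \<subset> P\<^sub>r\<close> has length \<open>r\<close>.  The supremum is taken in the extended reals,
  so that the zero ring, which has no prime ideals, gets dimension \<open>-\<infinity>\<close> and not \<open>0\<close>.
\<close>

definition krull_dim :: "('a, 'b) ring_scheme \<Rightarrow> ereal" where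
  "krull_dim R =
    (SUP Ps \<in> {Ps. Ps \<noteq> [] \<and> sorted_wrt (\<subset>) Ps \<and> (\<forall>P \<in> set Ps. primeideal P R)}.
      ereal (real (length Ps - 1)))"

text \<open>
  The sequence consists of elements of the quotient of the polynomial ring by \<open>I\<close>.  The elements of
  degree \<open>d\<close> of that quotient are the cosets of the homogeneous polynomials of degree \<open>d\<close>.
\<close>

definition homogeneous_sop ::
  "'v set \<Rightarrow> ('v, 'k::comm_ring_1) mpoly set \<Rightarrow> ('v, 'k) mpoly set list \<Rightarrow> bool" where
  "homogeneous_sop V I gs \<longleftrightarrow>
    homogeneous_ideal V I \<and>
    (\<forall>g \<in> set gs. \<exists>d > 0. \<exists>f \<in> carrier (poly_ring V).
       homogeneous d f \<and> g = I +>\<^bsub>poly_ring V\<^esub> f) \<and>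
    ereal (real (length gs)) = krull_dim (poly_ring V Quot I) \<and>
    krull_dim ((poly_ring V Quot I) Quot (genideal (poly_ring V Quot I) (set gs))) = 0"


section \<open>Two generic matrices and their commutator\<close>

datatype matrix_var = Xvar nat nat | Yvar nat nat

definition matrix_vars :: "nat \<Rightarrow> matrix_var set" where
  "matrix_vars n = (\<Union>i \<in> {1..n}. \<Union>j \<in> {1..n}. {Xvar i j, Yvar i j})"

definition x_var :: "nat \<Rightarrow> nat \<Rightarrow> (matrix_var, 'k::comm_ring_1) mpoly" where
  "x_var i j = poly_var (Xvar i j)"

definition y_var :: "nat \<Rightarrow> nat \<Rightarrow> (matrix_var, 'k::comm_ring_1) mpoly" where
  "y_var i j = poly_var (Yvar i j)"

text \<open>The entry at \<open>(i, j)\<close> of \<open>X Y - Y X\<close> for \<open>n \<times> n\<close> matrices, with indices starting at 1.\<close>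

definition commutator_entry :: "nat \<Rightarrow> nat \<Rightarrow> nat \<Rightarrow> (matrix_var, 'k::comm_ring_1) mpoly" where
  "commutator_entry n i j = (\<Sum>l = 1..n. x_var i l * y_var l j) - (\<Sum>l = 1..n. y_var i l * x_var l j)"

definition diag_antidiag_ideal :: "nat \<Rightarrow> (matrix_var, 'k::comm_ring_1) mpoly set" where
  "diag_antidiag_ideal n =
    genideal (poly_ring (matrix_vars n))
      ({commutator_entry n i i | i. 1 \<le> i \<and> i \<le> n} \<union>
       {commutator_entry n i (n + 1 - i) | i. 1 \<le> i \<and> i \<le> n})"


section \<open>The system of parameters\<close>

definition Omega :: "nat \<Rightarrow> (nat \<times> nat) set" where
  "Omega k =
    {(i, j). 1 \<le> i \<and> i \<le> k - 1 \<and> 1 \<le> j \<and> j \<le> 2 * k} \<union>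
    {(k, k), (k, k + 1), (k + 1, k + 1)} \<union>
    {(k + 1, j) | j. k + 3 \<le> j \<and> j \<le> 2 * k} \<union>
    {(i, k + 1) | i. k + 3 \<le> i \<and> i \<le> 2 * k} \<union>
    {(i, j). k + 2 \<le> i \<and> i \<le> 2 * k \<and> 1 \<le> j \<and> j \<le> k - 1} \<union>
    {(i, j). k + 2 \<le> i \<and> i \<le> 2 * k \<and> k + 2 \<le> j \<and> j \<le> 2 * k}"

text \<open>
  \<open>[a..<b]\<close> excludes \<open>b\<close>.  The index ranges in the first two lines only enumerate \<open>Omega k\<close>, which is
  contained in \<open>{1..2k} \<times> {1..2k}\<close>.
\<close>

definition parameter_polys :: "nat \<Rightarrow> (matrix_var, 'k::comm_ring_1) mpoly list" where
  "parameter_polys k =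
    [x_var i j. i \<leftarrow> [1..<2 * k + 1], j \<leftarrow> [1..<2 * k + 1], (i, j) \<in> Omega k] @
    [y_var j i. i \<leftarrow> [1..<2 * k + 1], j \<leftarrow> [1..<2 * k + 1], (i, j) \<in> Omega k] @
    [x_var k s - y_var (2 * k + 1 - s) k. s \<leftarrow> [1..<2 * k + 1], s \<noteq> k \<and> s \<noteq> k + 1] @
    [x_var (k + 1) s - y_var s (k + 1). s \<leftarrow> [1..<k + 3], s \<noteq> k + 1] @
    [x_var (k + 2) k - y_var (k + 1) (k + 2), x_var (k + 2) (k + 1) - y_var k (k + 2)] @
    [x_var s k - y_var k s. s \<leftarrow> [k + 3..<2 * k + 1]]"

end

theory Submission
  imports Defs
begin

text \<open>
  Only \<open>2 n - 1\<close> of the \<open>2 n\<close> generators of the ideal \<open>I\<close> are needed, because the diagonal entries of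
  a commutator sum to zero, and there are \<open>2 n\<^sup>2 - (2 n - 1)\<close> parameters.  Generators and parameters
  together are therefore as many forms of positive degree as there are variables.  For such a list
  of forms the statement follows from one property: every prime ideal that contains all of them
  contains all variables.  This is \<open>homogeneous_sop_if_primes_contain_variables\<close>.

  The property says that the irrelevant ideal is the only prime over \<open>I\<close> and the parameters, so that
  the second quotient has dimension zero.  It remains to see that \<open>R/I\<close> has dimension \<open>d\<close>, the number
  of parameters.  Two devices replace integral extensions and the height theorem here.

  The first device is the characterisation of the Krull dimension by Coquand and Lombardi.  The
  boundary monoid of \<open>f\<^sub>1, \<dots>, f\<^sub>r\<close> consists of the elements
  \<open>f\<^sub>1\<^sup>a (f\<^sub>2\<^sup>b (\<dots> (u + f\<^sub>r c\<^sub>r) \<dots>) + f\<^sub>1 c\<^sub>1)\<close> with a unit \<open>u\<close>.  There is a chain of primes of length \<open>r\<close>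
  over an ideal \<open>J\<close> if and only if some \<open>f\<^sub>1, \<dots>, f\<^sub>r\<close> have a boundary monoid that is disjoint from
  \<open>J\<close> (\<open>ex_prime_chain_if_boundary_disjoint\<close>, \<open>ex_boundary_disjoint_if_prime_chain\<close>).

  The second device is the growth of \<open>R/J\<close>.  The relation \<open>growth_below J m\<close> says that modulo \<open>J\<close> the
  polynomials of degree at most \<open>t\<close> are spanned by \<open>O(t\<^bsup>m - 1\<^esup>)\<close> of them, where \<open>m = 0\<close> stands for
  \<open>J = R\<close>.  Three facts link it to boundary monoids.  Adjoining a form to \<open>J\<close> lowers the bound by at
  most one (\<open>growth_below_if_adjoin\<close>).  If \<open>growth_below J m\<close> holds and the boundary monoid of
  \<open>r\<close> elements avoids \<open>J\<close>, then \<open>r < m\<close>, because the monomials in these elements are linearly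
  independent modulo \<open>J\<close> (\<open>length_less_if_boundary_disjoint\<close>).  And if \<open>r\<close> forms make the quotient
  finite-dimensional but their boundary monoid meets \<open>J\<close>, then \<open>growth_below J r\<close> already holds
  (\<open>growth_below_if_boundary_meets\<close>).

  Now \<open>R\<close> modulo generators and parameters is finite-dimensional, so \<open>growth_below I (d + 1)\<close> and
  chains over \<open>I\<close> have length at most \<open>d\<close>.  If the boundary monoid of the parameters met \<open>I\<close>, then
  \<open>growth_below I d\<close> would hold, and removing the \<open>2 n - 1\<close> generators one by one would bound the growth
  of the polynomial ring by less than its number of variables, which the variables themselves
  contradict.  So there is a chain of length \<open>d\<close>.

  Finally, a prime \<open>P\<close> that contains the generators and the parameters leaves \<open>4 k - 1\<close> unknowns in
  sparse matrices \<open>X\<close> and \<open>Y\<close>.  The commutator entries far from the centre are single squares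
  modulo \<open>P\<close> once they are taken in the right order, and this removes all unknowns except seven in
  the central \<open>4 \<times> 4\<close> block.  Those satisfy seven quadratic equations that have only the zero
  solution in a domain where \<open>2\<close> is invertible (\<open>central_unknowns_in_prime\<close>).
\<close>

section \<open>Prime ideals of a quotient ring\<close>
lemma carrier_Quot: "carrier (R Quot I) = (\<lambda>x. I +>\<^bsub>R\<^esub> x) ` carrier R"
  unfolding FactRing_def A_RCOSETS_def' by auto

lemma primes_Quot_bij_betw:
  fixes R (structure)
  assumes "cring R" and "ideal I R"
  shows "bij_betw (\<lambda>Q. {x \<in> carrier R. I +> x \<in> Q})
           {Q. primeideal Q (R Quot I)} {P. primeideal P R \<and> I \<subseteq> P}"
proof -
  interpret cring R by fact
  interpret I: ideal I R by fact
  interpret h: ring_hom_cring R "R Quot I" "(+>) I"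
    by (rule I.rcos_ring_hom_cring) fact
  have coset_I: "I +> x = \<zero>\<^bsub>R Quot I\<^esub>" if "x \<in> I" for x
    using I.a_rcos_const[OF that] unfolding FactRing_def by simp
  have mem_image: "I +> x \<in> (+>) I ` P \<longleftrightarrow> x \<in> P"
    if P: "ideal P R" "I \<subseteq> P" and x: "x \<in> carrier R" for P x
  proof
    assume "I +> x \<in> (+>) I ` P"
    then obtain y where y: "y \<in> P" "I +> x = I +> y" by auto
    have "x \<in> I +> y" using y(2) I.a_rcos_self[OF x] by simp
    then obtain i where "i \<in> I" "x = i \<oplus> y" by (auto simp: a_r_coset_def')
    then show "x \<in> P"
      using P y(1) additive_subgroup.a_closed[OF ideal.axioms(1)[OF P(1)]] by auto
  qed auto
  show ?thesis
  proof (rule bij_betw_byWitness[where f' = "\<lambda>P. (+>) I ` P"])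
    show "\<forall>Q\<in>{Q. primeideal Q (R Quot I)}. (+>) I ` {x \<in> carrier R. I +> x \<in> Q} = Q"
    proof safe
      fix Q X assume "primeideal Q (R Quot I)" "X \<in> Q"
      then interpret Q: primeideal Q "R Quot I" by simp
      have "X \<in> carrier (R Quot I)" using \<open>X \<in> Q\<close> Q.a_subset by auto
      then show "X \<in> (+>) I ` {x \<in> carrier R. I +> x \<in> Q}"
        using \<open>X \<in> Q\<close> by (auto simp: carrier_Quot)
    qed
    show "\<forall>P\<in>{P. primeideal P R \<and> I \<subseteq> P}. {x \<in> carrier R. I +> x \<in> (+>) I ` P} = P"
    proof safe
      fix P x assume P: "primeideal P R" "I \<subseteq> P"
      then interpret P: primeideal P R by simp
      show "x \<in> P" if "I +> x = I +> y" "x \<in> carrier R" "y \<in> P" for y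
        using that mem_image[OF P.is_ideal P(2)] by blast
      show "x \<in> carrier R" if "x \<in> P"
        using that P.a_subset by auto
    qed auto
    show "(\<lambda>Q. {x \<in> carrier R. I +> x \<in> Q}) ` {Q. primeideal Q (R Quot I)}
      \<subseteq> {P. primeideal P R \<and> I \<subseteq> P}"
    proof safe
      fix Q assume "primeideal Q (R Quot I)"
      then interpret Q: primeideal Q "R Quot I" by simp
      show "primeideal {x \<in> carrier R. I +> x \<in> Q} R"
      proof (rule primeidealI)
        show "ideal {x \<in> carrier R. I +> x \<in> Q} R" 
          by (rule ring_hom_ring.ideal_vimage[OF I.rcos_ring_hom_ring Q.is_ideal])
        show "cring R" by fact
        show "carrier R \<noteq> {x \<in> carrier R. I +> x \<in> Q}"
        proof
          assume "carrier R = {x \<in> carrier R. I +> x \<in> Q}"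
          then have "carrier (R Quot I) \<subseteq> Q" by (auto simp: carrier_Quot)
          then show False using Q.I_notcarr Q.a_subset by auto
        qed
        show "a \<in> {x \<in> carrier R. I +> x \<in> Q} \<or> b \<in> {x \<in> carrier R. I +> x \<in> Q}"
          if "a \<in> carrier R" "b \<in> carrier R" "a \<otimes> b \<in> {x \<in> carrier R. I +> x \<in> Q}" for a b
          using that Q.I_prime[of "I +> a" "I +> b"] by auto
      qed
      fix x assume "x \<in> I"
      then show "x \<in> carrier R" using I.a_subset by auto
      show "I +> x \<in> Q" using coset_I[OF \<open>x \<in> I\<close>] by simp
    qed
    show "(\<lambda>P. (+>) I ` P) ` {P. primeideal P R \<and> I \<subseteq> P} \<subseteq> {Q. primeideal Q (R Quot I)}"
    proof safe
      fix P assume P: "primeideal P R" "I \<subseteq> P"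
      then interpret P: primeideal P R by simp
      note mem = mem_image[OF P.is_ideal P(2)]
      show "primeideal ((+>) I ` P) (R Quot I)"
      proof (rule primeidealI)
        show "ideal ((+>) I ` P) (R Quot I)"
          using ring_ideal_imp_quot_ideal[OF I.is_ideal P.is_ideal] .
        show "cring (R Quot I)" by (rule I.quotient_is_cring) fact
        show "carrier (R Quot I) \<noteq> (+>) I ` P"
        proof
          assume eq: "carrier (R Quot I) = (+>) I ` P"
          have "x \<in> P" if "x \<in> carrier R" for x 
            using mem[OF that] eq that unfolding carrier_Quot by blast
          then show False using P.I_notcarr P.a_subset by blast
        qed
        show "A \<in> (+>) I ` P \<or> B \<in> (+>) I ` P"
          if AB: "A \<in> carrier (R Quot I)" "B \<in> carrier (R Quot I)"
            "A \<otimes>\<^bsub>R Quot I\<^esub> B \<in> (+>) I ` P" for A B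
        proof -
          obtain a b where ab: "a \<in> carrier R" "b \<in> carrier R" "A = I +> a" "B = I +> b"
            using AB(1,2) unfolding carrier_Quot by blast
          have "I +> (a \<otimes> b) \<in> (+>) I ` P"
            using AB(3) unfolding ab(3,4) h.hom_mult[OF ab(1,2)] .
          then have "a \<otimes> b \<in> P" using mem[OF m_closed[OF ab(1,2)]] by blast
          then show ?thesis using P.I_prime[OF ab(1,2)] ab(3,4) by blast
        qed
      qed
    qed
  qed
qed

text \<open>
  The primes of \<open>R/I\<close> correspond to the primes over \<open>I\<close>, and the correspondence preserves strict
  inclusion in both directions.  So chains can be taken in \<open>R\<close> itself, without cosets.
\<close>
lemma krull_dim_Quot:
  fixes R (structure)
  assumes "cring R" and "ideal I R"
  shows "krull_dim (R Quot I) =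
    (SUP Ps \<in> {Ps. Ps \<noteq> [] \<and> sorted_wrt (\<subset>) Ps \<and> (\<forall>P \<in> set Ps. primeideal P R \<and> I \<subseteq> P)}.
      ereal (real (length Ps - 1)))"
proof -
  let ?A = "{Ps. Ps \<noteq> [] \<and> sorted_wrt (\<subset>) Ps \<and> (\<forall>P \<in> set Ps. primeideal P (R Quot I))}"
  let ?B = "{Ps. Ps \<noteq> [] \<and> sorted_wrt (\<subset>) Ps \<and> (\<forall>P \<in> set Ps. primeideal P R \<and> I \<subseteq> P)}"
  let ?c = "\<lambda>Q. {x \<in> carrier R. I +> x \<in> Q}"
  note bij = primes_Quot_bij_betw[OF assms]
  have image_c: "(+>) I ` ?c Q = Q" if "primeideal Q (R Quot I)" for Q
  proof -
    interpret Q: primeideal Q "R Quot I" by fact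
    have "Q \<subseteq> (+>) I ` carrier R"
      using Q.a_subset unfolding carrier_Quot .
    then show ?thesis by blast
  qed
  have less_iff: "?c P \<subset> ?c Q \<longleftrightarrow> P \<subset> Q"
    if PQ: "primeideal P (R Quot I)" "primeideal Q (R Quot I)" for P Q
  proof -
    have "?c P \<subseteq> ?c Q \<longleftrightarrow> P \<subseteq> Q" if "primeideal P (R Quot I)" "primeideal Q (R Quot I)" for P Q
    proof
      assume "?c P \<subseteq> ?c Q"
      then have "(+>) I ` ?c P \<subseteq> (+>) I ` ?c Q" by (rule image_mono)
      then show "P \<subseteq> Q" using image_c that by simp
    qed blast
    from this[OF PQ] this[OF PQ(2) PQ(1)] show ?thesis unfolding less_le_not_le by blast
  qed
  have sorted_iff: "sorted_wrt (\<subset>) (map ?c Ps) \<longleftrightarrow> sorted_wrt (\<subset>) Ps"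
    if "\<forall>P \<in> set Ps. primeideal P (R Quot I)" for Ps
    using that
  proof (induction Ps)
    case (Cons P Ps)
    then have "(\<forall>Q \<in> set Ps. ?c P \<subset> ?c Q) \<longleftrightarrow> (\<forall>Q \<in> set Ps. P \<subset> Q)"
      using less_iff by (meson list.set_intros)
    moreover have "sorted_wrt (\<subset>) (map ?c Ps) \<longleftrightarrow> sorted_wrt (\<subset>) Ps"
      using Cons by (meson list.set_intros)
    ultimately show ?case
      unfolding list.map sorted_wrt.simps set_map Ball_image_comp o_def by simp
  qed simp
  have "map ?c ` ?A = ?B"
  proof (intro equalityI subsetI)
    fix Ps assume "Ps \<in> map ?c ` ?A"
    then obtain Qs where Qs: "Qs \<in> ?A" "Ps = map ?c Qs" by blast
    have "primeideal (?c Q) R \<and> I \<subseteq> ?c Q" if "Q \<in> set Qs" for Q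
      using bij_betw_apply[OF bij, of Q] that Qs(1) by blast
    moreover have "sorted_wrt (\<subset>) (map ?c Qs)" using sorted_iff[of Qs] Qs(1) by blast
    ultimately show "Ps \<in> ?B" using Qs by (simp only: mem_Collect_eq set_map) blast
  next
    fix Ps assume Ps: "Ps \<in> ?B"
    let ?d = "inv_into {Q. primeideal Q (R Quot I)} ?c"
    have d: "primeideal (?d P) (R Quot I) \<and> ?c (?d P) = P" if "P \<in> set Ps" for P
      using bij_betw_inv_into_right[OF bij, of P] bij_betw_apply[OF bij_betw_inv_into[OF bij], of P]
        that Ps by auto
    define Qs where "Qs = map ?d Ps"
    have Qs: "map ?c Qs = Ps" unfolding Qs_def map_map
      by (rule map_idI) (simp only: o_def d)
    have prime_Qs: "\<forall>Q \<in> set Qs. primeideal Q (R Quot I)"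
      unfolding Qs_def using d by (simp del: mem_Collect_eq)
    have "sorted_wrt (\<subset>) Qs" using sorted_iff[OF prime_Qs] Ps unfolding Qs by blast
    moreover have "Qs \<noteq> []" using Ps unfolding Qs_def by auto
    ultimately show "Ps \<in> map ?c ` ?A" using Qs prime_Qs by blast
  qed
  then have "(SUP Ps \<in> ?B. ereal (real (length Ps - 1))) =
    (SUP Ps \<in> map ?c ` ?A. ereal (real (length Ps - 1)))" by (simp only:)
  also have "\<dots> = (SUP Ps \<in> ?A. ereal (real (length Ps - 1)))"
    unfolding image_image length_map ..
  finally show ?thesis unfolding krull_dim_def by (rule sym)
qed

section \<open>Ideals of a subring of a commutative ring\<close>
text \<open>
  The carrier \<open>C\<close> is a subset of a type of class \<open>comm_ring_1\<close>, as for the polynomials in a given set of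
  variables.  The operations are then those of the type, and only membership in \<open>C\<close> is left to check.
\<close>
locale unital_subring =
  fixes C :: "'a::comm_ring_1 set"
  assumes one_in [simp, intro]: "1 \<in> C"
    and uminus_in [intro]: "\<And>a. a \<in> C \<Longrightarrow> - a \<in> C"
    and add_in [intro]: "\<And>a b. a \<in> C \<Longrightarrow> b \<in> C \<Longrightarrow> a + b \<in> C"
    and mult_in [intro]: "\<And>a b. a \<in> C \<Longrightarrow> b \<in> C \<Longrightarrow> a * b \<in> C"
begin

abbreviation R :: "'a ring" where
  "R \<equiv> \<lparr>carrier = C, mult = (*), one = 1, zero = 0, add = (+)\<rparr>"

lemma zero_in [simp, intro]: "0 \<in> C"
  using add_in[OF one_in uminus_in[OF one_in]] by simp

lemma diff_in [intro]: "a \<in> C \<Longrightarrow> b \<in> C \<Longrightarrow> a - b \<in> C"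
  using add_in[of a "- b"] uminus_in[of b] by simp

lemma power_in [intro]: "a \<in> C \<Longrightarrow> a ^ n \<in> C"
  by (induction n) auto

lemma sum_in [intro]: "(\<And>i. i \<in> A \<Longrightarrow> f i \<in> C) \<Longrightarrow> sum f A \<in> C"
  by (induction A rule: infinite_finite_induct) auto

lemma cring_R: "cring R"
proof (rule cringI)
  show "abelian_group R"
    by (rule abelian_groupI) (auto simp: algebra_simps intro: bexI[of _ "- x" for x])
  show "Group.comm_monoid R"
    by (rule comm_monoidI) (auto simp: algebra_simps)
qed (auto simp: algebra_simps)

lemma ideal_iff:
  "ideal J R \<longleftrightarrow> J \<subseteq> C \<and> 0 \<in> J \<and> (\<forall>a\<in>J. \<forall>b\<in>J. a + b \<in> J) \<and> (\<forall>a\<in>J. \<forall>r\<in>C. r * a \<in> J)"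
proof
  assume "ideal J R"
  then interpret ideal J R .
  show "J \<subseteq> C \<and> 0 \<in> J \<and> (\<forall>a\<in>J. \<forall>b\<in>J. a + b \<in> J) \<and> (\<forall>a\<in>J. \<forall>r\<in>C. r * a \<in> J)"
    using a_subset additive_subgroup.zero_closed[OF is_additive_subgroup]
      additive_subgroup.a_closed[OF is_additive_subgroup] I_l_closed by auto
next
  assume J: "J \<subseteq> C \<and> 0 \<in> J \<and> (\<forall>a\<in>J. \<forall>b\<in>J. a + b \<in> J) \<and> (\<forall>a\<in>J. \<forall>r\<in>C. r * a \<in> J)"
  interpret cring R by (rule cring_R)
  have inv: "inv\<^bsub>add_monoid R\<^esub> a = - a" if "a \<in> C" for a
    using that add.inv_equality[of "- a" a] by (auto simp: a_inv_def)
  have "- a \<in> J" if "a \<in> J" for a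
    using J that uminus_in[OF one_in] by (metis mult_minus1)
  then have "subgroup J (add_monoid R)"
    using J inv by (intro subgroup.intro) (auto simp: subset_iff)
  then show "ideal J R"
    using J by (intro idealI ring_axioms) (auto simp: mult.commute)
qed

lemma
  assumes "ideal J R"
  shows ideal_subset: "J \<subseteq> C"
    and ideal_zero: "0 \<in> J"
    and ideal_add: "a \<in> J \<Longrightarrow> b \<in> J \<Longrightarrow> a + b \<in> J"
    and ideal_mult: "a \<in> J \<Longrightarrow> r \<in> C \<Longrightarrow> r * a \<in> J"
    and ideal_diff: "a \<in> J \<Longrightarrow> b \<in> J \<Longrightarrow> a - b \<in> J"
    and ideal_sum: "(\<And>i. i \<in> A \<Longrightarrow> f i \<in> J) \<Longrightarrow> sum f A \<in> J"
proof -
  note J = assms[unfolded ideal_iff]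
  show "J \<subseteq> C" "0 \<in> J" using J by auto
  show add: "a + b \<in> J" if "a \<in> J" "b \<in> J" for a b using J that by auto
  show mult: "a \<in> J \<Longrightarrow> r \<in> C \<Longrightarrow> r * a \<in> J" for a r using J by auto
  show "a \<in> J \<Longrightarrow> b \<in> J \<Longrightarrow> a - b \<in> J"
    using add[of a "- 1 * b"] mult[of b "- 1"] by auto
  show "(\<And>i. i \<in> A \<Longrightarrow> f i \<in> J) \<Longrightarrow> sum f A \<in> J"
    using J by (induction A rule: infinite_finite_induct) auto
qed

lemma primeideal_iff:
  "primeideal P R \<longleftrightarrow> ideal P R \<and> 1 \<notin> P \<and> (\<forall>a\<in>C. \<forall>b\<in>C. a * b \<in> P \<longrightarrow> a \<in> P \<or> b \<in> P)"
proof
  assume "primeideal P R"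
  then interpret primeideal P R .
  show "ideal P R \<and> 1 \<notin> P \<and> (\<forall>a\<in>C. \<forall>b\<in>C. a * b \<in> P \<longrightarrow> a \<in> P \<or> b \<in> P)"
    using is_ideal I_prime I_notcarr one_imp_carrier by auto
next
  assume P: "ideal P R \<and> 1 \<notin> P \<and> (\<forall>a\<in>C. \<forall>b\<in>C. a * b \<in> P \<longrightarrow> a \<in> P \<or> b \<in> P)"
  then show "primeideal P R"
    by (intro primeidealI cring_R) auto
qed

lemma
  assumes "primeideal P R"
  shows primeideal_imp_ideal: "ideal P R"
    and one_notin_prime: "1 \<notin> P"
    and prime_mult: "a * b \<in> P \<Longrightarrow> a \<in> C \<Longrightarrow> b \<in> C \<Longrightarrow> a \<in> P \<or> b \<in> P"
  using assms unfolding primeideal_iff by blast+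

lemma prime_power: "primeideal P R \<Longrightarrow> a ^ n \<in> P \<Longrightarrow> a \<in> C \<Longrightarrow> a \<in> P"
  using one_notin_prime[of P] prime_mult[of P a] by (induction n) auto

text \<open>
  The ideal generated by an ideal \<open>J\<close> and one more element, in a form without finite sums.
\<close>
definition adjoin :: "'a set \<Rightarrow> 'a \<Rightarrow> 'a set" where
  "adjoin J f = {j + f * r |j r. j \<in> J \<and> r \<in> C}"

lemma ideal_adjoin:
  assumes J: "ideal J R" and f: "f \<in> C"
  shows "ideal (adjoin J f) R"
  unfolding ideal_iff
proof (intro conjI ballI)
  show "adjoin J f \<subseteq> C"
    using ideal_subset[OF J] f by (auto simp: adjoin_def)
  show "0 \<in> adjoin J f"
    using ideal_zero[OF J] by (force simp: adjoin_def)
next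
  fix a b assume "a \<in> adjoin J f" "b \<in> adjoin J f"
  then obtain i j r s where ab: "a = i + f * r" "b = j + f * s" "i \<in> J" "j \<in> J" "r \<in> C" "s \<in> C"
    by (auto simp: adjoin_def)
  have "a + b = (i + j) + f * (r + s)" using ab by (simp add: algebra_simps)
  then show "a + b \<in> adjoin J f"
    using ideal_add[OF J ab(3,4)] ab(5,6) unfolding adjoin_def by blast
next
  fix a s assume "a \<in> adjoin J f" and s: "s \<in> C"
  then obtain i r where a: "a = i + f * r" "i \<in> J" "r \<in> C"
    by (auto simp: adjoin_def)
  have "s * a = s * i + f * (s * r)" using a by (simp add: algebra_simps)
  then show "s * a \<in> adjoin J f"
    using ideal_mult[OF J a(2) s] a(3) s unfolding adjoin_def by blast
qed

lemma subset_adjoin: "J \<subseteq> adjoin J f"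
  unfolding adjoin_def by force

lemma generator_in_adjoin: "ideal J R \<Longrightarrow> f \<in> adjoin J f"
  unfolding adjoin_def using ideal_zero[of J] by force

lemma adjoin_least: "ideal P R \<Longrightarrow> J \<subseteq> P \<Longrightarrow> f \<in> P \<Longrightarrow> adjoin J f \<subseteq> P"
  unfolding adjoin_def using ideal_mult[of P f] ideal_add[of P] by (auto simp: mult.commute)

lemma adjoin_mono: "J \<subseteq> J' \<Longrightarrow> adjoin J f \<subseteq> adjoin J' f"
  unfolding adjoin_def by blast

text \<open>
  The theorem of Krull: an ideal that is maximal among those over \<open>J\<close> that avoid the multiplicative set
  \<open>M\<close> is prime.  Adjoining \<open>a\<close> or \<open>b\<close> outside \<open>P\<close> makes \<open>P\<close> meet \<open>M\<close>, and the product of the two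
  elements of \<open>M\<close> obtained in this way lies in \<open>P\<close> if \<open>a b\<close> does.
\<close>
lemma ex_prime_avoiding:
  assumes J: "ideal J R" and "1 \<in> M" and M: "\<And>a b. a \<in> M \<Longrightarrow> b \<in> M \<Longrightarrow> a * b \<in> M"
    and "J \<inter> M = {}"
  obtains P where "primeideal P R" "J \<subseteq> P" "P \<inter> M = {}"
proof -
  let ?S = "{I. ideal I R \<and> J \<subseteq> I \<and> I \<inter> M = {}}"
  have "\<exists>P\<in>?S. \<forall>X\<in>?S. P \<subseteq> X \<longrightarrow> X = P"
  proof (rule subset_Zorn_nonempty)
    show "?S \<noteq> {}" using J \<open>J \<inter> M = {}\<close> by auto
    fix \<C> assume ne: "\<C> \<noteq> {}" and ch: "subset.chain ?S \<C>"
    then have sub: "\<C> \<subseteq> ?S" and tot: "\<And>X Y. X \<in> \<C> \<Longrightarrow> Y \<in> \<C> \<Longrightarrow> X \<subseteq> Y \<or> Y \<subseteq> X"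
      by (auto simp: subset_chain_def)
    have "ideal (\<Union>\<C>) R"
      unfolding ideal_iff
    proof (intro conjI ballI)
      show "\<Union>\<C> \<subseteq> C" using sub ideal_subset by blast
      show "0 \<in> \<Union>\<C>" using sub ne ideal_zero by blast
      fix a assume "a \<in> \<Union>\<C>"
      then obtain X where X: "X \<in> \<C>" "a \<in> X" by auto
      show "r * a \<in> \<Union>\<C>" if "r \<in> C" for r
        using X ideal_mult[of X a r] that sub by auto
      fix b assume "b \<in> \<Union>\<C>"
      then obtain Y where Y: "Y \<in> \<C>" "b \<in> Y" by auto
      obtain Z where "Z \<in> \<C>" "a \<in> Z" "b \<in> Z" using X Y tot[of X Y] by blast
      then show "a + b \<in> \<Union>\<C>" using ideal_add[of Z a b] sub by auto
    qed
    then show "\<Union>\<C> \<in> ?S" using sub ne by auto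
  qed
  then obtain P where P: "ideal P R" "J \<subseteq> P" "P \<inter> M = {}"
    and max: "\<And>X. ideal X R \<Longrightarrow> X \<inter> M = {} \<Longrightarrow> P \<subseteq> X \<Longrightarrow> X = P" by auto
  have meets: "\<exists>p\<in>P. \<exists>r\<in>C. p + a * r \<in> M" if "a \<in> C" "a \<notin> P" for a
  proof (rule ccontr)
    assume "\<not> (\<exists>p\<in>P. \<exists>r\<in>C. p + a * r \<in> M)"
    then have "adjoin P a \<inter> M = {}" by (auto simp: adjoin_def)
    then have "adjoin P a = P"
      using max ideal_adjoin[OF P(1) that(1)] subset_adjoin by auto
    then show False using generator_in_adjoin[OF P(1)] that(2) by auto
  qed
  have "a \<in> P \<or> b \<in> P" if ab: "a \<in> C" "b \<in> C" "a * b \<in> P" for a b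
  proof (rule ccontr)
    assume "\<not> (a \<in> P \<or> b \<in> P)"
    then obtain p r p' r' where *: "p \<in> P" "r \<in> C" "p + a * r \<in> M" "p' \<in> P" "r' \<in> C" "p' + b * r' \<in> M"
      using meets ab by meson
    have "(p + a * r) * (p' + b * r') = (p' + b * r') * p + (a * r) * p' + (r * r') * (a * b)"
      by (simp add: algebra_simps)
    moreover have "(p' + b * r') * p \<in> P" "a * r * p' \<in> P" "r * r' * (a * b) \<in> P"
      using * ab ideal_subset[OF P(1)] by (auto intro!: ideal_mult[OF P(1)])
    then have "(p' + b * r') * p + (a * r) * p' + (r * r') * (a * b) \<in> P"
      by (intro ideal_add[OF P(1)])
    ultimately show False using M[OF *(3,6)] P(3) by auto
  qed
  moreover have "1 \<notin> P" using P(3) \<open>1 \<in> M\<close> by auto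
  ultimately have "primeideal P R" using P(1) unfolding primeideal_iff by blast
  then show thesis using that P by blast
qed

end

section \<open>Chains of primes and boundary monoids\<close>
text \<open>
  A multiplicative set \<open>U\<close> of units is fixed as the boundary monoid of the empty sequence.  Taking all
  nonzero constants for it, and not only \<open>1\<close>, puts every nonzero polynomial expression in
  \<open>f\<^sub>1, \<dots>, f\<^sub>r\<close> with constant coefficients into the boundary monoid of \<open>f\<^sub>1, \<dots>, f\<^sub>r\<close>.
\<close>
locale unital_subring_with_units = unital_subring +
  fixes U :: "'a set"
  assumes U_subset: "U \<subseteq> C" and one_in_U: "1 \<in> U"
    and U_mult: "\<And>u v. u \<in> U \<Longrightarrow> v \<in> U \<Longrightarrow> u * v \<in> U"
    and U_unit: "\<And>u. u \<in> U \<Longrightarrow> \<exists>v\<in>C. u * v = 1"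
begin

primrec boundary :: "'a list \<Rightarrow> 'a set" where
  "boundary [] = U"
| "boundary (f # fs) = {f ^ a * (u + f * r) |a u r. u \<in> boundary fs \<and> r \<in> C}"

lemma one_in_boundary: "1 \<in> boundary fs"
proof (induction fs)
  case (Cons f fs)
  have "1 = f ^ 0 * (1 + f * 0)" by simp
  with Cons show ?case unfolding boundary.simps by blast
qed (simp add: one_in_U)

lemma boundary_subset: "set fs \<subseteq> C \<Longrightarrow> boundary fs \<subseteq> C"
  using U_subset by (induction fs) auto

lemma boundary_mult:
  "set fs \<subseteq> C \<Longrightarrow> p \<in> boundary fs \<Longrightarrow> q \<in> boundary fs \<Longrightarrow> p * q \<in> boundary fs"
proof (induction fs arbitrary: p q)
  case (Cons f fs)
  then obtain a u r b v s where *: "p = f ^ a * (u + f * r)" "q = f ^ b * (v + f * s)"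
    "u \<in> boundary fs" "v \<in> boundary fs" "r \<in> C" "s \<in> C" by auto
  have "p * q = f ^ (a + b) * (u * v + f * (u * s + v * r + f * (r * s)))"
    using * by (simp add: algebra_simps power_add)
  moreover have "u * s + v * r + f * (r * s) \<in> C"
    using * Cons.prems(1) boundary_subset[of fs] by auto
  moreover have "u * v \<in> boundary fs" using Cons * by auto
  ultimately show ?case unfolding boundary.simps by blast
qed (simp add: U_mult)

text \<open>
  A prime \<open>P\<close> over \<open>J\<close> that avoids the boundary monoid of \<open>f # fs\<close> exists by the theorem of Krull.  Then
  the ideal generated by \<open>P\<close> and \<open>f\<close> avoids the boundary monoid of \<open>fs\<close>: if \<open>p + f r\<close> were in it, then
  \<open>p = (p + f r) - f r\<close> would be an element of \<open>P\<close> in the boundary monoid of \<open>f # fs\<close>.  The inclusions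
  are strict because \<open>f\<close> itself belongs to the boundary monoid of \<open>f # fs\<close>.
\<close>
lemma ex_prime_chain_if_boundary_disjoint:
  "ideal J R \<Longrightarrow> set fs \<subseteq> C \<Longrightarrow> J \<inter> boundary fs = {} \<Longrightarrow>
    \<exists>Ps. length Ps = Suc (length fs) \<and> sorted_wrt (\<subset>) Ps \<and> (\<forall>P\<in>set Ps. primeideal P R \<and> J \<subseteq> P)"
proof (induction fs arbitrary: J)
  case Nil
  obtain P where "primeideal P R" "J \<subseteq> P" "P \<inter> U = {}"
    using Nil by (auto intro: ex_prime_avoiding[OF Nil(1) one_in_U U_mult])
  then show ?case by (intro exI[of _ "[P]"]) auto
next
  case (Cons f fs)
  obtain P where P: "primeideal P R" "J \<subseteq> P" "P \<inter> boundary (f # fs) = {}"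
    using ex_prime_avoiding[OF Cons.prems(1) one_in_boundary _ Cons.prems(3)] boundary_mult Cons.prems(2)
    by metis
  then have idP: "ideal P R" by (simp add: primeideal_imp_ideal)
  have "f = f ^ 1 * (1 + f * 0)" by simp
  then have "f \<in> boundary (f # fs)" using one_in_boundary unfolding boundary.simps by blast
  then have "f \<notin> P" using P(3) by auto
  have "adjoin P f \<inter> boundary fs = {}"
  proof (rule ccontr)
    assume "adjoin P f \<inter> boundary fs \<noteq> {}"
    then obtain p r where *: "p \<in> P" "r \<in> C" "p + f * r \<in> boundary fs" by (auto simp: adjoin_def)
    have "p = f ^ 0 * ((p + f * r) + f * (- r))" by (simp add: algebra_simps)
    then have "p \<in> boundary (f # fs)" using * unfolding boundary.simps by blast
    then show False using P(3) * by auto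
  qed
  with Cons.IH[of "adjoin P f"] Cons.prems(2) ideal_adjoin[OF idP]
  obtain Ps where Ps: "length Ps = Suc (length fs)" "sorted_wrt (\<subset>) Ps"
    "\<forall>Q\<in>set Ps. primeideal Q R \<and> adjoin P f \<subseteq> Q" by auto
  have "P \<subset> Q" if "Q \<in> set Ps" for Q
    using that Ps(3) subset_adjoin[of P f] generator_in_adjoin[OF idP, of f] \<open>f \<notin> P\<close> by blast
  then show ?case using Ps P(1,2)
    by (intro exI[of _ "P # Ps"]) force
qed

text \<open>
  Choose \<open>f\<close> in the second prime \<open>Q\<close> but not in the first prime \<open>P\<close>.  If \<open>u\<close> is not in \<open>Q\<close>, then neither
  is \<open>u + f s\<close>, hence it is not in \<open>P\<close>, and multiplication by powers of \<open>f\<close> stays outside \<open>P\<close>.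
\<close>
lemma ex_boundary_disjoint_if_prime_chain:
  "length Ps = Suc r \<Longrightarrow> sorted_wrt (\<subset>) Ps \<Longrightarrow> (\<forall>P\<in>set Ps. primeideal P R) \<Longrightarrow>
    \<exists>fs. length fs = r \<and> set fs \<subseteq> C \<and> hd Ps \<inter> boundary fs = {}"
proof (induction Ps arbitrary: r)
  case (Cons P Ps)
  have P: "primeideal P R" and idP: "ideal P R"
    using Cons.prems(3) by (simp_all add: primeideal_imp_ideal)
  show ?case
  proof (cases Ps)
    case Nil
    have "u \<notin> P" if "u \<in> U" for u
    proof
      assume "u \<in> P"
      obtain v where "v \<in> C" "u * v = 1" using U_unit[OF \<open>u \<in> U\<close>] by blast
      then have "1 \<in> P" using ideal_mult[OF idP \<open>u \<in> P\<close>, of v] by (simp add: mult.commute)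
      then show False using one_notin_prime[OF P] by simp
    qed
    then have "hd (P # Ps) \<inter> boundary [] = {}" by auto
    moreover have "length [] = r" using Cons.prems(1) Nil by simp
    ultimately show ?thesis by (intro exI[of _ "[]"]) simp
  next
    case Ps: (Cons Q Qs)
    then obtain r' where r: "r = Suc r'" using Cons.prems(1) by (cases r) auto
    have "primeideal Q R" "P \<subset> Q"
      using Ps Cons.prems(2,3) by simp_all
    then have idQ: "ideal Q R" by (simp add: primeideal_imp_ideal)
    have "length Ps = Suc r'" "sorted_wrt (\<subset>) Ps" "\<forall>P\<in>set Ps. primeideal P R"
      using Cons.prems r by simp_all
    from Cons.IH[OF this] obtain fs where fs: "length fs = r'" "set fs \<subseteq> C" "Q \<inter> boundary fs = {}"
      unfolding Ps list.sel by blast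
    obtain f where f: "f \<in> Q" "f \<notin> P" using \<open>P \<subset> Q\<close> by auto
    then have "f \<in> C" using ideal_subset[OF idQ] by auto
    have "f ^ a * (u + f * s) \<notin> P" if "u \<in> boundary fs" "s \<in> C" for a u s
    proof
      assume mem: "f ^ a * (u + f * s) \<in> P"
      have u: "u \<in> C" "u \<notin> Q" using that(1) fs(3) boundary_subset[OF fs(2)] by blast+
      have "f ^ a \<notin> P" using prime_power[OF P _ \<open>f \<in> C\<close>] f(2) by blast
      then have "u + f * s \<in> P" using prime_mult[OF P mem] \<open>f \<in> C\<close> u that(2) by auto
      then have "u + f * s - s * f \<in> Q"
        using \<open>P \<subset> Q\<close> f that by (intro ideal_diff[OF idQ] ideal_mult[OF idQ]) auto
      then show False using u by (simp add: mult.commute)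
    qed
    then have "hd (P # Ps) \<inter> boundary (f # fs) = {}" by auto
    moreover have "length (f # fs) = r" "set (f # fs) \<subseteq> C" using fs(1,2) \<open>f \<in> C\<close> r by auto
    ultimately show ?thesis by blast
  qed
qed simp

end

section \<open>Polynomials and their truncation\<close>
definition polys :: "'v set \<Rightarrow> ('v, 'k::comm_ring_1) mpoly set" where
  "polys V = {p. \<forall>m \<in> Poly_Mapping.keys p. Poly_Mapping.keys m \<subseteq> V}"

lemma poly_ring_eq:
  "poly_ring V = \<lparr>carrier = polys V, mult = (*), one = 1, zero = 0, add = (+)\<rparr>"
  by (simp add: poly_ring_def polys_def)

definition constants :: "('v, 'k::field) mpoly set" where
  "constants = {Poly_Mapping.single 0 c |c. c \<noteq> 0}"

lemma keys_plus_nat: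
  fixes m m' :: "'v \<Rightarrow>\<^sub>0 nat"
  shows "Poly_Mapping.keys (m + m') = Poly_Mapping.keys m \<union> Poly_Mapping.keys m'"
  by (auto simp: in_keys_iff lookup_add)

lemma monom_degree_add: "monom_degree (m + m') = monom_degree m + monom_degree m'"
proof -
  have *: "monom_degree n = (\<Sum>v\<in>Poly_Mapping.keys m \<union> Poly_Mapping.keys m'. Poly_Mapping.lookup n v)"
    if "Poly_Mapping.keys n \<subseteq> Poly_Mapping.keys m \<union> Poly_Mapping.keys m'" for n :: "'a \<Rightarrow>\<^sub>0 nat"
    unfolding monom_degree_def using that
    by (intro sum.mono_neutral_left) (auto simp: in_keys_iff)
  show ?thesis
    using *[of m] *[of m'] *[of "m + m'"]
    by (simp add: keys_plus_nat lookup_add sum.distrib)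
qed

lemma monom_degree_0 [simp]: "monom_degree 0 = 0"
  by (simp add: monom_degree_def)

lemma poly_eq_sum_monomials:
  fixes p :: "'a \<Rightarrow>\<^sub>0 'b::comm_monoid_add"
  shows "p = (\<Sum>m\<in>Poly_Mapping.keys p. Poly_Mapping.single m (Poly_Mapping.lookup p m))"
proof (rule poly_mapping_eqI)
  fix k
  show "Poly_Mapping.lookup p k =
    Poly_Mapping.lookup (\<Sum>m\<in>Poly_Mapping.keys p. Poly_Mapping.single m (Poly_Mapping.lookup p m)) k"
    by (simp add: lookup_sum lookup_single when_def in_keys_iff)
qed

lemma lookup_monomial_mult:
  fixes p :: "('v, 'k::comm_ring_1) mpoly"
  shows "Poly_Mapping.lookup (Poly_Mapping.single m c * p) (m + k) = c * Poly_Mapping.lookup p k"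
proof -
  have "Poly_Mapping.single m c * p =
    (\<Sum>n\<in>Poly_Mapping.keys p. Poly_Mapping.single (m + n) (c * Poly_Mapping.lookup p n))"
    by (subst poly_eq_sum_monomials[of p]) (simp only: sum_distrib_left mult_single)
  then show ?thesis
    by (simp add: lookup_sum lookup_single when_def in_keys_iff)
qed

lemma lookup_scale:
  fixes p :: "('v, 'k::comm_ring_1) mpoly"
  shows "Poly_Mapping.lookup (Poly_Mapping.single 0 c * p) k = c * Poly_Mapping.lookup p k"
  using lookup_monomial_mult[of 0 c p k] by simp

interpretation mpoly: vector_space "\<lambda>(c::'k::field) (p::('v, 'k) mpoly). Poly_Mapping.single 0 c * p"
proof
  fix a b :: 'k and x y :: "('v, 'k) mpoly"
  show "Poly_Mapping.single 0 a * (x + y) = Poly_Mapping.single 0 a * x + Poly_Mapping.single 0 a * y"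
    by (rule distrib_left)
  show "Poly_Mapping.single 0 (a + b) * x = Poly_Mapping.single 0 a * x + Poly_Mapping.single 0 b * x"
    by (simp only: single_add distrib_right)
  show "Poly_Mapping.single 0 a * (Poly_Mapping.single 0 b * x) = Poly_Mapping.single 0 (a * b) * x"
    by (simp only: mult.assoc[symmetric] mult_single add_0_left)
  show "Poly_Mapping.single 0 1 * x = x"
    by (simp only: single_one mult_1_left)
qed

text \<open>
  The sum of the homogeneous components of degree at most \<open>t\<close>.
\<close>
definition deg_truncate :: "nat \<Rightarrow> ('v, 'k::comm_ring_1) mpoly \<Rightarrow> ('v, 'k) mpoly" where
  "deg_truncate t p = Poly_Mapping.mapp (\<lambda>m c. c when monom_degree m \<le> t) p"

lemma lookup_deg_truncate:
  "Poly_Mapping.lookup (deg_truncate t p) m = (Poly_Mapping.lookup p m when monom_degree m \<le> t)"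
  by (auto simp: deg_truncate_def lookup_mapp when_def in_keys_iff)

lemma keys_deg_truncate:
  "Poly_Mapping.keys (deg_truncate t p) = {m \<in> Poly_Mapping.keys p. monom_degree m \<le> t}"
  by (auto simp: in_keys_iff lookup_deg_truncate)

lemma deg_truncate_add: "deg_truncate t (p + q) = deg_truncate t p + deg_truncate t q"
  by (rule poly_mapping_eqI) (simp add: lookup_deg_truncate lookup_add when_def)

lemma deg_truncate_eq_self:
  "(\<And>m. m \<in> Poly_Mapping.keys p \<Longrightarrow> monom_degree m \<le> t) \<Longrightarrow> deg_truncate t p = p"
  by (rule poly_mapping_eqI) (auto simp: lookup_deg_truncate when_def in_keys_iff)

lemma deg_truncate_eq_zero:
  "(\<And>m. m \<in> Poly_Mapping.keys p \<Longrightarrow> t < monom_degree m) \<Longrightarrow> deg_truncate t p = 0"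
  by (rule poly_mapping_eqI) (force simp: lookup_deg_truncate when_def in_keys_iff)

text \<open>
  Multiplication by a form of degree \<open>e\<close> shifts the grading by \<open>e\<close>.  This is what allows to control the
  degree of a cofactor in an ideal that is generated by forms.
\<close>
lemma deg_truncate_mult_homogeneous:
  assumes "homogeneous e f"
  shows "deg_truncate t (f * p) = (if t < e then 0 else f * deg_truncate (t - e) p)"
proof (cases "t < e")
  case True
  have "t < monom_degree m" if "m \<in> Poly_Mapping.keys (f * p)" for m
    using that keys_mult[of f p] assms True by (fastforce simp: homogeneous_def monom_degree_add)
  then show ?thesis using True by (simp add: deg_truncate_eq_zero)
next
  case False
  let ?q = "deg_truncate (t - e) p"
  have "deg_truncate t (f * ?q) = f * ?q"
  proof (rule deg_truncate_eq_self)
    fix m assume "m \<in> Poly_Mapping.keys (f * ?q)"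
    then show "monom_degree m \<le> t"
      using keys_mult[of f ?q] assms False
      by (fastforce simp: homogeneous_def monom_degree_add keys_deg_truncate)
  qed
  moreover have "deg_truncate t (f * (p - ?q)) = 0"
  proof (rule deg_truncate_eq_zero)
    fix m assume m: "m \<in> Poly_Mapping.keys (f * (p - ?q))"
    have "t - e < monom_degree k" if "k \<in> Poly_Mapping.keys (p - ?q)" for k
      using that by (auto simp: in_keys_iff lookup_minus lookup_deg_truncate when_def split: if_splits)
    then show "t < monom_degree m"
      using m keys_mult[of f "p - ?q"] assms False
      by (fastforce simp: homogeneous_def monom_degree_add)
  qed
  moreover have "f * p = f * ?q + f * (p - ?q)" by (simp add: algebra_simps)
  ultimately show ?thesis using False by (simp add: deg_truncate_add)
qed

text \<open>
  More vectors than the size of a spanning set are linearly dependent.  The vectors form a family, not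
  a set, so that two equal members count as dependent.
\<close>
lemma ex_coeffs_if_card_less:
  fixes w :: "'i \<Rightarrow> ('v, 'k::field) mpoly"
  assumes "finite A" "finite B" "card B < card A" and w: "\<And>i. i \<in> A \<Longrightarrow> w i \<in> mpoly.span B"
  obtains c where "\<exists>i\<in>A. c i \<noteq> 0" "(\<Sum>i\<in>A. Poly_Mapping.single 0 (c i) * w i) = 0"
proof (cases "inj_on w A")
  case True
  have "mpoly.dependent (w ` A)"
  proof (rule ccontr)
    assume "mpoly.independent (w ` A)"
    then have "card (w ` A) \<le> card B"
      using mpoly.independent_span_bound[OF \<open>finite B\<close>] w by blast
    then show False using assms(3) card_image[OF True] by simp
  qed
  then obtain u where u: "\<exists>v\<in>w ` A. u v \<noteq> 0" "(\<Sum>v\<in>w ` A. Poly_Mapping.single 0 (u v) * v) = 0"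
    using mpoly.dependent_finite[of "w ` A"] \<open>finite A\<close> by auto
  show thesis
  proof
    show "\<exists>i\<in>A. (u \<circ> w) i \<noteq> 0" using u(1) by auto
    show "(\<Sum>i\<in>A. Poly_Mapping.single 0 ((u \<circ> w) i) * w i) = 0"
      using u(2) sum.reindex[OF True, of "\<lambda>v. Poly_Mapping.single 0 (u v) * v"] by (simp add: o_def)
  qed
next
  case False
  then obtain i j where ij: "i \<in> A" "j \<in> A" "i \<noteq> j" "w i = w j" by (auto simp: inj_on_def)
  let ?c = "\<lambda>x. if x = i then 1 else if x = j then - 1 else 0 :: 'k"
  show thesis
  proof
    show "\<exists>x\<in>A. ?c x \<noteq> 0" using ij by auto
    have "(\<Sum>x\<in>A. Poly_Mapping.single 0 (?c x) * w x) =
      (\<Sum>x\<in>A. (if x = i then w x else 0) - (if x = j then w x else 0))"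
      using ij by (intro sum.cong) (auto simp: single_uminus)
    also have "\<dots> = 0" using ij \<open>finite A\<close> by (simp add: sum_subtractf)
    finally show "(\<Sum>x\<in>A. Poly_Mapping.single 0 (?c x) * w x) = 0" .
  qed
qed

text \<open>
  The parameter \<open>K\<close> only fixes the field of coefficients.
\<close>
locale poly_vars =
  fixes V :: "'v set" and K :: "'k::field itself"
  assumes finite_V: "finite V"
begin

abbreviation C :: "('v, 'k) mpoly set" where "C \<equiv> polys V"

lemma single_in_C: "Poly_Mapping.keys m \<subseteq> V \<Longrightarrow> Poly_Mapping.single m c \<in> C"
  by (auto simp: polys_def)

lemma const_in_C [simp, intro]: "Poly_Mapping.single 0 c \<in> C"
  by (rule single_in_C) simp

sublocale unital_subring_with_units C constants
proof
  show "1 \<in> C" using const_in_C[of 1] by simp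
  show "- p \<in> C" if "p \<in> C" for p :: "('v, 'k) mpoly" 
    using that by (auto simp: polys_def in_keys_iff)
  show "p + q \<in> C" if "p \<in> C" "q \<in> C" for p q :: "('v, 'k) mpoly" 
    using that Poly_Mapping.keys_add[of p q] by (auto simp: polys_def)
  show "p * q \<in> C" if "p \<in> C" "q \<in> C" for p q :: "('v, 'k) mpoly" 
  proof -
    have "Poly_Mapping.keys m \<subseteq> V" if m: "m \<in> Poly_Mapping.keys (p * q)" for m
    proof -
      obtain a b where "m = a + b" "a \<in> Poly_Mapping.keys p" "b \<in> Poly_Mapping.keys q"
        using m keys_mult[of p q] by blast
      then show ?thesis using \<open>p \<in> C\<close> \<open>q \<in> C\<close> by (simp add: polys_def keys_plus_nat)
    qed
    then show ?thesis by (simp add: polys_def)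
  qed
  show "constants \<subseteq> C" by (auto simp: constants_def)
  show "1 \<in> constants" unfolding constants_def using single_one zero_neq_one by (smt (verit) mem_Collect_eq)
  show "u * v \<in> constants" if "u \<in> constants" "v \<in> constants" for u v :: "('v, 'k) mpoly" 
    using that by (auto simp: constants_def mult_single)
  show "\<exists>v\<in>C. u * v = 1" if u: "u \<in> constants" for u :: "('v, 'k) mpoly" 
  proof -
    obtain c where "u = Poly_Mapping.single 0 c" "c \<noteq> 0" using u by (auto simp: constants_def)
    then have "u * Poly_Mapping.single 0 (inverse c) = 1" by (simp add: mult_single)
    then show ?thesis using const_in_C by blast
  qed
qed

lemma poly_ring_eq_R: "poly_ring V = R"
  by (rule poly_ring_eq)

lemma deg_truncate_in_C [intro]: "p \<in> C \<Longrightarrow> deg_truncate t p \<in> C"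
  by (simp add: polys_def keys_deg_truncate)

definition polys_upto :: "nat \<Rightarrow> ('v, 'k) mpoly set" where
  "polys_upto t = {p \<in> C. \<forall>m\<in>Poly_Mapping.keys p. monom_degree m \<le> t}"

lemma deg_truncate_polys_upto: "p \<in> polys_upto t \<Longrightarrow> deg_truncate t p = p"
  by (rule deg_truncate_eq_self) (simp add: polys_upto_def)

lemma deg_truncate_in_polys_upto: "p \<in> C \<Longrightarrow> deg_truncate t p \<in> polys_upto t"
  by (simp add: polys_upto_def polys_def keys_deg_truncate)

lemma polys_upto_mult:
  assumes "p \<in> polys_upto s" "q \<in> polys_upto t"
  shows "p * q \<in> polys_upto (s + t)"
proof -
  have "monom_degree m \<le> s + t" if m: "m \<in> Poly_Mapping.keys (p * q)" for m
  proof -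
    obtain a b where "m = a + b" "a \<in> Poly_Mapping.keys p" "b \<in> Poly_Mapping.keys q"
      using m keys_mult[of p q] by blast
    then show ?thesis using assms by (simp add: polys_upto_def monom_degree_add add_mono)
  qed
  then show ?thesis using assms by (auto simp: polys_upto_def)
qed

lemma homogeneous_in_polys_upto: "homogeneous e f \<Longrightarrow> f \<in> C \<Longrightarrow> f \<in> polys_upto e"
  by (simp add: polys_upto_def homogeneous_def)

lemma polys_upto_mono: "s \<le> t \<Longrightarrow> polys_upto s \<subseteq> polys_upto t"
  by (auto simp: polys_upto_def)

lemma subspace_polys_upto: "mpoly.subspace (polys_upto t)"
proof (rule mpoly.subspaceI)
  show "0 \<in> polys_upto t" by (simp add: polys_upto_def polys_def)
  show "x + y \<in> polys_upto t" if "x \<in> polys_upto t" "y \<in> polys_upto t" for x y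
    using that Poly_Mapping.keys_add[of x y] by (auto simp: polys_upto_def)
  show "Poly_Mapping.single 0 c * x \<in> polys_upto t" if "x \<in> polys_upto t" for c x
  proof -
    have "Poly_Mapping.single 0 c \<in> polys_upto 0" by (auto simp: polys_upto_def)
    from polys_upto_mult[OF this that] show ?thesis by simp
  qed
qed

text \<open>
  Closure under truncation is equivalent to being homogeneous: differences of consecutive truncations
  are the homogeneous components.
\<close>
definition graded :: "('v, 'k) mpoly set \<Rightarrow> bool" where
  "graded J \<longleftrightarrow> ideal J R \<and> (\<forall>p\<in>J. \<forall>t. deg_truncate t p \<in> J)"

lemma graded_ideal: "graded J \<Longrightarrow> ideal J R"
  by (simp add: graded_def)

lemma graded_zero: "graded {0}"
proof -
  have "deg_truncate t 0 = 0" for t :: nat by (rule deg_truncate_eq_zero) simp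
  moreover have "ideal {0} R" unfolding ideal_iff by simp
  ultimately show ?thesis unfolding graded_def by blast
qed

lemma graded_adjoin:
  assumes J: "graded J" and f: "f \<in> C" "homogeneous e f"
  shows "graded (adjoin J f)"
  unfolding graded_def
proof (intro conjI ballI allI)
  show "ideal (adjoin J f) R" by (rule ideal_adjoin) (use J f in \<open>simp_all add: graded_ideal\<close>)
  fix p t assume "p \<in> adjoin J f"
  then obtain j r where p: "p = j + f * r" "j \<in> J" "r \<in> C" by (auto simp: adjoin_def)
  have "deg_truncate t p = deg_truncate t j + f * (if t < e then 0 else deg_truncate (t - e) r)"
    using f by (simp add: p deg_truncate_add deg_truncate_mult_homogeneous)
  moreover have "deg_truncate t j \<in> J" using J p by (simp add: graded_def)
  moreover have "(if t < e then 0 else deg_truncate (t - e) r) \<in> C" using p by auto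
  ultimately show "deg_truncate t p \<in> adjoin J f" unfolding adjoin_def by blast
qed

definition colon :: "('v, 'k) mpoly set \<Rightarrow> ('v, 'k) mpoly \<Rightarrow> ('v, 'k) mpoly set" where
  "colon J f = {p \<in> C. f * p \<in> J}"

lemma graded_colon:
  assumes J: "graded J" and f: "f \<in> C" "homogeneous e f"
  shows "graded (colon J f)"
  unfolding graded_def ideal_iff
proof (intro conjI ballI allI)
  note I = graded_ideal[OF J]
  show "colon J f \<subseteq> C" by (auto simp: colon_def)
  show "0 \<in> colon J f" using ideal_zero[OF I] by (simp add: colon_def)
  show "p + q \<in> colon J f" if "p \<in> colon J f" "q \<in> colon J f" for p q
    using that ideal_add[OF I, of "f * p" "f * q"] by (auto simp: colon_def distrib_left)
  show "r * p \<in> colon J f" if "p \<in> colon J f" "r \<in> C" for p r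
    using that ideal_mult[OF I, of "f * p" r] by (auto simp: colon_def mult.left_commute)
  show "deg_truncate t p \<in> colon J f" if p: "p \<in> colon J f" for p t
  proof -
    have "deg_truncate (t + e) (f * p) \<in> J" using p J by (simp add: graded_def colon_def)
    then have "f * deg_truncate t p \<in> J" using f by (simp add: deg_truncate_mult_homogeneous)
    then show ?thesis using p by (auto simp: colon_def)
  qed
qed

lemma subset_colon: "ideal J R \<Longrightarrow> f \<in> C \<Longrightarrow> J \<subseteq> colon J f"
  using ideal_subset[of J] ideal_mult[of J _ f] by (auto simp: colon_def)

section \<open>Growth of graded quotients\<close>
text \<open>
  The dimension of the image in \<open>R/J\<close> of the polynomials of degree at most \<open>t\<close> is at most \<open>n\<close>.  A spanning
  set avoids quotient spaces and their dimensions.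
\<close>
definition spanned_mod :: "('v, 'k) mpoly set \<Rightarrow> nat \<Rightarrow> nat \<Rightarrow> bool" where
  "spanned_mod J t n \<longleftrightarrow> (\<exists>B. finite B \<and> card B \<le> n \<and> B \<subseteq> polys_upto t \<and>
     (\<forall>p\<in>polys_upto t. \<exists>b\<in>mpoly.span B. p - b \<in> J))"

lemma spanned_mod_mono:
  "spanned_mod J t n \<Longrightarrow> J \<subseteq> J' \<Longrightarrow> n \<le> n' \<Longrightarrow> spanned_mod J' t n'"
  unfolding spanned_mod_def by (meson le_trans subsetD)

text \<open>
  The exact sequence \<open>0 \<rightarrow> R/(J : f) \<rightarrow> R/J \<rightarrow> R/(J, f) \<rightarrow> 0\<close>, whose first map is multiplication by the
  form \<open>f\<close>, in degrees at most \<open>t\<close>: spanning elements for the two ends combine to spanning elements for the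
  middle.  The cofactor of \<open>f\<close> can be truncated at \<open>t - e\<close> because \<open>J\<close> is graded.
\<close>
lemma spanned_mod_step:
  assumes J: "graded J" and f: "f \<in> C" "homogeneous e f"
    and n: "spanned_mod (adjoin J f) t n"
    and n': "t < e \<or> spanned_mod (colon J f) (t - e) n'"
  shows "spanned_mod J t (if t < e then n else n + n')"
proof -
  obtain B where B: "finite B" "card B \<le> n" "B \<subseteq> polys_upto t"
    "\<And>p. p \<in> polys_upto t \<Longrightarrow> \<exists>b\<in>mpoly.span B. p - b \<in> adjoin J f"
    using n unfolding spanned_mod_def by blast
  have decomp: "\<exists>b\<in>mpoly.span B. \<exists>j\<in>J. \<exists>r\<in>C. p - b = j + f * (if t < e then 0 else deg_truncate (t - e) r)"
    if p: "p \<in> polys_upto t" for p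
  proof -
    obtain b where b: "b \<in> mpoly.span B" "p - b \<in> adjoin J f" using B(4)[OF p] by blast
    then obtain j r where jr: "p - b = j + f * r" "j \<in> J" "r \<in> C" by (auto simp: adjoin_def)
    have "b \<in> polys_upto t"
      using mpoly.span_minimal[OF B(3) subspace_polys_upto] b by auto
    then have "p - b \<in> polys_upto t"
      using mpoly.subspace_diff[OF subspace_polys_upto p] by auto
    then have "p - b = deg_truncate t (j + f * r)"
      unfolding jr(1)[symmetric] by (simp add: deg_truncate_polys_upto)
    also have "\<dots> = deg_truncate t j + f * (if t < e then 0 else deg_truncate (t - e) r)"
      using f by (simp add: deg_truncate_add deg_truncate_mult_homogeneous)
    finally show ?thesis using b(1) jr J unfolding graded_def by blast
  qed
  show ?thesis
  proof (cases "t < e")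
    case True
    have "\<exists>b\<in>mpoly.span B. p - b \<in> J" if "p \<in> polys_upto t" for p
      using decomp[OF that] True by auto
    then show ?thesis using B True unfolding spanned_mod_def by auto
  next
    case False
    then obtain B' where B': "finite B'" "card B' \<le> n'" "B' \<subseteq> polys_upto (t - e)"
      "\<And>p. p \<in> polys_upto (t - e) \<Longrightarrow> \<exists>b\<in>mpoly.span B'. p - b \<in> colon J f"
      using n' unfolding spanned_mod_def by blast
    let ?B = "B \<union> (*) f ` B'"
    have "finite ?B" using B B' by simp
    moreover have "card ?B \<le> n + n'"
      using card_Un_le[of B "(*) f ` B'"] card_image_le[OF B'(1), of "(*) f"] B(2) B'(2) by linarith
    moreover have "?B \<subseteq> polys_upto t"
      using B(3) B'(3) polys_upto_mult[OF homogeneous_in_polys_upto[OF f(2,1)], of _ "t - e"] False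
      by auto
    moreover have "\<exists>b\<in>mpoly.span ?B. p - b \<in> J" if p: "p \<in> polys_upto t" for p
    proof -
      obtain b j r where bjr: "b \<in> mpoly.span B" "j \<in> J" "r \<in> C" "p - b = j + f * deg_truncate (t - e) r"
        using decomp[OF p] False by auto
      obtain b' where b': "b' \<in> mpoly.span B'" "deg_truncate (t - e) r - b' \<in> colon J f"
        using B'(4) deg_truncate_in_polys_upto[OF bjr(3)] by blast
      have "mpoly.subspace {x. f * x \<in> mpoly.span ?B}"
        by (rule mpoly.subspaceI)
          (auto simp: mpoly.span_zero distrib_left mult.left_commute[of f] mpoly.span_add mpoly.span_scale)
      moreover have "B' \<subseteq> {x. f * x \<in> mpoly.span ?B}"
        by (auto intro: mpoly.span_base)
      ultimately have "f * b' \<in> mpoly.span ?B"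
        using mpoly.span_minimal b'(1) by blast
      moreover have "b \<in> mpoly.span ?B"
        using bjr(1) mpoly.span_mono[of B ?B] by auto
      ultimately have "b + f * b' \<in> mpoly.span ?B" by (rule mpoly.span_add[rotated])
      moreover have "p - (b + f * b') = j + f * (deg_truncate (t - e) r - b')"
        using bjr(4) by (simp add: algebra_simps)
      moreover have "\<dots> \<in> J"
        using b'(2) bjr(2) ideal_add[OF graded_ideal[OF J]] by (simp add: colon_def)
      ultimately show ?thesis by metis
    qed
    ultimately have "spanned_mod J t (n + n')" unfolding spanned_mod_def by blast
    then show ?thesis using False by simp
  qed
qed

text \<open>
  The growth \<open>t\<^bsup>m - 1\<^esup>\<close> of a graded ring of dimension \<open>m - 1\<close>, shifted by one so that \<open>m = 0\<close> describes the
  zero ring.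
\<close>
primrec dim_bound :: "nat \<Rightarrow> nat \<Rightarrow> nat" where
  "dim_bound 0 t = 0"
| "dim_bound (Suc m) t = (t + 1) ^ m"

definition growth_below :: "('v, 'k) mpoly set \<Rightarrow> nat \<Rightarrow> bool" where
  "growth_below J m \<longleftrightarrow> (\<exists>c. \<forall>t. spanned_mod J t (c * dim_bound m t))"

lemma growth_below_mono: "growth_below J m \<Longrightarrow> J \<subseteq> J' \<Longrightarrow> growth_below J' m"
  unfolding growth_below_def using spanned_mod_mono by blast

lemma dim_bound_step: "dim_bound m t + t ^ m \<le> (t + 1) ^ m"
proof (cases m)
  case (Suc m')
  have "t * t ^ m' \<le> t * (t + 1) ^ m'" by (intro mult_left_mono power_mono) auto
  then show ?thesis by (simp add: Suc)
qed simp

text \<open>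
  Since \<open>J \<subseteq> J : f\<close>, the spanning number for \<open>J\<close> in degree \<open>t\<close> is at most that for \<open>(J, f)\<close> in degree \<open>t\<close>
  plus that for \<open>J\<close> in degree \<open>t - e\<close>.  Summation over \<open>t\<close> raises the exponent by one.  The inequality
  \<open>dim_bound_step\<close> performs this summation without a loss in the constant.
\<close>
lemma growth_below_if_adjoin:
  assumes J: "graded J" and f: "f \<in> C" "homogeneous e f" "0 < e"
    and "growth_below (adjoin J f) m"
  shows "growth_below J (Suc m)"
proof -
  obtain c where c: "\<And>t. spanned_mod (adjoin J f) t (c * dim_bound m t)"
    using assms(5) unfolding growth_below_def by blast
  have "spanned_mod J t (c * (t + 1) ^ m)" for t
  proof (induction t rule: less_induct)
    case (less t)
    have step: "c * dim_bound m t + c * t ^ m \<le> c * (t + 1) ^ m"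
      unfolding distrib_left[symmetric] by (intro mult_le_mono2 dim_bound_step)
    show ?case
    proof (cases "t < e")
      case True
      then have "spanned_mod J t (c * dim_bound m t)"
        using spanned_mod_step[OF J f(1,2) c, of t 0] by simp
      then show ?thesis
        using step by (rule spanned_mod_mono[OF _ subset_refl add_leD1])
    next
      case False
      then have "t - e < t" using f(3) by auto
      have "spanned_mod (colon J f) (t - e) (c * (t - e + 1) ^ m)"
        using spanned_mod_mono[OF less[OF \<open>t - e < t\<close>] subset_colon[OF graded_ideal[OF J] f(1)]] by simp
      then have "spanned_mod J t (c * dim_bound m t + c * (t - e + 1) ^ m)"
        using spanned_mod_step[OF J f(1,2) c, of t "c * (t - e + 1) ^ m"] False by simp
      moreover have "c * (t - e + 1) ^ m \<le> c * t ^ m"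
        using False f(3) by (intro mult_left_mono power_mono) auto
      then have "c * dim_bound m t + c * (t - e + 1) ^ m \<le> c * (t + 1) ^ m"
        using step by linarith
      ultimately show ?thesis by (rule spanned_mod_mono[OF _ subset_refl])
    qed
  qed
  then show ?thesis unfolding growth_below_def by auto
qed

lemma dim_bound_mono: "s \<le> t \<Longrightarrow> dim_bound m s \<le> dim_bound m t"
  by (cases m) (auto intro: power_mono)

lemma growth_below_if_adjoin_colon:
  assumes J: "graded J" and f: "f \<in> C" "homogeneous e f"
    and "growth_below (adjoin J f) m" "growth_below (colon J f) m"
  shows "growth_below J m"
proof -
  obtain c c' where c: "\<And>t. spanned_mod (adjoin J f) t (c * dim_bound m t)"
    and c': "\<And>t. spanned_mod (colon J f) t (c' * dim_bound m t)"
    using assms(4,5) unfolding growth_below_def by blast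
  have "spanned_mod J t ((c + c') * dim_bound m t)" for t
  proof -
    have "c' * dim_bound m (t - e) \<le> c' * dim_bound m t"
      by (intro mult_left_mono dim_bound_mono) auto
    then have "(if t < e then c * dim_bound m t else c * dim_bound m t + c' * dim_bound m (t - e))
      \<le> (c + c') * dim_bound m t"
      by (simp add: distrib_right)
    moreover have "t < e \<or> spanned_mod (colon J f) (t - e) (c' * dim_bound m (t - e))"
      using c' by blast
    ultimately show ?thesis
      using spanned_mod_mono[OF spanned_mod_step[OF J f c]] by blast
  qed
  then show ?thesis unfolding growth_below_def by blast
qed

end

lemma poly_var_power:
  "(poly_var v :: ('v, 'k::comm_ring_1) mpoly) ^ n = Poly_Mapping.single (Poly_Mapping.single v n) 1"
  by (induction n) (simp_all add: poly_var_def mult_single flip: single_add)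

text \<open>
  A polynomial in \<open>q\<close> of degree \<open>m\<close> does not bound \<open>(q + 1)\<^bsup>m + 1\<^esup>\<close>.
\<close>
lemma power_growth_contradiction:
  fixes c E m :: nat
  assumes "\<And>q. (q + 1) ^ Suc m \<le> c * (q * E + 1) ^ m"
  shows False
proof -
  \<comment> \<open>chosen so that the right-hand side is at most \<open>q * (q + 1) ^ m\<close>\<close>
  define q where "q = c * (E + 1) ^ m"
  have "(q * E + 1) ^ m \<le> ((E + 1) * (q + 1)) ^ m"
    by (intro power_mono) (auto simp: algebra_simps)
  then have "c * (q * E + 1) ^ m \<le> c * ((E + 1) * (q + 1)) ^ m" by (rule mult_le_mono2)
  also have "\<dots> = q * (q + 1) ^ m" by (simp only: q_def power_mult_distrib mult.assoc)
  finally have "(q + 1) ^ Suc m \<le> q * (q + 1) ^ m" using assms[of q] by linarith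
  then have "(q + 1) * (q + 1) ^ m \<le> q * (q + 1) ^ m" by simp
  then show False by (subst (asm) mult_le_cancel2) simp
qed

context poly_vars
begin

text \<open>
  Positive degrees are essential in the recursion on the degree: a form of degree zero would not decrease it.
\<close>
definition positive_forms :: "('v, 'k) mpoly list \<Rightarrow> bool" where
  "positive_forms fs \<longleftrightarrow> (\<forall>f\<in>set fs. f \<in> C \<and> (\<exists>e>0. homogeneous e f))"

lemma positive_forms_Cons:
  "positive_forms (f # fs) \<longleftrightarrow> (f \<in> C \<and> (\<exists>e>0. homogeneous e f)) \<and> positive_forms fs"
  by (simp add: positive_forms_def)

lemma positive_forms_subset: "positive_forms fs \<Longrightarrow> set fs \<subseteq> C"
  by (auto simp: positive_forms_def)

lemma graded_foldl_adjoin: "graded J \<Longrightarrow> positive_forms fs \<Longrightarrow> graded (foldl adjoin J fs)"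
proof (induction fs arbitrary: J)
  case (Cons f fs)
  obtain e where "f \<in> C" "homogeneous e f" "positive_forms fs"
    using Cons.prems(2) unfolding positive_forms_Cons by blast
  then show ?case using Cons.IH graded_adjoin[OF Cons.prems(1)] by simp
qed simp

lemma foldl_adjoin_mono: "J \<subseteq> J' \<Longrightarrow> foldl adjoin J fs \<subseteq> foldl adjoin J' fs"
proof (induction fs arbitrary: J J')
  case (Cons f fs)
  then show ?case using adjoin_mono[OF Cons.prems] by simp
qed simp

lemma subset_foldl_adjoin: "J \<subseteq> foldl adjoin J fs"
proof (induction fs arbitrary: J)
  case (Cons f fs)
  show ?case using subset_adjoin[of J f] Cons.IH[of "adjoin J f"] by simp
qed simp

lemma generators_in_foldl_adjoin:
  "ideal J R \<Longrightarrow> set fs \<subseteq> C \<Longrightarrow> set fs \<subseteq> foldl adjoin J fs"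
proof (induction fs arbitrary: J)
  case (Cons f fs)
  have "ideal (adjoin J f) R" using Cons.prems by (intro ideal_adjoin) auto
  then have "set fs \<subseteq> foldl adjoin (adjoin J f) fs" using Cons by simp
  moreover have "f \<in> foldl adjoin (adjoin J f) fs"
    using generator_in_adjoin[OF Cons.prems(1)] subset_foldl_adjoin by blast
  ultimately show ?case by simp
qed simp

lemma foldl_adjoin_least:
  "ideal P R \<Longrightarrow> J \<subseteq> P \<Longrightarrow> set fs \<subseteq> P \<Longrightarrow> foldl adjoin J fs \<subseteq> P"
proof (induction fs arbitrary: J)
  case (Cons f fs)
  have "adjoin J f \<subseteq> P" using adjoin_least[OF Cons.prems(1,2)] Cons.prems(3) by simp
  then show ?case using Cons by simp
qed simp

lemma growth_below_foldl_adjoin: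
  "graded J \<Longrightarrow> positive_forms fs \<Longrightarrow> growth_below (foldl adjoin J fs) m \<Longrightarrow>
    growth_below J (m + length fs)"
proof (induction fs arbitrary: J)
  case (Cons f fs)
  obtain e where f: "f \<in> C" "homogeneous e f" "0 < e" and fs: "positive_forms fs"
    using Cons.prems(2) unfolding positive_forms_Cons by blast
  have "growth_below (adjoin J f) (m + length fs)"
    using Cons.IH[OF graded_adjoin[OF Cons.prems(1) f(1,2)] fs] Cons.prems(3) by simp
  then show ?case using growth_below_if_adjoin[OF Cons.prems(1) f] by simp
qed simp

lemma growth_below_0_if_constant:
  assumes J: "ideal J R" and u: "u \<in> J" "u \<in> constants"
  shows "growth_below J 0"
proof -
  obtain v where "v \<in> C" "u * v = 1" using U_unit[OF u(2)] by blast
  then have one: "1 \<in> J" using ideal_mult[OF J u(1), of v] by (simp add: mult.commute)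
  have "p \<in> J" if "p \<in> C" for p using ideal_mult[OF J one that] by simp
  then have "spanned_mod J t 0" for t
    unfolding spanned_mod_def
    by (intro exI[of _ "{}"]) (auto simp: polys_upto_def mpoly.span_empty)
  then show ?thesis unfolding growth_below_def by simp
qed

text \<open>
  Let \<open>f\<^sup>a (u + f r)\<close> be in \<open>J\<close>, with \<open>u\<close> in the boundary monoid of the remaining forms.  If \<open>a = 0\<close>, then \<open>u\<close>
  lies in \<open>(J, f)\<close>, the induction hypothesis applies to \<open>(J, f)\<close>, and removing \<open>f\<close> costs one.  If
  \<open>a > 0\<close>, then \<open>f\<^bsup>a - 1\<^esup> (u + f r)\<close> lies in \<open>J : f\<close>, and \<open>R/J\<close> is composed of \<open>R/(J : f)\<close> and \<open>R/(J, f)\<close>.  The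
  growth of the latter is small enough because one form less is needed to make it
  finite-dimensional.
\<close>
lemma growth_below_if_boundary_meets:
  "graded J \<Longrightarrow> positive_forms fs \<Longrightarrow> growth_below (foldl adjoin J fs) 1 \<Longrightarrow>
    J \<inter> boundary fs \<noteq> {} \<Longrightarrow> growth_below J (length fs)"
proof (induction fs arbitrary: J)
  case Nil
  then obtain u where "u \<in> J" "u \<in> constants" by auto
  then show ?case
    using growth_below_0_if_constant[OF graded_ideal[OF Nil(1)]] by simp
next
  case (Cons f fs)
  obtain e where f: "f \<in> C" "homogeneous e f" "0 < e" and fs: "positive_forms fs"
    using Cons.prems(2) unfolding positive_forms_Cons by blast
  have main: "growth_below J (Suc (length fs))"
    if "graded J" "growth_below (foldl adjoin (adjoin J f) fs) 1"
      "f ^ a * (u + f * r) \<in> J" "u \<in> boundary fs" "r \<in> C" for J a u r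
    using that
  proof (induction a arbitrary: J)
    case 0
    have "u + f * r \<in> J" using 0 by simp
    moreover have "u = (u + f * r) + f * (- r)" by (simp add: algebra_simps)
    ultimately have "u \<in> adjoin J f" using 0(5) unfolding adjoin_def by blast
    then have "growth_below (adjoin J f) (length fs)"
      using 0(4) by (intro Cons.IH graded_adjoin[OF 0(1) f(1,2)] fs 0(2)) blast
    then show ?case by (rule growth_below_if_adjoin[OF 0(1) f])
  next
    case (Suc a)
    have J: "ideal J R" using Suc.prems(1) by (rule graded_ideal)
    have u: "u \<in> C" using boundary_subset[OF positive_forms_subset[OF fs]] Suc.prems(4) by blast
    have "growth_below (adjoin J f) (1 + length fs)"
      by (rule growth_below_foldl_adjoin[OF graded_adjoin[OF Suc.prems(1) f(1,2)] fs Suc.prems(2)])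
    moreover have "growth_below (colon J f) (Suc (length fs))"
    proof (rule Suc.IH[OF graded_colon[OF Suc.prems(1) f(1,2)] _ _ Suc.prems(4,5)])
      show "growth_below (foldl adjoin (adjoin (colon J f) f) fs) 1"
        using growth_below_mono[OF Suc.prems(2) foldl_adjoin_mono[OF adjoin_mono[OF subset_colon[OF J f(1)]]]] .
      have "f ^ a * (u + f * r) \<in> C"
        using f(1) u Suc.prems(5) by (intro mult_in add_in power_in)
      then show "f ^ a * (u + f * r) \<in> colon J f"
        using Suc.prems(3) by (simp add: colon_def mult.assoc)
    qed
    ultimately show ?case
      using growth_below_if_adjoin_colon[OF Suc.prems(1) f(1,2)] by simp
  qed
  obtain p where "p \<in> J" "p \<in> boundary (f # fs)" using Cons.prems(4) by blast
  then obtain a u r where "f ^ a * (u + f * r) \<in> J" "u \<in> boundary fs" "r \<in> C" by auto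
  then show ?case using main[OF Cons.prems(1)] Cons.prems(3) by simp
qed

section \<open>Growth bounds the length of chains\<close>
definition power_product :: "('v, 'k) mpoly list \<Rightarrow> nat list \<Rightarrow> ('v, 'k) mpoly" where
  "power_product fs as = prod_list (map2 (^) fs as)"

lemma power_product_Cons: "power_product (f # fs) (a # as) = f ^ a * power_product fs as"
  by (simp add: power_product_def)

lemma power_product_in_C: "set fs \<subseteq> C \<Longrightarrow> power_product fs as \<in> C"
proof (induction fs arbitrary: as)
  case (Cons f fs)
  then show ?case
    by (cases as) (auto simp: power_product_Cons power_product_def[of "_ # _" "[]"] intro!: mult_in)
qed (simp add: power_product_def)

definition exponents :: "nat \<Rightarrow> nat \<Rightarrow> nat list set" where
  "exponents q r = {as. set as \<subseteq> {..q} \<and> length as = r}"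

lemma finite_exponents: "finite (exponents q r)"
  unfolding exponents_def by (rule finite_lists_length_eq) simp

lemma card_exponents: "card (exponents q r) = (q + 1) ^ r"
  unfolding exponents_def by (subst card_lists_length_eq) simp_all

lemma exponents_0: "exponents q 0 = {[]}"
  by (auto simp: exponents_def)

lemma exponents_Suc: "exponents q (Suc r) = (\<lambda>(a, as). a # as) ` ({..q} \<times> exponents q r)"
  by (auto simp: exponents_def length_Suc_conv image_iff)

text \<open>
  Order a nonzero polynomial expression by powers of the first element \<open>f\<close> and factor out the lowest
  power that occurs.  Its coefficient is a nonzero expression in the remaining elements, so the
  expression has the shape \<open>f\<^sup>a (u + f r)\<close> that defines the boundary monoid.
\<close>
lemma combination_in_boundary:
  "set fs \<subseteq> C \<Longrightarrow> \<exists>as\<in>exponents q (length fs). c as \<noteq> 0 \<Longrightarrow>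
    (\<Sum>as\<in>exponents q (length fs). Poly_Mapping.single 0 (c as) * power_product fs as) \<in> boundary fs"
proof (induction fs arbitrary: c)
  case Nil
  then have "Poly_Mapping.single 0 (c []) \<in> constants" by (auto simp: exponents_0 constants_def)
  then show ?case by (simp add: exponents_0 power_product_def)
next
  case (Cons f fs)
  let ?E = "exponents q (length fs)"
  define S where "S a = (\<Sum>as\<in>?E. Poly_Mapping.single 0 (c (a # as)) * power_product fs as)" for a
  have f: "f \<in> C" and fs: "set fs \<subseteq> C" using Cons.prems(1) by auto
  have S_in: "S a \<in> C" for a
    unfolding S_def using power_product_in_C[OF fs] by (intro sum_in mult_in) auto
  have "inj_on (\<lambda>(a, as). a # as) ({..q} \<times> ?E)" by (auto simp: inj_on_def)
  then have "(\<Sum>as\<in>exponents q (length (f # fs)). Poly_Mapping.single 0 (c as) * power_product (f # fs) as)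
    = (\<Sum>(a, as)\<in>{..q} \<times> ?E. Poly_Mapping.single 0 (c (a # as)) * power_product (f # fs) (a # as))"
    by (simp add: exponents_Suc sum.reindex case_prod_unfold)
  also have "\<dots> = (\<Sum>a\<le>q. f ^ a * S a)"
    by (simp add: sum.cartesian_product[symmetric] S_def sum_distrib_left power_product_Cons mult.left_commute)
  finally have sum_eq: "(\<Sum>as\<in>exponents q (length (f # fs)).
    Poly_Mapping.single 0 (c as) * power_product (f # fs) as) = (\<Sum>a\<le>q. f ^ a * S a)" .
  let ?P = "\<lambda>a. a \<le> q \<and> (\<exists>as\<in>?E. c (a # as) \<noteq> 0)"
  obtain a where "?P a" using Cons.prems(2) by (auto simp: exponents_Suc)
  \<comment> \<open>the lowest power of \<open>f\<close> with a nonzero coefficient\<close>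
  define a0 where "a0 = (LEAST a. ?P a)"
  have a0: "?P a0" unfolding a0_def by (rule LeastI) fact
  have min: "\<not> ?P a" if "a < a0" for a using not_less_Least that unfolding a0_def by blast
  have "S a = 0" if "a < a0" for a
  proof -
    have "\<forall>as\<in>?E. c (a # as) = 0" using min[OF that] a0 that by auto
    then show ?thesis unfolding S_def by (intro sum.neutral) simp
  qed
  then have "(\<Sum>a\<le>q. f ^ a * S a) = (\<Sum>a\<in>{a0..q}. f ^ a * S a)"
    by (intro sum.mono_neutral_right) auto
  also have "\<dots> = f ^ a0 * S a0 + (\<Sum>a\<in>{Suc a0..q}. f ^ a * S a)"
    using a0 by (simp add: sum.atLeast_Suc_atMost)
  also have "(\<Sum>a\<in>{Suc a0..q}. f ^ a * S a) = f ^ a0 * (f * (\<Sum>a\<in>{Suc a0..q}. f ^ (a - Suc a0) * S a))"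
    unfolding sum_distrib_left
  proof (rule sum.cong)
    fix a assume "a \<in> {Suc a0..q}"
    then have "f ^ a = f ^ a0 * f * f ^ (a - Suc a0)"
      by (metis atLeastAtMost_iff le_add_diff_inverse power_add power_Suc2)
    then show "f ^ a * S a = f ^ a0 * (f * (f ^ (a - Suc a0) * S a))" by (simp add: mult.assoc)
  qed simp
  also have "f ^ a0 * S a0 + f ^ a0 * (f * (\<Sum>a\<in>{Suc a0..q}. f ^ (a - Suc a0) * S a)) =
    f ^ a0 * (S a0 + f * (\<Sum>a\<in>{Suc a0..q}. f ^ (a - Suc a0) * S a))"
    by (rule distrib_left[symmetric])
  finally have "(\<Sum>a\<le>q. f ^ a * S a) =
    f ^ a0 * (S a0 + f * (\<Sum>a\<in>{Suc a0..q}. f ^ (a - Suc a0) * S a))" .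
  moreover have "S a0 \<in> boundary fs"
    unfolding S_def using Cons.IH[OF fs, of "\<lambda>as. c (a0 # as)"] a0 by blast
  moreover have "(\<Sum>a\<in>{Suc a0..q}. f ^ (a - Suc a0) * S a) \<in> C"
    using f S_in by (intro sum_in mult_in power_in)
  ultimately show ?case unfolding sum_eq boundary.simps by blast
qed

lemma polys_upto_power: "p \<in> polys_upto s \<Longrightarrow> p ^ n \<in> polys_upto (n * s)"
proof (induction n)
  case 0
  have "1 \<in> polys_upto 0" by (simp add: polys_upto_def)
  then show ?case by simp
next
  case (Suc n)
  then show ?case using polys_upto_mult[of p s "p ^ n" "n * s"] by simp
qed

lemma power_product_in_polys_upto:
  "set fs \<subseteq> polys_upto s \<Longrightarrow> as \<in> exponents q (length fs) \<Longrightarrow>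
    power_product fs as \<in> polys_upto (length fs * (q * s))"
proof (induction fs arbitrary: as)
  case Nil
  then show ?case by (simp add: power_product_def polys_upto_def)
next
  case (Cons f fs)
  obtain a bs where as: "as = a # bs" "a \<le> q" "bs \<in> exponents q (length fs)"
    using Cons.prems(2) by (auto simp: exponents_Suc)
  have "f ^ a \<in> polys_upto (a * s)" using Cons.prems by (intro polys_upto_power) auto
  moreover have "a * s \<le> q * s" using as(2) by simp
  ultimately have "f ^ a \<in> polys_upto (q * s)" using polys_upto_mono by blast
  moreover have "power_product fs bs \<in> polys_upto (length fs * (q * s))"
    using Cons as by simp
  ultimately show ?case
    using polys_upto_mult[of "f ^ a" "q * s"] by (simp add: as power_product_Cons)
qed

lemma ex_polys_upto:
  assumes "finite F" "F \<subseteq> C"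
  shows "\<exists>s. F \<subseteq> polys_upto s"
proof -
  have "\<exists>s. p \<in> polys_upto s" if "p \<in> C" for p
    using that unfolding polys_upto_def
    by (intro exI[of _ "\<Sum>m\<in>Poly_Mapping.keys p. monom_degree m"]) (auto intro: member_le_sum)
  then obtain s where s: "p \<in> polys_upto (s p)" if "p \<in> C" for p by metis
  have "p \<in> polys_upto (\<Sum>p\<in>F. s p)" if "p \<in> F" for p
    using polys_upto_mono[OF member_le_sum[OF that, of s]] s that assms by auto
  then show ?thesis by blast
qed

text \<open>
  The \<open>(q + 1)\<^sup>r\<close> monomials in \<open>f\<^sub>1, \<dots>, f\<^sub>r\<close> with exponents at most \<open>q\<close> have degree \<open>O(q)\<close>.  A linear dependence
  modulo \<open>J\<close> would be an element of \<open>J\<close> in the boundary monoid, so \<open>(q + 1)\<^sup>r = O(q\<^bsup>m - 1\<^esup>)\<close>.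
\<close>
lemma length_less_if_boundary_disjoint:
  assumes J: "ideal J R" and fs: "set fs \<subseteq> C" and disj: "J \<inter> boundary fs = {}"
    and "growth_below J m"
  shows "length fs < m"
proof -
  obtain c where c: "\<And>t. spanned_mod J t (c * dim_bound m t)"
    using assms(4) unfolding growth_below_def by blast
  obtain s where s: "set fs \<subseteq> polys_upto s" using ex_polys_upto[of "set fs"] fs by auto
  let ?r = "length fs"
  have count: "(q + 1) ^ ?r \<le> c * dim_bound m (q * (?r * s))" for q
  proof (rule ccontr)
    let ?t = "?r * (q * s)" and ?A = "exponents q ?r"
    assume "\<not> (q + 1) ^ ?r \<le> c * dim_bound m (q * (?r * s))"
    then have less: "c * dim_bound m ?t < card ?A"
      by (simp add: card_exponents mult.left_commute)
    obtain B where B: "finite B" "card B \<le> c * dim_bound m ?t"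
      "\<And>p. p \<in> polys_upto ?t \<Longrightarrow> \<exists>b\<in>mpoly.span B. p - b \<in> J"
      using c[of ?t] unfolding spanned_mod_def by blast
    have "\<forall>as\<in>?A. \<exists>b. b \<in> mpoly.span B \<and> power_product fs as - b \<in> J"
      using B(3) power_product_in_polys_upto[OF s] by blast
    then obtain w where w: "\<And>as. as \<in> ?A \<Longrightarrow> w as \<in> mpoly.span B"
      "\<And>as. as \<in> ?A \<Longrightarrow> power_product fs as - w as \<in> J" by metis
    have "card B < card ?A" using B(2) less by linarith
    then obtain d where d: "\<exists>as\<in>?A. d as \<noteq> 0"
      "(\<Sum>as\<in>?A. Poly_Mapping.single 0 (d as) * w as) = 0"
      by (rule ex_coeffs_if_card_less[where w = w, OF finite_exponents B(1) _ w(1)])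
    have "(\<Sum>as\<in>?A. Poly_Mapping.single 0 (d as) * (power_product fs as - w as)) \<in> J"
      using w(2) by (intro ideal_sum[OF J] ideal_mult[OF J]) auto
    then have "(\<Sum>as\<in>?A. Poly_Mapping.single 0 (d as) * power_product fs as) \<in> J"
      using d(2) by (simp add: right_diff_distrib sum_subtractf)
    then show False using combination_in_boundary[OF fs, of q d] d(1) disj by blast
  qed
  show ?thesis
  proof (rule ccontr)
    assume "\<not> ?r < m"
    show False
    proof (cases m)
      case 0
      then show False using count[of 0] by simp
    next
      case (Suc m')
      have "(q + 1) ^ Suc m' \<le> c * (q * (?r * s) + 1) ^ m'" for q
      proof -
        have "(q + 1) ^ Suc m' \<le> (q + 1) ^ ?r"
          using \<open>\<not> ?r < m\<close> Suc by (intro power_increasing) auto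
        also note count[of q]
        finally show ?thesis by (simp add: Suc)
      qed
      then show False by (rule power_growth_contradiction)
    qed
  qed
qed

section \<open>A criterion for homogeneous systems of parameters\<close>
lemma poly_var_in_C: "v \<in> V \<Longrightarrow> poly_var v \<in> C"
  unfolding poly_var_def by (rule single_in_C) simp

text \<open>
  Modulo \<open>J\<close> only the finitely many monomials whose exponents stay below the nilpotency orders survive.
\<close>
lemma growth_below_1_if_variables_nilpotent:
  assumes J: "ideal J R" and nil: "\<And>v. v \<in> V \<Longrightarrow> \<exists>n. poly_var v ^ n \<in> J"
  shows "growth_below J 1"
proof -
  obtain N where N: "\<And>v. v \<in> V \<Longrightarrow> poly_var v ^ N v \<in> J" using nil by metis
  define box where
    "box = {m. Poly_Mapping.keys m \<subseteq> V \<and> (\<forall>v\<in>V. Poly_Mapping.lookup m v < N v)}"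
  have "finite (Poly_Mapping.lookup ` box)"
  proof (rule finite_subset)
    show "Poly_Mapping.lookup ` box \<subseteq>
      {g. \<forall>v. (v \<in> V \<longrightarrow> g v \<in> {..<sum N V}) \<and> (v \<notin> V \<longrightarrow> g v = 0)}"
    proof clarify
      fix m v assume m: "m \<in> box"
      have "Poly_Mapping.lookup m v < sum N V" if "v \<in> V"
      proof -
        have "Poly_Mapping.lookup m v < N v" using m that unfolding box_def by blast
        also have "N v \<le> sum N V" using that finite_V by (intro member_le_sum) simp_all
        finally show ?thesis .
      qed
      moreover have "Poly_Mapping.lookup m v = 0" if "v \<notin> V"
      proof -
        have "v \<notin> Poly_Mapping.keys m" using m that unfolding box_def by blast
        then show ?thesis by (simp add: in_keys_iff)
      qed
      ultimately show "(v \<in> V \<longrightarrow> Poly_Mapping.lookup m v \<in> {..<sum N V}) \<and>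
        (v \<notin> V \<longrightarrow> Poly_Mapping.lookup m v = 0)" by simp
    qed
    show "finite {g. \<forall>v. (v \<in> V \<longrightarrow> g v \<in> {..<sum N V}) \<and> (v \<notin> V \<longrightarrow> g v = (0::nat))}"
      using finite_V by (rule finite_set_of_finite_funs) simp
  qed
  moreover have "inj_on Poly_Mapping.lookup box" by (intro inj_onI poly_mapping_eqI) simp
  ultimately have fin: "finite box" by (rule finite_imageD)
  have outside: "Poly_Mapping.single m c \<in> J" if m: "Poly_Mapping.keys m \<subseteq> V" "m \<notin> box" for m c
  proof -
    obtain v where v: "v \<in> V" "N v \<le> Poly_Mapping.lookup m v"
      using m unfolding box_def by (auto simp: not_less)
    define n where "n = m - Poly_Mapping.single v (N v)"
    have eq: "m = n + Poly_Mapping.single v (N v)"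
      unfolding n_def using v(2)
      by (intro poly_mapping_eqI) (auto simp: lookup_add lookup_minus lookup_single when_def)
    have "Poly_Mapping.keys n \<subseteq> V" using m(1) unfolding eq keys_plus_nat by blast
    then have "Poly_Mapping.single n c * poly_var v ^ N v \<in> J"
      by (intro ideal_mult[OF J N[OF v(1)]] single_in_C)
    then show ?thesis unfolding eq by (simp add: poly_var_power mult_single)
  qed
  have "spanned_mod J t (card box * dim_bound 1 t)" for t
    unfolding spanned_mod_def
  proof (intro exI conjI ballI)
    let ?B = "(\<lambda>m. Poly_Mapping.single m 1) ` {m \<in> box. monom_degree m \<le> t}"
    show "finite ?B" using fin by simp
    have "card ?B \<le> card {m \<in> box. monom_degree m \<le> t}" using fin by (intro card_image_le) simp
    also have "\<dots> \<le> card box" using fin by (intro card_mono) auto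
    finally show "card ?B \<le> card box * dim_bound 1 t" by simp
    show "?B \<subseteq> polys_upto t"
      by (auto simp: polys_upto_def box_def intro!: single_in_C)
    fix p assume p: "p \<in> polys_upto t"
    let ?s = "\<lambda>m. Poly_Mapping.single m (Poly_Mapping.lookup p m)"
    let ?in = "Poly_Mapping.keys p \<inter> box" and ?out = "Poly_Mapping.keys p - box"
    have "Poly_Mapping.single 0 (Poly_Mapping.lookup p m) * Poly_Mapping.single m 1 \<in> mpoly.span ?B"
      if "m \<in> ?in" for m
      using that p by (intro mpoly.span_scale mpoly.span_base) (auto simp: polys_upto_def)
    then have in_span: "(\<Sum>m\<in>?in. ?s m) \<in> mpoly.span ?B"
      by (intro mpoly.span_sum) (simp only: mult_single add_0_left mult_1_right)
    have rest: "p - (\<Sum>m\<in>?in. ?s m) = (\<Sum>m\<in>?out. ?s m)"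
    proof -
      have "p = (\<Sum>m\<in>?in \<union> ?out. ?s m)"
        unfolding Int_Diff_Un by (rule poly_eq_sum_monomials)
      also have "\<dots> = (\<Sum>m\<in>?in. ?s m) + (\<Sum>m\<in>?out. ?s m)"
        by (rule sum.union_disjoint) auto
      finally have eq: "p = (\<Sum>m\<in>?in. ?s m) + (\<Sum>m\<in>?out. ?s m)" .
      show ?thesis unfolding diff_eq_eq by (subst add.commute) (fact eq)
    qed
    have "(\<Sum>m\<in>?out. ?s m) \<in> J"
      using p outside by (intro ideal_sum[OF J]) (auto simp: polys_upto_def polys_def)
    then have "p - (\<Sum>m\<in>?in. ?s m) \<in> J" unfolding rest .
    with in_span show "\<exists>b\<in>mpoly.span ?B. p - b \<in> J" by (rule bexI[rotated])
  qed
  then show ?thesis unfolding growth_below_def by blast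
qed

text \<open>
  The prime ideal generated by the variables in \<open>S\<close>.
\<close>
definition vanishing :: "'v set \<Rightarrow> ('v, 'k) mpoly set" where
  "vanishing S = {p. \<forall>m\<in>Poly_Mapping.keys p. Poly_Mapping.keys m \<inter> S \<noteq> {}}"

text \<open>
  The ideals generated by initial segments of the variables form a chain, and the next variable is
  regular modulo each of them: multiplication by a variable outside \<open>S\<close> only shifts the monomials.
\<close>
lemma boundary_variables_disjoint_vanishing:
  "distinct vs \<Longrightarrow> set vs \<inter> S = {} \<Longrightarrow> p \<in> boundary (map poly_var vs) \<Longrightarrow> p \<notin> vanishing S"
proof (induction vs arbitrary: S p)
  case Nil
  then have "p \<in> constants" by simp
  then obtain c where c: "p = Poly_Mapping.single 0 c" "c \<noteq> 0" unfolding constants_def by blast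
  then show ?case by (simp add: vanishing_def)
next
  case (Cons v vs)
  obtain a u r where p: "p = poly_var v ^ a * (u + poly_var v * r)" and u: "u \<in> boundary (map poly_var vs)"
    using Cons.prems(3) by auto
  have IH: "u \<notin> vanishing (insert v S)"
    using Cons.prems by (intro Cons.IH u) auto
  show ?case
  proof
    assume "p \<in> vanishing S"
    have "Poly_Mapping.keys m \<inter> insert v S \<noteq> {}" if m: "m \<in> Poly_Mapping.keys u" for m
    proof (cases "v \<in> Poly_Mapping.keys m")
      case False
      let ?v = "\<lambda>n. Poly_Mapping.single v n"
      have "Poly_Mapping.lookup (poly_var v * r) m = 0"
      proof (rule ccontr)
        assume "Poly_Mapping.lookup (poly_var v * r) m \<noteq> 0"
        then have "m \<in> Poly_Mapping.keys (poly_var v * r)" by (simp add: in_keys_iff)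
        then obtain n where "m = ?v 1 + n"
          using keys_mult[of "poly_var v" r] by (auto simp: poly_var_def)
        then show False using False by (simp add: keys_plus_nat)
      qed
      then have "Poly_Mapping.lookup (u + poly_var v * r) m \<noteq> 0"
        using m by (simp add: lookup_add in_keys_iff)
      then have "?v a + m \<in> Poly_Mapping.keys p"
        by (simp add: p in_keys_iff poly_var_power lookup_monomial_mult)
      then have "Poly_Mapping.keys (?v a + m) \<inter> S \<noteq> {}"
        using \<open>p \<in> vanishing S\<close> by (simp add: vanishing_def)
      moreover have "Poly_Mapping.keys (?v a) \<inter> S = {}"
        using Cons.prems(2) by (auto split: if_splits)
      ultimately show ?thesis by (auto simp: keys_plus_nat)
    qed auto
    then show False using IH by (simp add: vanishing_def)
  qed
qed

lemma zero_notin_boundary_variables: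
  "distinct vs \<Longrightarrow> 0 \<notin> boundary (map poly_var vs)"
  using boundary_variables_disjoint_vanishing[of vs "{}" 0] by (auto simp: vanishing_def)

text \<open>
  The ideal generated by all variables.
\<close>
definition irrelevant :: "('v, 'k) mpoly set" where
  "irrelevant = {p \<in> C. Poly_Mapping.lookup p 0 = 0}"

lemma lookup_mult_0:
  "Poly_Mapping.lookup (p * q) 0 = Poly_Mapping.lookup p 0 * Poly_Mapping.lookup q 0"
  for p q :: "('v, 'k) mpoly"
proof -
  let ?c = "Poly_Mapping.single 0 (Poly_Mapping.lookup p 0)"
  let ?p = "p - ?c"
  have "p * q = ?p * q + ?c * q" by (simp add: algebra_simps)
  have "0 \<notin> Poly_Mapping.keys (?p * q)"
  proof
    assume "0 \<in> Poly_Mapping.keys (?p * q)"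
    then obtain a b where ab: "0 = a + b" "a \<in> Poly_Mapping.keys ?p"
      using keys_mult[of ?p q] by blast
    have "Poly_Mapping.keys a = {}" using keys_plus_nat[of a b] ab(1) by simp
    then have "a = 0" by (auto simp: in_keys_iff intro: poly_mapping_eqI)
    then show False using ab(2) by (simp add: in_keys_iff lookup_minus)
  qed
  then have "Poly_Mapping.lookup (?p * q) 0 = 0" by (simp add: in_keys_iff)
  then show ?thesis
    unfolding \<open>p * q = ?p * q + ?c * q\<close> lookup_add lookup_scale by simp
qed

lemma prime_irrelevant: "primeideal irrelevant R"
  unfolding primeideal_iff ideal_iff
  by (auto simp: irrelevant_def lookup_add lookup_mult_0)

lemma positive_form_in_irrelevant:
  assumes "f \<in> C" "homogeneous e f" "0 < e"
  shows "f \<in> irrelevant"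
proof -
  have "0 \<notin> Poly_Mapping.keys f" using assms by (force simp: homogeneous_def)
  then show ?thesis using assms by (simp add: irrelevant_def in_keys_iff)
qed

lemma prime_eq_irrelevant:
  assumes P: "primeideal P R" and vars: "\<And>v. v \<in> V \<Longrightarrow> poly_var v \<in> P"
  shows "P = irrelevant"
proof
  have I: "ideal P R" using P by (rule primeideal_imp_ideal)
  show sub: "irrelevant \<subseteq> P"
  proof
    fix p assume p: "p \<in> irrelevant"
    have "Poly_Mapping.single m (Poly_Mapping.lookup p m) \<in> P" if m: "m \<in> Poly_Mapping.keys p" for m
    proof -
      have mV: "Poly_Mapping.keys m \<subseteq> V" using p m by (auto simp: irrelevant_def polys_def)
      have "m \<noteq> 0" using p m by (auto simp: irrelevant_def in_keys_iff)
      then obtain v where v: "v \<in> Poly_Mapping.keys m"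
        by (metis all_not_in_conv in_keys_iff lookup_zero poly_mapping_eqI)
      define n where "n = m - Poly_Mapping.single v 1"
      have eq: "m = n + Poly_Mapping.single v 1"
        unfolding n_def using v by (intro poly_mapping_eqI)
          (auto simp: lookup_add lookup_minus lookup_single when_def in_keys_iff)
      have "Poly_Mapping.keys n \<subseteq> V" using mV unfolding eq keys_plus_nat by blast
      then have "Poly_Mapping.single n c * poly_var v \<in> P" for c
        using v mV vars by (intro ideal_mult[OF I] single_in_C) auto
      then show ?thesis unfolding eq by (simp add: poly_var_def mult_single)
    qed
    then show "p \<in> P" by (subst poly_eq_sum_monomials) (rule ideal_sum[OF I])
  qed
  show "P \<subseteq> irrelevant"
  proof (rule ccontr)
    assume "\<not> P \<subseteq> irrelevant"
    then obtain p where p: "p \<in> P" "p \<notin> irrelevant" by blast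
    then have "p \<in> C" using ideal_subset[OF I] by blast
    let ?c = "Poly_Mapping.single 0 (Poly_Mapping.lookup p 0)"
    have "?c \<in> constants" using p \<open>p \<in> C\<close> by (auto simp: irrelevant_def constants_def)
    then obtain v where v: "v \<in> C" "?c * v = 1" using U_unit by blast
    have "p - ?c \<in> irrelevant" using \<open>p \<in> C\<close> by (auto simp: irrelevant_def lookup_minus)
    then have "p - (p - ?c) \<in> P" using ideal_diff[OF I p(1)] sub by blast
    then have "v * ?c \<in> P" using ideal_mult[OF I _ v(1)] by simp
    then show False using v(2) one_notin_prime[OF P] by (simp add: mult.commute)
  qed
qed

lemma ideal_foldl_adjoin: "ideal J R \<Longrightarrow> set fs \<subseteq> C \<Longrightarrow> ideal (foldl adjoin J fs) R"
proof (induction fs arbitrary: J)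
  case (Cons f fs)
  then show ?case using ideal_adjoin[of J f] by simp
qed simp

lemma genideal_eq_foldl_adjoin:
  assumes "set hs \<subseteq> C"
  shows "genideal R (set hs) = foldl adjoin {0} hs"
proof
  interpret cring R by (rule cring_R)
  have zero: "ideal {0} R" using graded_zero by (rule graded_ideal)
  show "genideal R (set hs) \<subseteq> foldl adjoin {0} hs"
    by (intro genideal_minimal ideal_foldl_adjoin zero assms generators_in_foldl_adjoin)
  have "ideal (genideal R (set hs)) R" using genideal_ideal assms by simp
  then show "foldl adjoin {0} hs \<subseteq> genideal R (set hs)"
    using foldl_adjoin_least ideal_zero genideal_self[of "set hs"] assms by simp
qed

lemma ex_power_in_ideal:
  assumes J: "ideal J R" and x: "x \<in> C" and primes: "\<And>P. primeideal P R \<Longrightarrow> J \<subseteq> P \<Longrightarrow> x \<in> P"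
  shows "\<exists>n. x ^ n \<in> J"
proof (rule ccontr)
  assume none: "\<nexists>n. x ^ n \<in> J"
  have "1 \<in> range (\<lambda>n. x ^ n)" using power_0[of x] by (metis rangeI)
  moreover have "a * b \<in> range (\<lambda>n. x ^ n)" if "a \<in> range (\<lambda>n. x ^ n)" "b \<in> range (\<lambda>n. x ^ n)" for a b
  proof -
    obtain m n where "a = x ^ m" "b = x ^ n" using \<open>a \<in> _\<close> \<open>b \<in> _\<close> by blast
    then have "a * b = x ^ (m + n)" by (simp only: power_add)
    then show ?thesis by blast
  qed
  moreover have "J \<inter> range (\<lambda>n. x ^ n) = {}" using none by auto
  ultimately obtain P where P: "primeideal P R" "J \<subseteq> P" "P \<inter> range (\<lambda>n. x ^ n) = {}"
    by (rule ex_prime_avoiding[OF J])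
  have "x \<in> P" using primes[OF P(1,2)] .
  moreover have "x \<in> range (\<lambda>n. x ^ n)" using power_one_right[of x] by (metis rangeI)
  ultimately show False using P(3) by blast
qed

text \<open>
  Upper bound: the quotient by \<open>hs\<close> and \<open>fs\<close> is finite-dimensional, so that \<open>growth_below I (length fs + 1)\<close>
  bounds the length of chains.  Lower bound: if the boundary monoid of \<open>fs\<close> met \<open>I\<close>, the growth of \<open>R/I\<close>
  would be one less, and removing \<open>hs\<close> would give the polynomial ring a growth that is too small for
  its \<open>length hs + length fs\<close> variables.
\<close>
lemma krull_dim_Quot_parameters:
  assumes hs: "positive_forms hs" and fs: "positive_forms fs" and len: "length hs + length fs = card V"
    and vars: "\<And>P v. primeideal P R \<Longrightarrow> set hs \<subseteq> P \<Longrightarrow> set fs \<subseteq> P \<Longrightarrow> v \<in> V \<Longrightarrow> poly_var v \<in> P"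
  shows "krull_dim (R Quot (foldl adjoin {0} hs)) = ereal (real (length fs))"
proof -
  define I where "I = foldl adjoin {0} hs"
  have graded_I: "graded I" unfolding I_def by (intro graded_foldl_adjoin graded_zero hs)
  then have idI: "ideal I R" by (rule graded_ideal)
  have hs_I: "set hs \<subseteq> I"
    unfolding I_def
    by (intro generators_in_foldl_adjoin graded_ideal[OF graded_zero] positive_forms_subset hs)
  have growth_1: "growth_below (foldl adjoin I fs) 1"
  proof (rule growth_below_1_if_variables_nilpotent)
    show id: "ideal (foldl adjoin I fs) R"
      by (intro ideal_foldl_adjoin idI positive_forms_subset fs)
    have "set hs \<subseteq> foldl adjoin I fs" "set fs \<subseteq> foldl adjoin I fs"
      using hs_I subset_foldl_adjoin generators_in_foldl_adjoin[OF idI positive_forms_subset[OF fs]]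
      by blast+
    then show "\<exists>n. poly_var v ^ n \<in> foldl adjoin I fs" if "v \<in> V" for v
      using vars that by (intro ex_power_in_ideal[OF id] poly_var_in_C) blast+
  qed
  have growth_I: "growth_below I (Suc (length fs))"
    using growth_below_foldl_adjoin[OF graded_I fs growth_1] by simp
  have "I \<inter> boundary fs = {}"
  proof (rule ccontr)
    assume "I \<inter> boundary fs \<noteq> {}"
    then have "growth_below I (length fs)"
      by (rule growth_below_if_boundary_meets[OF graded_I fs growth_1])
    then have "growth_below {0} (length fs + length hs)"
      unfolding I_def by (rule growth_below_foldl_adjoin[OF graded_zero hs])
    then have "growth_below {0} (card V)"
      using len by (simp only: add.commute[of "length fs"])
    moreover obtain vs where vs: "set vs = V" "distinct vs"
      using finite_distinct_list[OF finite_V] by blast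
    moreover have "{0} \<inter> boundary (map poly_var vs) = {}"
      using zero_notin_boundary_variables[OF vs(2)] by blast
    moreover have "set (map poly_var vs) \<subseteq> C" using vs(1) poly_var_in_C by auto
    ultimately have "length vs < card V"
      using length_less_if_boundary_disjoint[OF graded_ideal[OF graded_zero], of "map poly_var vs"]
      by simp
    then show False using vs distinct_card[of vs] by simp
  qed
  from ex_prime_chain_if_boundary_disjoint[OF idI positive_forms_subset[OF fs] this]
  obtain Ps where Ps: "length Ps = Suc (length fs)" "sorted_wrt (\<subset>) Ps"
    "\<forall>P\<in>set Ps. primeideal P R \<and> I \<subseteq> P" by blast
  let ?chains = "{Ps. Ps \<noteq> [] \<and> sorted_wrt (\<subset>) Ps \<and> (\<forall>P \<in> set Ps. primeideal P R \<and> I \<subseteq> P)}"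
  have "(SUP Ps \<in> ?chains. ereal (real (length Ps - 1))) = ereal (real (length fs))"
  proof (rule antisym)
    show "(SUP Ps \<in> ?chains. ereal (real (length Ps - 1))) \<le> ereal (real (length fs))"
    proof (rule SUP_least)
      fix Qs assume Qs: "Qs \<in> ?chains"
      then obtain r where r: "length Qs = Suc r" by (cases Qs) auto
      obtain gs where gs: "length gs = r" "set gs \<subseteq> C" "hd Qs \<inter> boundary gs = {}"
        using ex_boundary_disjoint_if_prime_chain[OF r] Qs by blast
      have "hd Qs \<in> set Qs" using Qs by (intro hd_in_set) blast
      then have "I \<inter> boundary gs = {}" using Qs gs(3) by blast
      then have "length gs < Suc (length fs)"
        by (rule length_less_if_boundary_disjoint[OF idI gs(2) _ growth_I])
      then show "ereal (real (length Qs - 1)) \<le> ereal (real (length fs))" using r gs(1) by simp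
    qed
    have "Ps \<in> ?chains" using Ps by auto
    then have "ereal (real (length Ps - 1)) \<le> (SUP Ps \<in> ?chains. ereal (real (length Ps - 1)))"
      by (rule SUP_upper)
    then show "ereal (real (length fs)) \<le> (SUP Ps \<in> ?chains. ereal (real (length Ps - 1)))"
      using Ps(1) by simp
  qed
  then show ?thesis
    unfolding I_def[symmetric] krull_dim_Quot[OF cring_R idI] .
qed

lemma krull_dim_zero_if_unique_prime:
  assumes "\<And>P. primeideal P S \<and> G \<subseteq> P \<longleftrightarrow> P = Q" and "cring S" and "ideal G S"
  shows "krull_dim (S Quot G) = 0"
proof -
  have "{Ps. Ps \<noteq> [] \<and> sorted_wrt (\<subset>) Ps \<and> (\<forall>P \<in> set Ps. primeideal P S \<and> G \<subseteq> P)} = {[Q]}"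
  proof (intro equalityI subsetI)
    fix Ps assume "Ps \<in> {Ps. Ps \<noteq> [] \<and> sorted_wrt (\<subset>) Ps \<and> (\<forall>P \<in> set Ps. primeideal P S \<and> G \<subseteq> P)}"
    then have Ps: "Ps \<noteq> []" "sorted_wrt (\<subset>) Ps" "\<forall>P \<in> set Ps. P = Q" unfolding assms(1) by blast+
    obtain P Ps' where Ps': "Ps = P # Ps'" using Ps(1) by (meson list.exhaust)
    have "Ps' = []"
    proof (rule ccontr)
      assume "Ps' \<noteq> []"
      then have "P \<subset> hd Ps'" "hd Ps' = Q" "P = Q" using Ps(2,3) unfolding Ps' by simp_all
      then show False by simp
    qed
    then show "Ps \<in> {[Q]}" using Ps(3) unfolding Ps' by simp
  next
    fix Ps assume "Ps \<in> {[Q]}"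
    then show "Ps \<in> {Ps. Ps \<noteq> [] \<and> sorted_wrt (\<subset>) Ps \<and> (\<forall>P \<in> set Ps. primeideal P S \<and> G \<subseteq> P)}"
      unfolding assms(1) by simp
  qed
  then show ?thesis unfolding krull_dim_Quot[OF assms(2,3)] by simp
qed

text \<open>
  The preimage in \<open>R\<close> of a prime of the double quotient contains \<open>hs\<close> and \<open>fs\<close>, hence all variables, so it
  is the irrelevant ideal.
\<close>
lemma krull_dim_Quot_Quot_parameters:
  assumes hs: "positive_forms hs" and fs: "positive_forms fs"
    and vars: "\<And>P v. primeideal P R \<Longrightarrow> set hs \<subseteq> P \<Longrightarrow> set fs \<subseteq> P \<Longrightarrow> v \<in> V \<Longrightarrow> poly_var v \<in> P"
    and I: "I = foldl adjoin {0} hs"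
  shows "krull_dim ((R Quot I) Quot (genideal (R Quot I) ((\<lambda>f. I +>\<^bsub>R\<^esub> f) ` set fs))) = 0"
proof -
  have hs_C: "set hs \<subseteq> C" and fs_C: "set fs \<subseteq> C" using hs fs by (simp_all add: positive_forms_subset)
  have zero: "ideal {0} R" using graded_zero by (rule graded_ideal)
  have idI: "ideal I R" unfolding I by (intro ideal_foldl_adjoin zero hs_C)
  have hs_I: "set hs \<subseteq> I" unfolding I by (intro generators_in_foldl_adjoin zero hs_C)
  interpret S: cring "R Quot I" by (rule ideal.quotient_is_cring[OF idI cring_R])
  let ?gs = "(\<lambda>f. I +>\<^bsub>R\<^esub> f) ` set fs"
  define G where "G = genideal (R Quot I) ?gs"
  have gs: "?gs \<subseteq> carrier (R Quot I)" using fs_C unfolding carrier_Quot by auto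
  have idG: "ideal G (R Quot I)" unfolding G_def by (rule S.genideal_ideal[OF gs])
  let ?c = "\<lambda>Q. {x \<in> carrier R. I +>\<^bsub>R\<^esub> x \<in> Q}"
  note bij = primes_Quot_bij_betw[OF cring_R idI]
  have irr: "primeideal irrelevant R" "set hs \<subseteq> irrelevant" "set fs \<subseteq> irrelevant"
    using prime_irrelevant hs fs positive_form_in_irrelevant unfolding positive_forms_def by blast+
  have "I \<subseteq> irrelevant"
    unfolding I using irr ideal_zero[OF primeideal_imp_ideal[OF irr(1)]]
    by (intro foldl_adjoin_least primeideal_imp_ideal) auto
  then have "irrelevant \<in> ?c ` {Q. primeideal Q (R Quot I)}"
    using bij_betw_imp_surj_on[OF bij] irr(1) by blast
  then obtain Q where Q: "primeideal Q (R Quot I)" "?c Q = irrelevant" by auto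
  have "primeideal P (R Quot I) \<and> G \<subseteq> P \<longleftrightarrow> P = Q" for P
  proof
    assume P: "primeideal P (R Quot I) \<and> G \<subseteq> P"
    then have cP: "primeideal (?c P) R" "I \<subseteq> ?c P" using bij_betw_apply[OF bij, of P] by auto
    have "?gs \<subseteq> P" using P S.genideal_self[OF gs] unfolding G_def by blast
    then have "set fs \<subseteq> ?c P" using fs_C by auto
    moreover have "set hs \<subseteq> ?c P" using hs_I cP(2) by blast
    ultimately have "?c P = irrelevant" using vars[OF cP(1)] by (intro prime_eq_irrelevant cP(1))
    then show "P = Q" using inj_onD[OF bij_betw_imp_inj_on[OF bij], of P Q] P Q by auto
  next
    assume "P = Q"
    have "?gs \<subseteq> Q" using irr(3) unfolding Q(2)[symmetric] by auto
    then have "G \<subseteq> Q"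
      unfolding G_def using Q(1) by (intro S.genideal_minimal) (auto simp: primeideal_def)
    then show "primeideal P (R Quot I) \<and> G \<subseteq> P" using Q(1) \<open>P = Q\<close> by blast
  qed
  then show ?thesis
    unfolding G_def[symmetric] by (rule krull_dim_zero_if_unique_prime[OF _ S.cring_axioms idG])
qed

text \<open>
  As many forms of positive degree as variables, with only the trivial common zero: then every
  splitting of the list into \<open>hs\<close> and \<open>fs\<close> presents \<open>fs\<close> as a system of parameters modulo \<open>hs\<close>.
\<close>
theorem homogeneous_sop_if_primes_contain_variables:
  assumes hs: "positive_forms hs" and fs: "positive_forms fs" and len: "length hs + length fs = card V"
    and vars: "\<And>P v. primeideal P R \<Longrightarrow> set hs \<subseteq> P \<Longrightarrow> set fs \<subseteq> P \<Longrightarrow> v \<in> V \<Longrightarrow> poly_var v \<in> P"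
    and I: "I = genideal (poly_ring V) (set hs)"
  shows "homogeneous_sop V I (map (\<lambda>f. I +>\<^bsub>poly_ring V\<^esub> f) fs)"
proof -
  have I_eq: "I = foldl adjoin {0} hs"
    unfolding I poly_ring_eq_R by (rule genideal_eq_foldl_adjoin[OF positive_forms_subset[OF hs]])
  have "homogeneous_ideal V I"
    unfolding homogeneous_ideal_def poly_ring_eq_R
    using hs I[unfolded poly_ring_eq_R] by (intro exI[of _ "set hs"]) (auto simp: positive_forms_def)
  moreover have "\<exists>d>0. \<exists>f\<in>carrier (poly_ring V). homogeneous d f \<and> g = I +>\<^bsub>poly_ring V\<^esub> f"
    if g: "g \<in> set (map (\<lambda>f. I +>\<^bsub>poly_ring V\<^esub> f) fs)" for g
  proof -
    obtain f where "f \<in> set fs" "g = I +>\<^bsub>poly_ring V\<^esub> f" using g by auto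
    moreover from this obtain e where "f \<in> C" "0 < e" "homogeneous e f"
      using fs unfolding positive_forms_def by blast
    ultimately show ?thesis unfolding poly_ring_eq_R partial_object.simps by blast
  qed
  moreover have "krull_dim (R Quot I) = ereal (real (length fs))"
    unfolding I_eq by (rule krull_dim_Quot_parameters[OF hs fs len vars])
  moreover have "krull_dim ((R Quot I) Quot (genideal (R Quot I) ((\<lambda>f. I +>\<^bsub>R\<^esub> f) ` set fs))) = 0"
    by (rule krull_dim_Quot_Quot_parameters[OF hs fs vars I_eq])
  ultimately show ?thesis
    unfolding homogeneous_sop_def length_map
    by (intro conjI ballI) (simp_all only: poly_ring_eq_R set_map)
qed

end

section \<open>Commutator entries and parameters\<close>
lemma homogeneous_poly_var: "homogeneous 1 (poly_var v :: ('v, 'k::comm_ring_1) mpoly)"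
  by (auto simp: homogeneous_def poly_var_def monom_degree_def)

lemma keys_diff_subset:
  "Poly_Mapping.keys (p - q) \<subseteq> Poly_Mapping.keys p \<union> Poly_Mapping.keys q"
  for p q :: "('v, 'k::comm_ring_1) mpoly"
  by (auto simp: in_keys_iff lookup_minus)

lemma homogeneous_diff: "homogeneous d p \<Longrightarrow> homogeneous d q \<Longrightarrow> homogeneous d (p - q)"
  unfolding homogeneous_def using keys_diff_subset[of p q] by blast

lemma homogeneous_sum: "(\<And>i. i \<in> A \<Longrightarrow> homogeneous d (f i)) \<Longrightarrow> homogeneous d (sum f A)"
  unfolding homogeneous_def using Poly_Mapping.keys_sum[of f A] by blast

lemma homogeneous_mult:
  assumes "homogeneous d p" "homogeneous e q"
  shows "homogeneous (d + e) (p * q)"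
  unfolding homogeneous_def
proof
  fix m assume "m \<in> Poly_Mapping.keys (p * q)"
  then obtain a b where "m = a + b" "a \<in> Poly_Mapping.keys p" "b \<in> Poly_Mapping.keys q"
    using keys_mult[of p q] by blast
  then show "monom_degree m = d + e" using assms by (simp add: homogeneous_def monom_degree_add)
qed

lemma homogeneous_commutator_entry:
  "homogeneous 2 (commutator_entry n i j :: (matrix_var, 'k::comm_ring_1) mpoly)"
proof -
  have "homogeneous 2 (poly_var v * poly_var w :: (matrix_var, 'k) mpoly)" for v w
    using homogeneous_mult[OF homogeneous_poly_var homogeneous_poly_var] by (simp only: one_add_one)
  then show ?thesis
    unfolding commutator_entry_def x_var_def y_var_def
    by (intro homogeneous_diff homogeneous_sum)
qed

text \<open>
  The matrices \<open>X Y\<close> and \<open>Y X\<close> have the same trace.  This is the relation that makes one of the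
  generators superfluous.
\<close>
lemma sum_diagonal_commutator_entries:
  "(\<Sum>i = 1..n. commutator_entry n i i) = (0 :: (matrix_var, 'k::comm_ring_1) mpoly)"
proof -
  have "(\<Sum>i = 1..n. \<Sum>l = 1..n. y_var i l * x_var l i) =
    (\<Sum>l = 1..n. \<Sum>i = 1..n. x_var l i * y_var i l :: (matrix_var, 'k) mpoly)"
    by (subst sum.swap) (simp only: mult.commute)
  then show ?thesis by (simp only: commutator_entry_def sum_subtractf diff_self)
qed

lemma matrix_vars_eq:
  "matrix_vars n = (\<lambda>(i, j). Xvar i j) ` ({1..n} \<times> {1..n}) \<union> (\<lambda>(i, j). Yvar i j) ` ({1..n} \<times> {1..n})"
  by (auto simp: matrix_vars_def)

lemma finite_matrix_vars: "finite (matrix_vars n)"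
  by (simp add: matrix_vars_eq)

lemma card_matrix_vars: "card (matrix_vars n) = 2 * n * n"
proof -
  have "card ((\<lambda>(i, j). Xvar i j) ` ({1..n} \<times> {1..n})) = n * n"
    "card ((\<lambda>(i, j). Yvar i j) ` ({1..n} \<times> {1..n})) = n * n"
    by (simp_all add: card_image inj_on_def card_cartesian_product)
  moreover have "(\<lambda>(i, j). Xvar i j) ` ({1..n} \<times> {1..n}) \<inter> (\<lambda>(i, j). Yvar i j) ` ({1..n} \<times> {1..n}) = {}"
    by auto
  ultimately show ?thesis
    unfolding matrix_vars_eq by (simp add: card_Un_disjoint)
qed

text \<open>
  Six pairwise disjoint pieces, five of them rectangles, which makes the cardinality computable.
\<close>
lemma Omega_eq:
  "Omega k = {1..k - 1} \<times> {1..2 * k} \<union> {(k, k), (k, k + 1), (k + 1, k + 1)} \<union>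
    {k + 1} \<times> {k + 3..2 * k} \<union> {k + 3..2 * k} \<times> {k + 1} \<union>
    {k + 2..2 * k} \<times> {1..k - 1} \<union> {k + 2..2 * k} \<times> {k + 2..2 * k}"
  unfolding Omega_def
  by (intro arg_cong2[where f = "(\<union>)"] refl) auto

lemma Omega_subset: "1 \<le> k \<Longrightarrow> Omega k \<subseteq> {1..2 * k} \<times> {1..2 * k}"
  unfolding Omega_eq by auto

lemma card_Omega:
  assumes "2 \<le> k"
  shows "card (Omega k) = (2 * k - 1) * (2 * k - 1)"
proof -
  obtain m where k: "k = m + 2" using assms by (metis le_add_diff_inverse2)
  let ?A = "{1..k - 1} \<times> {1..2 * k}" and ?B = "{(k, k), (k, k + 1), (k + 1, k + 1)}"
    and ?C = "{k + 1} \<times> {k + 3..2 * k}" and ?D = "{k + 3..2 * k} \<times> {k + 1}"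
    and ?E = "{k + 2..2 * k} \<times> {1..k - 1}" and ?F = "{k + 2..2 * k} \<times> {k + 2..2 * k}"
  have "?A \<inter> ?B = {}" "(?A \<union> ?B) \<inter> ?C = {}" "(?A \<union> ?B \<union> ?C) \<inter> ?D = {}"
    "(?A \<union> ?B \<union> ?C \<union> ?D) \<inter> ?E = {}" "(?A \<union> ?B \<union> ?C \<union> ?D \<union> ?E) \<inter> ?F = {}"
    using assms by auto
  then have "card (Omega k) = card ?A + card ?B + card ?C + card ?D + card ?E + card ?F"
    unfolding Omega_eq by (simp only: card_Un_disjoint finite_cartesian_product finite_atLeastAtMost
        finite_Un finite_insert finite.emptyI simp_thms)
  also have "\<dots> = (k - 1) * (2 * k) + 3 + (k - 2) + (k - 2) + (k - 1) * (k - 1) + (k - 1) * (k - 1)"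
    using assms by (simp add: card_cartesian_product)
  also have "\<dots> = (2 * k - 1) * (2 * k - 1)" unfolding k by (simp add: algebra_simps)
  finally show ?thesis .
qed

lemma set_pairs_comprehension:
  "set [f i j. i \<leftarrow> xs, j \<leftarrow> ys, (i, j) \<in> S] = (\<lambda>(i, j). f i j) ` (S \<inter> set xs \<times> set ys)"
proof -
  have "set [f i j. j \<leftarrow> ys, (i, j) \<in> S] = f i ` {j \<in> set ys. (i, j) \<in> S}" for i by auto
  then show ?thesis unfolding set_concat set_map image_image by auto
qed

lemma length_filter_comprehension:
  assumes "distinct xs"
  shows "length [f s. s \<leftarrow> xs, Q s] = card {s \<in> set xs. Q s}"
  using assms
proof (induction xs)
  case (Cons x xs)
  have "{s \<in> set (x # xs). Q s} = (if Q x then insert x {s \<in> set xs. Q s} else {s \<in> set xs. Q s})"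
    by auto
  moreover have "x \<notin> {s \<in> set xs. Q s}" using Cons.prems by simp
  ultimately show ?case using Cons by simp
qed simp

lemma length_pairs_comprehension:
  assumes "distinct xs" "distinct ys"
  shows "length [f i j. i \<leftarrow> xs, j \<leftarrow> ys, (i, j) \<in> S] = card (S \<inter> set xs \<times> set ys)"
  using assms(1)
proof (induction xs)
  case (Cons x xs)
  have split: "S \<inter> set (x # xs) \<times> set ys =
    Pair x ` {j \<in> set ys. (x, j) \<in> S} \<union> S \<inter> set xs \<times> set ys" by auto
  have "card (S \<inter> set (x # xs) \<times> set ys) =
    card (Pair x ` {j \<in> set ys. (x, j) \<in> S}) + card (S \<inter> set xs \<times> set ys)"
    unfolding split using Cons.prems by (intro card_Un_disjoint) auto
  also have "card (Pair x ` {j \<in> set ys. (x, j) \<in> S}) = card {j \<in> set ys. (x, j) \<in> S}"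
    by (intro card_image inj_onI) simp
  finally show ?case
    using Cons length_filter_comprehension[OF assms(2), where f = "f x" and Q = "\<lambda>j. (x, j) \<in> S"] by simp
qed simp

lemma set_parameter_polys:
  assumes "1 \<le> k"
  shows "set (parameter_polys k) =
    (\<lambda>(i, j). x_var i j) ` Omega k \<union> (\<lambda>(i, j). y_var j i) ` Omega k \<union>
    (\<lambda>s. x_var k s - y_var (2 * k + 1 - s) k) ` {s \<in> {1..2 * k}. s \<noteq> k \<and> s \<noteq> k + 1} \<union>
    (\<lambda>s. x_var (k + 1) s - y_var s (k + 1)) ` {s \<in> {1..k + 2}. s \<noteq> k + 1} \<union>
    {x_var (k + 2) k - y_var (k + 1) (k + 2), x_var (k + 2) (k + 1) - y_var k (k + 2)} \<union>
    (\<lambda>s. x_var s k - y_var k s) ` {k + 3..2 * k}"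
proof -
  have set_filter: "set [f s. s \<leftarrow> [a..<b], Q s] = f ` {s \<in> {a..<b}. Q s}"
    for f :: "nat \<Rightarrow> (matrix_var, 'a) mpoly" and a b Q by auto
  have Omega_box: "Omega k \<inter> {1..<2 * k + 1} \<times> {1..<2 * k + 1} = Omega k"
    using Omega_subset[OF assms] by auto
  have "{1..<2 * k + 1} = {1..2 * k}" "{1..<k + 3} = {1..k + 2}" "{k + 3..<2 * k + 1} = {k + 3..2 * k}"
    by auto
  then show ?thesis
    unfolding parameter_polys_def set_append
      set_pairs_comprehension set_filter set_map set_upt Omega_box
    by (simp only: list.set Un_assoc)
qed

lemma length_parameter_polys:
  assumes "2 \<le> k"
  shows "length (parameter_polys k :: (matrix_var, 'k::comm_ring_1) mpoly list) + (4 * k - 1) = 8 * k * k"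
proof -
  obtain m where k: "k = m + 2" using assms by (metis le_add_diff_inverse2)
  have k1: "1 \<le> k" using assms by simp
  have "{s \<in> {1..<2 * k + 1}. s \<noteq> k \<and> s \<noteq> k + 1} = {1..<2 * k + 1} - {k, k + 1}" by auto
  then have 1: "card {s \<in> {1..<2 * k + 1}. s \<noteq> k \<and> s \<noteq> k + 1} = 2 * k - 2"
    using assms by (simp add: card_Diff_subset)
  have "{s \<in> {1..<k + 3}. s \<noteq> k + 1} = {1..<k + 3} - {k + 1}" by auto
  then have 2: "card {s \<in> {1..<k + 3}. s \<noteq> k + 1} = k + 1"
    using assms by (simp add: card_Diff_subset)
  have Omega_box: "Omega k \<inter> {1..<2 * k + 1} \<times> {1..<2 * k + 1} = Omega k"
    using Omega_subset[OF k1] by auto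
  have "length (parameter_polys k :: (matrix_var, 'k) mpoly list) =
    (2 * k - 1) * (2 * k - 1) + (2 * k - 1) * (2 * k - 1) + (2 * k - 2) + (k + 1) + 2 + (k - 2)"
    unfolding parameter_polys_def length_append
      length_pairs_comprehension[OF distinct_upt distinct_upt]
      length_filter_comprehension[OF distinct_upt] set_upt Omega_box 1 2
      card_Omega[OF assms] length_map length_upt
    using assms by simp
  then show ?thesis unfolding k by (simp add: algebra_simps)
qed

section \<open>The common zeros of generators and parameters\<close>
context unital_subring
begin

text \<open>
  The form in which the parameters are used: they identify two unknowns \<open>u\<close> and \<open>v\<close> modulo \<open>P\<close>, and a
  commutator entry then turns into the square of one of them.
\<close>
lemma
  assumes P: "primeideal P R" and "u \<in> C" "v \<in> C" and "u - v \<in> P" and "u * v \<in> P"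
  shows prime_contains_left: "u \<in> P" and prime_contains_right: "v \<in> P"
proof -
  note I = primeideal_imp_ideal[OF P]
  have swap: "v - u \<in> P"
    using ideal_diff[OF I ideal_zero[OF I] assms(4)] by simp
  have "u \<in> P \<or> v \<in> P" using prime_mult[OF P assms(5,2,3)] .
  moreover have "u \<in> P" if "v \<in> P" using ideal_add[OF I assms(4) that] by simp
  moreover have "v \<in> P" if "u \<in> P" using ideal_add[OF I swap that] by simp
  ultimately show "u \<in> P" by blast
  from \<open>u \<in> P\<close> show "v \<in> P" using \<open>u \<in> P \<Longrightarrow> v \<in> P\<close> by blast
qed

text \<open>
  Equations 2 and 4 give \<open>a\<^sup>2 = b\<^sup>2\<close> modulo \<open>P\<close>, so \<open>b = \<plusminus> a\<close>, and with equation 1 this leads to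
  \<open>c (c \<minusplus> f) = 0\<close>.  If \<open>c = 0\<close>, the other unknowns vanish one after the other.  Otherwise \<open>f\<^sup>2 = c\<^sup>2\<close>, and
  equations 1 and 3 leave \<open>2 p q = 0\<close>, so that \<open>p\<close> or \<open>q\<close> vanishes.  Equations 5 and 7 express \<open>q\<^sup>2\<close>
  and \<open>p\<^sup>2\<close> as \<open>\<plusminus> 2 a c\<close>, so \<open>a c = 0\<close>, and equation 1 gives \<open>c = 0\<close> again.
  The invertibility of \<open>2\<close> enters at \<open>2 p q = 0\<close> and at
  \<open>2 a c = 0\<close>.
\<close>
lemma central_unknowns_in_prime:
  assumes P: "primeideal P R" and two: "\<And>u. u \<in> C \<Longrightarrow> 2 * u \<in> P \<Longrightarrow> u \<in> P"
    and C: "a \<in> C" "b \<in> C" "c \<in> C" "d \<in> C" "f \<in> C" "p \<in> C" "q \<in> C"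
    and 1: "a * b + c * c \<in> P"
    and 2: "b * b + c * f \<in> P"
    and 3: "2 * (p * q) - a * b - f * f \<in> P"
    and 4: "a * a + f * c \<in> P"
    and 5: "a * c + b * f - q * q \<in> P"
    and 6: "c * c + d * d + f * f - p * q \<in> P"
    and 7: "c * b + f * a - p * p \<in> P"
  shows "a \<in> P \<and> b \<in> P \<and> c \<in> P \<and> d \<in> P \<and> f \<in> P \<and> p \<in> P \<and> q \<in> P"
proof -
  note I = primeideal_imp_ideal[OF P]
  note add = ideal_add[OF I] and diff = ideal_diff[OF I] and mult = ideal_mult[OF I]
  have square: "u \<in> P" if "u * u \<in> P" "u \<in> C" for u
    using prime_mult[OF P that(1,2,2)] by blast
  have multr: "u * v \<in> P" if "u \<in> P" "v \<in> C" for u v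
    using mult[OF that] by (simp add: mult.commute)
  have final: ?thesis if c: "c \<in> P"
  proof -
    have "a * a \<in> P"
      by (rule back_subst[of "\<lambda>x. x \<in> P", OF diff[OF 4 mult[OF c C(5)]]])
        (simp add: algebra_simps)
    then have a: "a \<in> P" using C(1) by (rule square)
    have "b * b \<in> P"
      by (rule back_subst[of "\<lambda>x. x \<in> P", OF diff[OF 2 multr[OF c C(5)]]])
        (simp add: algebra_simps)
    then have b: "b \<in> P" using C(2) by (rule square)
    have "q * q \<in> P"
      by (rule back_subst[of "\<lambda>x. x \<in> P", OF diff[OF add[OF multr[OF a C(3)] multr[OF b C(5)]] 5]])
        (simp add: algebra_simps)
    then have q: "q \<in> P" using C(7) by (rule square)
    have "p * p \<in> P"
      by (rule back_subst[of "\<lambda>x. x \<in> P", OF diff[OF add[OF multr[OF c C(2)] mult[OF a C(5)]] 7]])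
        (simp add: algebra_simps)
    then have p: "p \<in> P" using C(6) by (rule square)
    have pq: "p * q \<in> P" by (rule multr[OF p C(7)])
    have "f * f \<in> P"
      by (rule back_subst[of "\<lambda>x. x \<in> P", OF diff[OF diff[OF add[OF pq pq] multr[OF a C(2)]] 3]])
        (simp add: algebra_simps)
    then have f: "f \<in> P" using C(5) by (rule square)
    have "d * d \<in> P"
      by (rule back_subst[of "\<lambda>x. x \<in> P", OF diff[OF diff[OF add[OF 6 pq] multr[OF c C(3)]] multr[OF f C(5)]]])
        (simp add: algebra_simps)
    then have d: "d \<in> P" using C(4) by (rule square)
    from a b c d f p q show ?thesis by blast
  qed
  have ac: "c \<in> P" if "a * c \<in> P"
  proof -
    have "c \<in> P" if "a \<in> P"
    proof -
      have "c * c \<in> P"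
        by (rule back_subst[of "\<lambda>x. x \<in> P", OF diff[OF 1 multr[OF that C(2)]]])
          (simp add: algebra_simps)
      then show ?thesis using C(3) by (rule square)
    qed
    then show ?thesis using prime_mult[OF P that C(1,3)] by blast
  qed
  have pq: "p \<in> P \<or> q \<in> P" if "f * f - c * c \<in> P"
  proof -
    have "(2 * (p * q) - a * b - f * f) + (a * b + c * c) + (f * f - c * c) \<in> P"
      by (rule add[OF add[OF 3 1] that])
    then have "2 * (p * q) \<in> P" by (simp add: algebra_simps)
    then have "p * q \<in> P" by (rule two[OF mult_in[OF C(6,7)]])
    then show ?thesis using prime_mult[OF P] C by blast
  qed
  have "c \<in> P"
  proof -
    have "(a - b) * (a + b) = (a * a + f * c) - (b * b + c * f)" by (simp add: algebra_simps)
    then have "(a - b) * (a + b) \<in> P" using diff[OF 4 2] by simp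
    then consider "a - b \<in> P" | "a + b \<in> P"
      using prime_mult[OF P, of "a - b" "a + b"] C by blast
    then show ?thesis
    proof cases
      case 1
      note ab = 1
      have "c * (c - f) = (a * b + c * c) - (a * a + f * c) + a * (a - b)" by (simp add: algebra_simps)
      moreover have "\<dots> \<in> P" by (rule add[OF diff[OF \<open>a * b + c * c \<in> P\<close> 4] mult[OF ab C(1)]])
      ultimately have "c * (c - f) \<in> P" by simp
      then consider "c \<in> P" | "c - f \<in> P" using prime_mult[OF P, of c "c - f"] C by blast
      then show ?thesis
      proof cases
        case 2
        have "f * f - c * c = (c - f) * (- (f + c))" by (simp add: algebra_simps)
        moreover have "\<dots> \<in> P" using C by (intro multr[OF 2] uminus_in add_in)
        ultimately have "p \<in> P \<or> q \<in> P" using pq by simp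
        then have "a * c \<in> P"
        proof
          assume p: "p \<in> P"
          have "2 * (a * c) = (c * b + f * a - p * p) + p * p + c * (a - b) + a * (c - f)"
            by (simp add: algebra_simps)
          moreover have "\<dots> \<in> P"
            by (rule add[OF add[OF add[OF 7 multr[OF p C(6)]] mult[OF ab C(3)]] mult[OF 2 C(1)]])
          ultimately have "2 * (a * c) \<in> P" by (simp only:)
          then show ?thesis by (rule two[OF mult_in[OF C(1,3)]])
        next
          assume q: "q \<in> P"
          have "2 * (a * c) = (a * c + b * f - q * q) + q * q + c * (a - b) + b * (c - f)"
            by (simp add: algebra_simps)
          moreover have "\<dots> \<in> P"
            by (rule add[OF add[OF add[OF 5 multr[OF q C(7)]] mult[OF ab C(3)]] mult[OF 2 C(2)]])
          ultimately have "2 * (a * c) \<in> P" by (simp only:)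
          then show ?thesis by (rule two[OF mult_in[OF C(1,3)]])
        qed
        then show ?thesis by (rule ac)
      qed
    next
      case 2
      note ab = 2
      have "c * (c + f) = (a * b + c * c) + (a * a + f * c) - a * (a + b)" by (simp add: algebra_simps)
      moreover have "\<dots> \<in> P" by (rule diff[OF add[OF 1 4] mult[OF ab C(1)]])
      ultimately have "c * (c + f) \<in> P" by simp
      then consider "c \<in> P" | "c + f \<in> P" using prime_mult[OF P, of c "c + f"] C by blast
      then show ?thesis
      proof cases
        case 2
        have "f * f - c * c = (c + f) * (f - c)" by (simp add: algebra_simps)
        moreover have "\<dots> \<in> P" using C by (intro multr[OF 2] diff_in)
        ultimately have "p \<in> P \<or> q \<in> P" using pq by simp
        then have "a * c \<in> P"
        proof
          assume p: "p \<in> P"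
          have "2 * (a * c) = c * (a + b) + a * (c + f) - ((c * b + f * a - p * p) + p * p)"
            by (simp add: algebra_simps)
          moreover have "\<dots> \<in> P"
            by (rule diff[OF add[OF mult[OF ab C(3)] mult[OF 2 C(1)]] add[OF 7 multr[OF p C(6)]]])
          ultimately have "2 * (a * c) \<in> P" by (simp only:)
          then show ?thesis by (rule two[OF mult_in[OF C(1,3)]])
        next
          assume q: "q \<in> P"
          have "2 * (a * c) = (a * c + b * f - q * q) + q * q + c * (a + b) - b * (c + f)"
            by (simp add: algebra_simps)
          moreover have "\<dots> \<in> P"
            by (rule diff[OF add[OF add[OF 5 multr[OF q C(7)]] mult[OF ab C(3)]] mult[OF 2 C(2)]])
          ultimately have "2 * (a * c) \<in> P" by (simp only:)
          then show ?thesis by (rule two[OF mult_in[OF C(1,3)]])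
        qed
        then show ?thesis by (rule ac)
      qed
    qed
  qed
  then show ?thesis by (rule final)
qed

end

text \<open>
  A prime \<open>P\<close> that contains the generators and the parameters.  Modulo \<open>P\<close>, the matrix \<open>X\<close> has nonzero entries
  only in the rows \<open>k\<close> and \<open>k + 1\<close>, in column \<open>k\<close> below them, and at \<open>(k + 2, k + 1)\<close>.  The nonzero entries
  of \<open>Y\<close> lie in the transposed positions.
\<close>
locale parameter_prime =
  fixes k :: nat and P :: "(matrix_var, 'k::field) mpoly set"
  assumes k: "2 \<le> k" and two: "(2 :: 'k) \<noteq> 0"
    and prime: "primeideal P (poly_ring (matrix_vars (2 * k)))"
    and diagonal: "\<And>i. 1 \<le> i \<Longrightarrow> i \<le> 2 * k \<Longrightarrow> commutator_entry (2 * k) i i \<in> P"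
    and antidiagonal: "\<And>i. 1 \<le> i \<Longrightarrow> i \<le> 2 * k \<Longrightarrow> commutator_entry (2 * k) i (2 * k + 1 - i) \<in> P"
    and parameters: "set (parameter_polys k) \<subseteq> P"
begin

sublocale poly_vars "matrix_vars (2 * k)" "TYPE('k)"
  by unfold_locales (rule finite_matrix_vars)

lemma prime_R: "primeideal P R"
  using prime unfolding poly_ring_eq_R .

lemmas ideal_P = primeideal_imp_ideal[OF prime_R]
lemmas P_add = ideal_add[OF ideal_P] and P_diff = ideal_diff[OF ideal_P]
  and P_mult = ideal_mult[OF ideal_P] and P_zero = ideal_zero[OF ideal_P]

abbreviation x :: "nat \<Rightarrow> nat \<Rightarrow> (matrix_var, 'k) mpoly" where "x \<equiv> x_var"
abbreviation y :: "nat \<Rightarrow> nat \<Rightarrow> (matrix_var, 'k) mpoly" where "y \<equiv> y_var"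
abbreviation ix :: "nat set" where "ix \<equiv> {1..2 * k}"

lemma P_mult_right: "u \<in> P \<Longrightarrow> v \<in> C \<Longrightarrow> u * v \<in> P"
  using P_mult[of u v] by (simp add: mult.commute)

lemma x_in: "i \<in> ix \<Longrightarrow> j \<in> ix \<Longrightarrow> x i j \<in> C"
  unfolding x_var_def by (rule poly_var_in_C) (auto simp: matrix_vars_def)

lemma y_in: "i \<in> ix \<Longrightarrow> j \<in> ix \<Longrightarrow> y i j \<in> C"
  unfolding y_var_def by (rule poly_var_in_C) (auto simp: matrix_vars_def)

lemma Omega_zero:
  assumes "(i, j) \<in> Omega k"
  shows "x i j \<in> P \<and> y j i \<in> P"
proof -
  have "1 \<le> k" using k by simp
  note sub = set_parameter_polys[OF this, where 'a = 'k]
  have "(\<lambda>(i, j). x i j) ` Omega k \<subseteq> P" "(\<lambda>(i, j). y j i) ` Omega k \<subseteq> P"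
    using parameters unfolding sub by blast+
  then show ?thesis using assms unfolding image_subset_iff by fast
qed

lemma identified:
  shows row_k: "s \<in> ix \<Longrightarrow> s \<noteq> k \<Longrightarrow> s \<noteq> k + 1 \<Longrightarrow> x k s - y (2 * k + 1 - s) k \<in> P"
    and row_k1: "1 \<le> s \<Longrightarrow> s \<le> k + 2 \<Longrightarrow> s \<noteq> k + 1 \<Longrightarrow> x (k + 1) s - y s (k + 1) \<in> P"
    and row_k2: "x (k + 2) k - y (k + 1) (k + 2) \<in> P" "x (k + 2) (k + 1) - y k (k + 2) \<in> P"
    and column_k: "k + 3 \<le> s \<Longrightarrow> s \<le> 2 * k \<Longrightarrow> x s k - y k s \<in> P"
proof -
  have "1 \<le> k" using k by simp
  note sub = set_parameter_polys[OF this, where 'a = 'k]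
  have k_mem: "x k s - y (2 * k + 1 - s) k \<in> P" if "s \<in> {s \<in> ix. s \<noteq> k \<and> s \<noteq> k + 1}" for s
    using parameters imageI[OF that, of "\<lambda>s. x k s - y (2 * k + 1 - s) k"]
    unfolding sub Un_subset_iff by (elim conjE) (rule subsetD)
  have k1_mem: "x (k + 1) s - y s (k + 1) \<in> P" if "s \<in> {s \<in> {1..k + 2}. s \<noteq> k + 1}" for s
    using parameters imageI[OF that, of "\<lambda>s. x (k + 1) s - y s (k + 1)"]
    unfolding sub Un_subset_iff by (elim conjE) (rule subsetD)
  have column_mem: "x s k - y k s \<in> P" if "s \<in> {k + 3..2 * k}" for s
    using parameters imageI[OF that, of "\<lambda>s. x s k - y k s"]
    unfolding sub Un_subset_iff by (elim conjE) (rule subsetD)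
  show "x (k + 2) k - y (k + 1) (k + 2) \<in> P" "x (k + 2) (k + 1) - y k (k + 2) \<in> P"
    using parameters unfolding sub Un_subset_iff insert_subset by simp_all
  show "s \<in> ix \<Longrightarrow> s \<noteq> k \<Longrightarrow> s \<noteq> k + 1 \<Longrightarrow> x k s - y (2 * k + 1 - s) k \<in> P"
    by (rule k_mem) simp
  show "1 \<le> s \<Longrightarrow> s \<le> k + 2 \<Longrightarrow> s \<noteq> k + 1 \<Longrightarrow> x (k + 1) s - y s (k + 1) \<in> P"
    by (rule k1_mem) simp
  show "k + 3 \<le> s \<Longrightarrow> s \<le> 2 * k \<Longrightarrow> x s k - y k s \<in> P"
    by (rule column_mem) simp
qed

text \<open>
  The six pieces of \<open>Omega k\<close>, as introduction rules.
\<close>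
lemma Omega_cases:
  shows Omega_top: "i \<in> ix \<Longrightarrow> i \<le> k - 1 \<Longrightarrow> j \<in> ix \<Longrightarrow> (i, j) \<in> Omega k"
    and Omega_middle: "(k, k) \<in> Omega k" "(k, k + 1) \<in> Omega k" "(k + 1, k + 1) \<in> Omega k"
    and Omega_row: "k + 3 \<le> j \<Longrightarrow> j \<le> 2 * k \<Longrightarrow> (k + 1, j) \<in> Omega k"
    and Omega_column: "k + 3 \<le> i \<Longrightarrow> i \<le> 2 * k \<Longrightarrow> (i, k + 1) \<in> Omega k"
    and Omega_left: "k + 2 \<le> i \<Longrightarrow> i \<le> 2 * k \<Longrightarrow> j \<in> ix \<Longrightarrow> j \<le> k - 1 \<Longrightarrow> (i, j) \<in> Omega k"
    and Omega_right: "k + 2 \<le> i \<Longrightarrow> i \<le> 2 * k \<Longrightarrow> k + 2 \<le> j \<Longrightarrow> j \<le> 2 * k \<Longrightarrow> (i, j) \<in> Omega k"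
  unfolding Omega_def by simp_all

lemma commutator_restrict:
  assumes ij: "i \<in> ix" "j \<in> ix" and c: "commutator_entry (2 * k) i j \<in> P" and S: "S \<subseteq> ix"
    and rest: "\<And>l. l \<in> ix \<Longrightarrow> l \<notin> S \<Longrightarrow> x i l * y l j \<in> P \<and> y i l * x l j \<in> P"
  shows "(\<Sum>l\<in>S. x i l * y l j - y i l * x l j) \<in> P"
proof -
  let ?t = "\<lambda>l. x i l * y l j - y i l * x l j"
  have "commutator_entry (2 * k) i j = sum ?t ix"
    by (simp add: commutator_entry_def sum_subtractf)
  also have "\<dots> = sum ?t (ix - S) + sum ?t S"
    using S by (simp add: sum.subset_diff)
  finally have "sum ?t S = commutator_entry (2 * k) i j - sum ?t (ix - S)" by simp
  moreover have "sum ?t (ix - S) \<in> P"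
    using rest by (intro ideal_sum[OF ideal_P] P_diff) auto
  ultimately show ?thesis using P_diff[OF c] by simp
qed

text \<open>
  Row \<open>i\<close> of \<open>X\<close> vanishes modulo \<open>P\<close>, and row \<open>i\<close> of \<open>Y\<close> has only the entries in the columns \<open>k\<close> and \<open>k + 1\<close>.
\<close>
lemma upper_row:
  assumes i: "i \<in> ix" "i \<le> k - 1" and j: "j \<in> ix" and c: "commutator_entry (2 * k) i j \<in> P"
  shows "y i k * x k j + y i (k + 1) * x (k + 1) j \<in> P"
proof -
  have xi: "x i l \<in> P" if "l \<in> ix" for l
    using Omega_zero[OF Omega_top[OF i that]] by simp
  have kk: "k \<in> ix" "k + 1 \<in> ix" using k by simp_all
  have "(\<Sum>l\<in>{k, k + 1}. x i l * y l j - y i l * x l j) \<in> P"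
  proof (rule commutator_restrict[OF i(1) j c])
    show "{k, k + 1} \<subseteq> ix" using kk by simp
    fix l assume l: "l \<in> ix" "l \<notin> {k, k + 1}"
    have "(l, i) \<in> Omega k"
    proof (cases "l \<le> k - 1")
      case True
      then show ?thesis using Omega_top l(1) i(1) by blast
    next
      case False
      then have "k + 2 \<le> l" "l \<le> 2 * k" using l by auto
      then show ?thesis using Omega_left i by blast
    qed
    then have "y i l \<in> P" using Omega_zero by blast
    then show "x i l * y l j \<in> P \<and> y i l * x l j \<in> P"
      using xi[OF l(1)] P_mult_right x_in[OF l(1) j] y_in[OF l(1) j] by blast
  qed
  then have *: "(x i k * y k j - y i k * x k j) + (x i (k + 1) * y (k + 1) j - y i (k + 1) * x (k + 1) j) \<in> P"
    by simp
  have "x i k * y k j + x i (k + 1) * y (k + 1) j \<in> P"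
    using kk j by (intro P_add P_mult_right xi y_in)
  from P_diff[OF this *] show ?thesis by (simp add: algebra_simps)
qed

text \<open>
  In both matrices, row \<open>i\<close> has only the entry in column \<open>k\<close> modulo \<open>P\<close>.
\<close>
lemma lower_row:
  assumes i: "k + 3 \<le> i" "i \<le> 2 * k" and j: "j \<in> ix" and c: "commutator_entry (2 * k) i j \<in> P"
  shows "x i k * y k j - y i k * x k j \<in> P"
proof -
  have i': "i \<in> ix" "k + 2 \<le> i" using i by auto
  have "(\<Sum>l\<in>{k}. x i l * y l j - y i l * x l j) \<in> P"
  proof (rule commutator_restrict[OF i'(1) j c])
    show "{k} \<subseteq> ix" using k by simp
    fix l assume l: "l \<in> ix" "l \<notin> {k}"
    have "(i, l) \<in> Omega k \<and> (l, i) \<in> Omega k"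
    proof -
      consider "l \<le> k - 1" | "l = k + 1" | "k + 2 \<le> l" "l \<le> 2 * k" using l by force
      then show ?thesis
        using Omega_top Omega_left Omega_row Omega_column Omega_right l(1) i i' by cases blast+
    qed
    then have "x i l \<in> P" "y i l \<in> P" using Omega_zero by blast+
    then show "x i l * y l j \<in> P \<and> y i l * x l j \<in> P"
      using P_mult_right x_in[OF l(1) j] y_in[OF l(1) j] by blast
  qed
  then show ?thesis by simp
qed

text \<open>
  The entry of the commutator at \<open>(i, j)\<close> on the antidiagonal reduces to the product of \<open>x\<^sub>k\<^sub>j\<close> and \<open>y\<^sub>i\<^sub>k\<close>, because
  \<open>x\<close> vanishes at \<open>(k + 1, j)\<close>, and a parameter identifies the two factors.  The following three lemmas
  treat the rest of the border in the same way; each of them uses the previous ones to remove the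
  second product of the commutator entry.
\<close>
lemma row_k_right:
  assumes j: "k + 3 \<le> j" "j \<le> 2 * k"
  shows "x k j \<in> P \<and> y (2 * k + 1 - j) k \<in> P"
proof -
  define i where "i = 2 * k + 1 - j"
  have i: "i \<in> ix" "i \<le> k - 1" "j = 2 * k + 1 - i" and jx: "j \<in> ix" and kk: "k \<in> ix"
    using j k unfolding i_def by auto
  have "commutator_entry (2 * k) i j \<in> P" using antidiagonal[of i] i by simp
  then have "y i k * x k j + y i (k + 1) * x (k + 1) j \<in> P" by (rule upper_row[OF i(1,2) jx])
  moreover have "y i (k + 1) * x (k + 1) j \<in> P"
    using Omega_zero[OF Omega_row[OF j]] k by (intro P_mult y_in i) auto
  ultimately have "y i k * x k j + y i (k + 1) * x (k + 1) j - y i (k + 1) * x (k + 1) j \<in> P"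
    by (rule P_diff)
  then have prod: "x k j * y i k \<in> P" by (simp add: mult.commute)
  have diff: "x k j - y i k \<in> P" using row_k[OF jx] j unfolding i_def by simp
  note * = prime_R x_in[OF kk jx] y_in[OF i(1) kk] diff prod
  show ?thesis unfolding i_def[symmetric]
    using prime_contains_left[OF *] prime_contains_right[OF *] by blast
qed

lemma row_k1_left:
  assumes i: "1 \<le> i" "i + 2 \<le> k"
  shows "x (k + 1) i \<in> P \<and> y i (k + 1) \<in> P"
proof -
  have i': "i \<in> ix" "i \<le> k - 1" and kk: "k \<in> ix" "k + 1 \<in> ix" using i by auto
  have "commutator_entry (2 * k) i i \<in> P" using diagonal[of i] i' by simp
  then have *: "y i k * x k i + y i (k + 1) * x (k + 1) i \<in> P" by (rule upper_row[OF i' i'(1)])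
  have "y i k \<in> P" using row_k_right[of "2 * k + 1 - i"] i by simp
  then have "y i k * x k i \<in> P" using x_in[OF kk(1) i'(1)] by (rule P_mult_right)
  from P_diff[OF * this] have prod: "x (k + 1) i * y i (k + 1) \<in> P" by (simp add: mult.commute)
  have diff: "x (k + 1) i - y i (k + 1) \<in> P" using row_k1[of i] i by simp
  note * = prime_R x_in[OF kk(2) i'(1)] y_in[OF i'(1) kk(2)] diff prod
  show ?thesis using prime_contains_left[OF *] prime_contains_right[OF *] by blast
qed

lemma column_k_bottom:
  assumes i: "k + 3 \<le> i" "i \<le> 2 * k"
  shows "x i k \<in> P \<and> y k i \<in> P"
proof -
  have ix: "i \<in> ix" and kk: "k \<in> ix" using i by auto
  have "commutator_entry (2 * k) i i \<in> P" using diagonal[of i] i by simp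
  then have *: "x i k * y k i - y i k * x k i \<in> P" by (rule lower_row[OF i ix])
  have "y i k * x k i \<in> P" using row_k_right[OF i] y_in[OF ix kk] by (intro P_mult) auto
  from P_add[OF * this] have prod: "x i k * y k i \<in> P" by simp
  note * = prime_R x_in[OF ix kk] y_in[OF kk ix] column_k[OF i] prod
  show ?thesis using prime_contains_left[OF *] prime_contains_right[OF *] by blast
qed

lemma row_k_left:
  assumes j: "1 \<le> j" "j + 2 \<le> k"
  shows "x k j \<in> P \<and> y (2 * k + 1 - j) k \<in> P"
proof -
  define i where "i = 2 * k + 1 - j"
  have i: "k + 3 \<le> i" "i \<le> 2 * k" "i \<in> ix" "j = 2 * k + 1 - i" and jx: "j \<in> ix" and kk: "k \<in> ix"
    using j unfolding i_def by auto
  have "commutator_entry (2 * k) i j \<in> P" using antidiagonal[of i] i by simp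
  then have *: "x i k * y k j - y i k * x k j \<in> P" by (rule lower_row[OF i(1,2) jx])
  have "x i k * y k j \<in> P" using column_k_bottom[OF i(1,2)] y_in[OF kk jx] by (intro P_mult_right) auto
  from P_diff[OF this *] have prod: "x k j * y i k \<in> P" by (simp add: mult.commute)
  have diff: "x k j - y i k \<in> P" using row_k[OF jx] j unfolding i_def by simp
  note * = prime_R x_in[OF kk jx] y_in[OF i(3) kk] diff prod
  show ?thesis unfolding i_def[symmetric]
    using prime_contains_left[OF *] prime_contains_right[OF *] by blast
qed

text \<open>
  The positions of \<open>X\<close>, and transposed those of \<open>Y\<close>, that the border equations leave open.
\<close>
definition central :: "(nat \<times> nat) set" where
  "central = {(k, k - 1), (k, k + 2), (k + 1, k - 1), (k + 1, k), (k + 1, k + 2), (k + 2, k), (k + 2, k + 1)}"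

lemma outside_central:
  assumes r: "r \<in> ix" and s: "s \<in> ix" and out: "(r, s) \<notin> central"
  shows "x r s \<in> P \<and> y s r \<in> P"
proof -
  consider "r \<le> k - 1" | "r = k" | "r = k + 1" | "r = k + 2" | "k + 3 \<le> r" "r \<le> 2 * k"
    using r by force
  then show ?thesis
  proof cases
    case 1
    then show ?thesis by (intro Omega_zero Omega_top r s)
  next
    case 2
    have "s \<noteq> k - 1" "s \<noteq> k + 2" using out 2 unfolding central_def by auto
    then consider "1 \<le> s" "s + 2 \<le> k" | "s = k" | "s = k + 1" | "k + 3 \<le> s" "s \<le> 2 * k"
      using s by force
    then show ?thesis
    proof cases
      case 1
      have "y s k \<in> P" using row_k_right[of "2 * k + 1 - s"] 1 by simp
      then show ?thesis using row_k_left[OF 1] \<open>r = k\<close> by simp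
    next
      case 4
      have "y s k \<in> P" using row_k_left[of "2 * k + 1 - s"] 4 by simp
      then show ?thesis using row_k_right[OF 4] \<open>r = k\<close> by simp
    qed (use Omega_zero Omega_middle \<open>r = k\<close> in blast)+
  next
    case 3
    have "s \<noteq> k - 1" "s \<noteq> k" "s \<noteq> k + 2" using out 3 unfolding central_def by auto
    then consider "1 \<le> s" "s + 2 \<le> k" | "s = k + 1" | "k + 3 \<le> s" "s \<le> 2 * k"
      using s by force
    then show ?thesis
    proof cases
      case 1
      then show ?thesis using row_k1_left \<open>r = k + 1\<close> by simp
    next
      case 2
      then show ?thesis using Omega_zero Omega_middle(3) \<open>r = k + 1\<close> by simp
    next
      case 3
      then show ?thesis using Omega_zero Omega_row \<open>r = k + 1\<close> by simp
    qed
  next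
    case 4
    have "s \<noteq> k" "s \<noteq> k + 1" using out 4 unfolding central_def by auto
    then consider "s \<le> k - 1" | "k + 2 \<le> s" "s \<le> 2 * k"
      using s by force
    then show ?thesis
    proof cases
      case 1
      then show ?thesis using Omega_zero Omega_left[of r s] s r 4 by simp
    next
      case 2
      then show ?thesis using Omega_zero Omega_right[of r s] r 4 by simp
    qed
  next
    case 5
    then have r2: "k + 2 \<le> r" by simp
    consider "s \<le> k - 1" | "s = k" | "s = k + 1" | "k + 2 \<le> s" "s \<le> 2 * k"
      using s by force
    then show ?thesis
    proof cases
      case 1
      then show ?thesis by (intro Omega_zero Omega_left r2 5 s)
    next
      case 2
      then show ?thesis using column_k_bottom[OF 5] by simp
    next
      case 3
      then show ?thesis using Omega_zero[OF Omega_column[OF 5]] by simp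
    next
      case 4
      then show ?thesis by (intro Omega_zero Omega_right r2 5)
    qed
  qed
qed

text \<open>
  The central \<open>4 \<times> 4\<close> blocks of \<open>X\<close> and \<open>Y\<close> modulo \<open>P\<close>, in the rows and columns \<open>k - 1, \<dots>, k + 2\<close>, which
  are counted from zero.  The parameters express the entries of \<open>Y\<close> by those of \<open>X\<close>, so that seven
  unknowns remain.
\<close>
definition x_central :: "nat \<Rightarrow> nat \<Rightarrow> (matrix_var, 'k) mpoly" where
  "x_central r s = (if (k - 1 + r, k - 1 + s) \<in> central then x (k - 1 + r) (k - 1 + s) else 0)"

definition y_central :: "nat \<Rightarrow> nat \<Rightarrow> (matrix_var, 'k) mpoly" where
  "y_central r s =
    (if (r, s) = (0, 1) then x k (k + 2) else if (r, s) = (3, 1) then x k (k - 1)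
     else if (r, s) = (0, 2) then x (k + 1) (k - 1) else if (r, s) = (1, 2) then x (k + 1) k
     else if (r, s) = (3, 2) then x (k + 1) (k + 2) else if (r, s) = (1, 3) then x (k + 2) (k + 1)
     else if (r, s) = (2, 3) then x (k + 2) k else 0)"

lemma block_index: "r < 4 \<Longrightarrow> k - 1 + r \<in> ix"
  unfolding atLeastAtMost_iff using k by arith

lemma block_in_central:
  "(k - 1 + r, k - 1 + s) \<in> central \<longleftrightarrow>
    (r, s) \<in> {(1, 0), (1, 3), (2, 0), (2, 1), (2, 3), (3, 1), (3, 2)}"
proof -
  let ?f = "\<lambda>(r, s). (k - 1 + r, k - 1 + s)"
  have eqs: "k - 1 + 0 = k - 1" "k - 1 + 1 = k" "k - 1 + 2 = k + 1" "k - 1 + 3 = k + 2"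
    using k by simp_all
  have "central = ?f ` {(1, 0), (1, 3), (2, 0), (2, 1), (2, 3), (3, 1), (3, 2)}"
    unfolding central_def by (simp only: image_insert image_empty prod.case eqs)
  moreover have "inj ?f" by (auto simp: inj_on_def)
  ultimately show ?thesis using inj_image_mem_iff[of ?f "(r, s)"] by (simp only: prod.case)
qed

lemma identified_block:
  "x k (k + 2) - y (k - 1) k \<in> P" "x k (k - 1) - y (k + 2) k \<in> P"
  "x (k + 1) (k - 1) - y (k - 1) (k + 1) \<in> P" "x (k + 1) k - y k (k + 1) \<in> P"
  "x (k + 1) (k + 2) - y (k + 2) (k + 1) \<in> P"
  "x (k + 2) k - y (k + 1) (k + 2) \<in> P" "x (k + 2) (k + 1) - y k (k + 2) \<in> P"
proof -
  have "2 * k + 1 - (k + 2) = k - 1" "2 * k + 1 - (k - 1) = k + 2" using k by simp_all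
  moreover have "k + 2 \<in> ix" "k - 1 \<in> ix" "k - 1 \<noteq> k" "k - 1 \<noteq> k + 1" using k by auto
  ultimately show "x k (k + 2) - y (k - 1) k \<in> P" "x k (k - 1) - y (k + 2) k \<in> P"
    using row_k[of "k + 2"] row_k[of "k - 1"] by simp_all
  show "x (k + 1) (k - 1) - y (k - 1) (k + 1) \<in> P" "x (k + 1) k - y k (k + 1) \<in> P"
    "x (k + 1) (k + 2) - y (k + 2) (k + 1) \<in> P"
    by (rule row_k1; use k in arith)+
  show "x (k + 2) k - y (k + 1) (k + 2) \<in> P" "x (k + 2) (k + 1) - y k (k + 2) \<in> P"
    by (rule row_k2)+
qed

lemma P_swap: "u - v \<in> P \<Longrightarrow> v - u \<in> P"
  using P_diff[OF P_zero, of "u - v"] by simp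

lemma x_central_cong:
  assumes "r < 4" "s < 4"
  shows "x (k - 1 + r) (k - 1 + s) - x_central r s \<in> P"
proof (cases "(k - 1 + r, k - 1 + s) \<in> central")
  case True
  then show ?thesis unfolding x_central_def using P_zero by simp
next
  case False
  then show ?thesis
    unfolding x_central_def using outside_central[OF block_index[OF assms(1)] block_index[OF assms(2)]] by simp
qed

lemma y_central_cong:
  assumes "r < 4" "s < 4"
  shows "y (k - 1 + r) (k - 1 + s) - y_central r s \<in> P"
proof (cases "(k - 1 + s, k - 1 + r) \<in> central")
  case True
  have eqs: "k - 1 + 0 = k - 1" "k - 1 + 1 = k" "k - 1 + 2 = k + 1" "k - 1 + 3 = k + 2"
    using k by simp_all
  note swapped = identified_block[THEN P_swap]
  from True have "(s, r) \<in> {(1, 0), (1, 3), (2, 0), (2, 1), (2, 3), (3, 1), (3, 2)}"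
    unfolding block_in_central .
  then consider "s = 1" "r = 0" | "s = 1" "r = 3" | "s = 2" "r = 0" | "s = 2" "r = 1" | "s = 2" "r = 3"
    | "s = 3" "r = 1" | "s = 3" "r = 2" by auto
  then show ?thesis
  proof cases
    case 1
    show ?thesis unfolding y_central_def 1 eqs using swapped(1) by simp
  next
    case 2
    show ?thesis unfolding y_central_def 2 eqs using swapped(2) by simp
  next
    case 3
    show ?thesis unfolding y_central_def 3 eqs using swapped(3) by simp
  next
    case 4
    show ?thesis unfolding y_central_def 4 eqs using swapped(4) by simp
  next
    case 5
    show ?thesis unfolding y_central_def 5 eqs using swapped(5) by simp
  next
    case 6
    show ?thesis unfolding y_central_def 6 eqs using swapped(7) by simp
  next
    case 7
    show ?thesis unfolding y_central_def 7 eqs using swapped(6) by simp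
  qed
next
  case False
  then have "(r, s) \<notin> {(0, 1), (3, 1), (0, 2), (1, 2), (3, 2), (1, 3), (2, 3)}"
    unfolding block_in_central by blast
  then have "y_central r s = 0" unfolding y_central_def by (simp only: insert_iff empty_iff de_Morgan_disj if_False)
  then show ?thesis
    using outside_central[OF block_index[OF assms(2)] block_index[OF assms(1)] False] by simp
qed

lemma product_cong:
  assumes "u - u' \<in> P" "v - v' \<in> P" "u' \<in> C" "v \<in> C"
  shows "u * v - u' * v' \<in> P"
proof -
  have "(u - u') * v + u' * (v - v') \<in> P"
    by (rule P_add[OF P_mult_right[OF assms(1,4)] P_mult[OF assms(2,3)]])
  then show ?thesis by (simp add: algebra_simps)
qed

lemma central_in: "x k (k + 2) \<in> C" "x k (k - 1) \<in> C" "x (k + 1) (k - 1) \<in> C" "x (k + 1) k \<in> C"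
  "x (k + 1) (k + 2) \<in> C" "x (k + 2) (k + 1) \<in> C" "x (k + 2) k \<in> C"
  by (rule x_in; unfold atLeastAtMost_iff; use k in arith)+

lemma x_central_in: "r < 4 \<Longrightarrow> s < 4 \<Longrightarrow> x_central r s \<in> C"
  unfolding x_central_def using x_in[OF block_index block_index] by simp

lemma y_central_in: "y_central r s \<in> C"
  unfolding y_central_def using central_in by simp

lemma central_bounds:
  "(r, s) \<in> central \<Longrightarrow> k - 1 \<le> r \<and> r \<le> k + 2 \<and> k - 1 \<le> s \<and> s \<le> k + 2"
  unfolding central_def by (elim insertE emptyE; unfold prod.inject; arith)

lemma diff_diff_diff_cancel: "(a - b) - ((a - a') - (b - b')) = a' - (b' :: 'a::ab_group_add)"
  by (simp add: algebra_simps)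

text \<open>
  Outside of the central block all factors lie in \<open>P\<close>, so that a commutator entry in the block is, modulo
  \<open>P\<close>, the entry of the commutator of the two \<open>4 \<times> 4\<close> matrices.
\<close>
lemma block_equation:
  assumes rs: "r < 4" "s < 4" and c: "commutator_entry (2 * k) (k - 1 + r) (k - 1 + s) \<in> P"
  shows "(\<Sum>t<4. x_central r t * y_central t s - y_central r t * x_central t s) \<in> P"
proof -
  let ?B = "(+) (k - 1) ` {..<4}"
  let ?i = "k - 1 + r" and ?j = "k - 1 + s"
  have inj: "inj_on ((+) (k - 1)) {..<4::nat}" by simp
  have "(\<Sum>l\<in>?B. x ?i l * y l ?j - y ?i l * x l ?j) \<in> P"
  proof (rule commutator_restrict[OF block_index[OF rs(1)] block_index[OF rs(2)] c])
    show "?B \<subseteq> ix"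
    proof (rule image_subsetI)
      fix t :: nat assume "t \<in> {..<4}"
      then have "t < 4" by (simp only: lessThan_iff)
      then show "k - 1 + t \<in> ix" by (rule block_index)
    qed
    fix l assume l: "l \<in> ix" "l \<notin> ?B"
    have "l < k - 1 \<or> k + 2 < l"
    proof (rule ccontr)
      assume "\<not> ?thesis"
      then have "l = k - 1 + (l - (k - 1))" "l - (k - 1) < 4" using k by arith+
      then have "l \<in> ?B" by (intro image_eqI[of _ _ "l - (k - 1)"]) simp_all
      then show False using l(2) by simp
    qed
    then have "(i, l) \<notin> central" "(l, i) \<notin> central" for i
      using central_bounds by fastforce+
    then have "x ?i l \<in> P" "y ?i l \<in> P"
      using outside_central[OF block_index[OF rs(1)] l(1)] outside_central[OF l(1) block_index[OF rs(1)]]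
      by blast+
    then show "x ?i l * y l ?j \<in> P \<and> y ?i l * x l ?j \<in> P"
      using P_mult_right x_in[OF l(1) block_index[OF rs(2)]] y_in[OF l(1) block_index[OF rs(2)]]
      by blast
  qed
  then have 1: "(\<Sum>t<4. x ?i (k - 1 + t) * y (k - 1 + t) ?j - y ?i (k - 1 + t) * x (k - 1 + t) ?j) \<in> P"
    unfolding sum.reindex[OF inj] o_def .
  have "(\<Sum>t<4. (x ?i (k - 1 + t) * y (k - 1 + t) ?j - x_central r t * y_central t s) -
      (y ?i (k - 1 + t) * x (k - 1 + t) ?j - y_central r t * x_central t s)) \<in> P"
  proof (rule ideal_sum[OF ideal_P], rule P_diff)
    fix t :: nat assume "t \<in> {..<4}"
    then have t: "t < 4" by simp
    show "x ?i (k - 1 + t) * y (k - 1 + t) ?j - x_central r t * y_central t s \<in> P"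
      using rs t by (intro product_cong x_central_cong y_central_cong x_central_in y_in block_index)
    show "y ?i (k - 1 + t) * x (k - 1 + t) ?j - y_central r t * x_central t s \<in> P"
      using rs t by (intro product_cong x_central_cong y_central_cong y_central_in x_in block_index)
  qed
  from P_diff[OF 1 this] show ?thesis
    unfolding sum_subtractf[symmetric] diff_diff_diff_cancel .
qed

text \<open>
  The seven equations are the commutator entries at the diagonal positions \<open>k - 1\<close>, \<open>k + 1\<close>, \<open>k + 2\<close> and at the
  four antidiagonal positions of the block.
\<close>
lemma central_variables:
  "x k (k - 1) \<in> P \<and> x k (k + 2) \<in> P \<and> x (k + 1) (k - 1) \<in> P \<and> x (k + 1) k \<in> P \<and>
    x (k + 1) (k + 2) \<in> P \<and> x (k + 2) k \<in> P \<and> x (k + 2) (k + 1) \<in> P"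
proof (rule central_unknowns_in_prime[OF prime_R])
  show "u \<in> P" if u: "u \<in> C" "2 * u \<in> P" for u
  proof -
    have "Poly_Mapping.single 0 (inverse 2) * (2 * u) \<in> P" by (rule P_mult[OF u(2) const_in_C])
    moreover have "Poly_Mapping.single 0 (inverse 2) * (2 * u) = u"
    proof -
      have "(2 :: (matrix_var, 'k) mpoly) = Poly_Mapping.single 0 2" by simp
      then have "Poly_Mapping.single 0 (inverse 2) * (2 * u) =
        Poly_Mapping.single 0 (inverse 2 :: 'k) * Poly_Mapping.single 0 2 * u"
        by (simp only: mult.assoc)
      also have "\<dots> = u" unfolding mult_single using two by simp
      finally show ?thesis .
    qed
    ultimately show ?thesis by simp
  qed
  show "x k (k - 1) \<in> C" "x k (k + 2) \<in> C" "x (k + 1) (k - 1) \<in> C" "x (k + 1) k \<in> C"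
    "x (k + 1) (k + 2) \<in> C" "x (k + 2) k \<in> C" "x (k + 2) (k + 1) \<in> C"
    by (rule central_in)+
  have eqs: "k - 1 + 0 = k - 1" "k - 1 + 1 = k" "k - 1 + 2 = k + 1" "k - 1 + 3 = k + 2"
    using k by simp_all
  have x_central: "x_central 1 0 = x k (k - 1)" "x_central 1 3 = x k (k + 2)" "x_central 2 0 = x (k + 1) (k - 1)"
    "x_central 2 1 = x (k + 1) k" "x_central 2 3 = x (k + 1) (k + 2)" "x_central 3 1 = x (k + 2) k"
    "x_central 3 2 = x (k + 2) (k + 1)"
    "x_central 0 0 = 0" "x_central 0 1 = 0" "x_central 0 2 = 0" "x_central 0 3 = 0"
    "x_central 1 1 = 0" "x_central 1 2 = 0" "x_central 2 2 = 0"
    "x_central 3 0 = 0" "x_central 3 3 = 0"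
    unfolding x_central_def unfolding block_in_central unfolding eqs by simp_all
  have y_central: "y_central 0 1 = x k (k + 2)" "y_central 3 1 = x k (k - 1)" "y_central 0 2 = x (k + 1) (k - 1)"
    "y_central 1 2 = x (k + 1) k" "y_central 3 2 = x (k + 1) (k + 2)" "y_central 1 3 = x (k + 2) (k + 1)"
    "y_central 2 3 = x (k + 2) k"
    "y_central 0 0 = 0" "y_central 1 0 = 0" "y_central 2 0 = 0" "y_central 3 0 = 0"
    "y_central 1 1 = 0" "y_central 2 1 = 0" "y_central 2 2 = 0"
    "y_central 0 3 = 0" "y_central 3 3 = 0"
    unfolding y_central_def by simp_all
  have four: "(\<Sum>t<4. g t) = g 0 + g 1 + g 2 + g 3" for g :: "nat \<Rightarrow> (matrix_var, 'k) mpoly"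
    by (simp add: eval_nat_numeral)
  note block = block_equation[unfolded four, unfolded x_central y_central]
  have c: "commutator_entry (2 * k) (k - 1 + 0) (k - 1 + 0) \<in> P"
    "commutator_entry (2 * k) (k - 1 + 0) (k - 1 + 3) \<in> P"
    "commutator_entry (2 * k) (k - 1 + 3) (k - 1 + 3) \<in> P"
    "commutator_entry (2 * k) (k - 1 + 3) (k - 1 + 0) \<in> P"
    "commutator_entry (2 * k) (k - 1 + 1) (k - 1 + 2) \<in> P"
    "commutator_entry (2 * k) (k - 1 + 2) (k - 1 + 2) \<in> P"
    "commutator_entry (2 * k) (k - 1 + 2) (k - 1 + 1) \<in> P"
  proof -
    have i: "2 * k + 1 - (k - 1) = k + 2" "2 * k + 1 - (k + 2) = k - 1"
      "2 * k + 1 - k = k + 1" "2 * k + 1 - (k + 1) = k" using k by simp_all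
    show "commutator_entry (2 * k) (k - 1 + 0) (k - 1 + 0) \<in> P"
      "commutator_entry (2 * k) (k - 1 + 3) (k - 1 + 3) \<in> P"
      "commutator_entry (2 * k) (k - 1 + 2) (k - 1 + 2) \<in> P"
      unfolding eqs using k by (auto intro!: diagonal)
    show "commutator_entry (2 * k) (k - 1 + 0) (k - 1 + 3) \<in> P"
      unfolding eqs using antidiagonal[of "k - 1"] k unfolding i by simp
    show "commutator_entry (2 * k) (k - 1 + 3) (k - 1 + 0) \<in> P"
      unfolding eqs using antidiagonal[of "k + 2"] k unfolding i by simp
    show "commutator_entry (2 * k) (k - 1 + 1) (k - 1 + 2) \<in> P"
      unfolding eqs using antidiagonal[of k] k unfolding i by simp
    show "commutator_entry (2 * k) (k - 1 + 2) (k - 1 + 1) \<in> P"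
      unfolding eqs using antidiagonal[of "k + 1"] k unfolding i by simp
  qed
  have neg: "u \<in> P" if "- u \<in> P" for u
    using P_diff[OF P_zero that] by simp
  show "x k (k - 1) * x k (k + 2) + x (k + 1) (k - 1) * x (k + 1) (k - 1) \<in> P"
    by (rule neg, rule back_subst[of "\<lambda>u. u \<in> P", OF block[OF _ _ c(1)]]) 
      (simp_all add: x_central y_central algebra_simps del: One_nat_def)
  show "x k (k + 2) * x k (k + 2) + x (k + 1) (k - 1) * x (k + 1) (k + 2) \<in> P"
    by (rule neg, rule back_subst[of "\<lambda>u. u \<in> P", OF block[OF _ _ c(2)]]) 
      (simp_all add: x_central y_central algebra_simps del: One_nat_def)
  show "2 * (x (k + 2) k * x (k + 2) (k + 1)) - x k (k - 1) * x k (k + 2) -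
      x (k + 1) (k + 2) * x (k + 1) (k + 2) \<in> P"
    by (rule back_subst[of "\<lambda>u. u \<in> P", OF block[OF _ _ c(3)]]) 
      (simp_all add: x_central y_central algebra_simps del: One_nat_def)
  show "x k (k - 1) * x k (k - 1) + x (k + 1) (k + 2) * x (k + 1) (k - 1) \<in> P"
    by (rule neg, rule back_subst[of "\<lambda>u. u \<in> P", OF block[OF _ _ c(4)]]) 
      (simp_all add: x_central y_central algebra_simps del: One_nat_def)
  show "x k (k - 1) * x (k + 1) (k - 1) + x k (k + 2) * x (k + 1) (k + 2) -
      x (k + 2) (k + 1) * x (k + 2) (k + 1) \<in> P"
    by (rule back_subst[of "\<lambda>u. u \<in> P", OF block[OF _ _ c(5)]]) 
      (simp_all add: x_central y_central algebra_simps del: One_nat_def)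
  show "x (k + 1) (k - 1) * x (k + 1) (k - 1) + x (k + 1) k * x (k + 1) k +
      x (k + 1) (k + 2) * x (k + 1) (k + 2) - x (k + 2) k * x (k + 2) (k + 1) \<in> P"
    by (rule back_subst[of "\<lambda>u. u \<in> P", OF block[OF _ _ c(6)]]) 
      (simp_all add: x_central y_central algebra_simps del: One_nat_def)
  show "x (k + 1) (k - 1) * x k (k + 2) + x (k + 1) (k + 2) * x k (k - 1) - x (k + 2) k * x (k + 2) k \<in> P"
    by (rule back_subst[of "\<lambda>u. u \<in> P", OF block[OF _ _ c(7)]]) 
      (simp_all add: x_central y_central algebra_simps del: One_nat_def)
qed

lemma all_variables:
  assumes "v \<in> matrix_vars (2 * k)"
  shows "poly_var v \<in> P"
proof -
  have y: "v \<in> P" if "u - v \<in> P" "u \<in> P" for u v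
    using P_diff[OF that(2,1)] by simp
  have central: "x r s \<in> P \<and> y s r \<in> P" if "(r, s) \<in> central" for r s
    using that central_variables y[OF identified_block(1)] y[OF identified_block(2)]
      y[OF identified_block(3)] y[OF identified_block(4)] y[OF identified_block(5)]
      y[OF identified_block(6)] y[OF identified_block(7)]
    unfolding central_def by fast
  have all: "x r s \<in> P \<and> y s r \<in> P" if "r \<in> ix" "s \<in> ix" for r s
    using central outside_central[OF that] by blast
  from assms obtain i j where ij: "i \<in> ix" "j \<in> ix" "v = Xvar i j \<or> v = Yvar i j"
    unfolding matrix_vars_def by blast
  from ij(3) show ?thesis
  proof
    assume "v = Xvar i j"
    then show ?thesis using all[OF ij(1,2)] unfolding x_var_def by simp
  next
    assume "v = Yvar i j"
    then show ?thesis using all[OF ij(2,1)] unfolding y_var_def by simp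
  qed
qed

end

section \<open>The system of parameters\<close>
text \<open>
  The last diagonal entry is left out: it is minus the sum of the others, and the criterion needs exactly
  \<open>2 n - 1\<close> generators.
\<close>
definition commutator_generators :: "nat \<Rightarrow> (matrix_var, 'k::comm_ring_1) mpoly list" where
  "commutator_generators n =
    map (\<lambda>i. commutator_entry n i i) [1..<n] @ map (\<lambda>i. commutator_entry n i (n + 1 - i)) [1..<n + 1]"

lemma commutator_entry_in_polys:
  assumes "i \<in> {1..n}" "j \<in> {1..n}"
  shows "(commutator_entry n i j :: (matrix_var, 'k::field) mpoly) \<in> polys (matrix_vars n)"
proof -
  interpret poly_vars "matrix_vars n" "TYPE('k)"
    by unfold_locales (rule finite_matrix_vars)
  have "(poly_var v :: (matrix_var, 'k) mpoly) \<in> C" if "v \<in> {Xvar i j, Yvar i j}" "i \<in> {1..n}" "j \<in> {1..n}" for i j v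
    using that by (intro poly_var_in_C) (auto simp: matrix_vars_def)
  then show ?thesis
    unfolding commutator_entry_def x_var_def y_var_def using assms
    by (intro diff_in sum_in mult_in) auto
qed

lemma diag_antidiag_ideal_eq:
  "(diag_antidiag_ideal n :: (matrix_var, 'k::field) mpoly set) =
    genideal (poly_ring (matrix_vars n)) (set (commutator_generators n))"
proof -
  interpret poly_vars "matrix_vars n" "TYPE('k)"
    by unfold_locales (rule finite_matrix_vars)
  interpret R: cring R by (rule cring_R)
  let ?G = "set (commutator_generators n) :: (matrix_var, 'k) mpoly set"
  let ?H = "{commutator_entry n i i | i. 1 \<le> i \<and> i \<le> n} \<union>
       {commutator_entry n i (n + 1 - i) | i. 1 \<le> i \<and> i \<le> n} :: (matrix_var, 'k) mpoly set"
  have G: "?G = (\<lambda>i. commutator_entry n i i) ` {1..<n} \<union> (\<lambda>i. commutator_entry n i (n + 1 - i)) ` {1..<n + 1}"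
    unfolding commutator_generators_def by (simp only: set_append set_map set_upt)
  have H_C: "?H \<subseteq> C"
  proof safe
    fix i assume i: "1 \<le> i" "i \<le> n"
    then have "n + 1 - i \<in> {1..n}" unfolding atLeastAtMost_iff by arith
    then show "commutator_entry n i i \<in> C" "commutator_entry n i (n + 1 - i) \<in> C"
      using i by (intro commutator_entry_in_polys; simp)+
  qed
  have G_H: "?G \<subseteq> ?H" unfolding G by auto
  have G_carrier: "?G \<subseteq> carrier R" and H_carrier: "?H \<subseteq> carrier R"
    unfolding partial_object.simps by (rule subset_trans[OF G_H H_C], rule H_C)
  have idG: "ideal (genideal R ?G) R" by (rule R.genideal_ideal[OF G_carrier])
  have G_sub: "?G \<subseteq> genideal R ?G" by (rule R.genideal_self[OF G_carrier])
  have below: "commutator_entry n i i \<in> genideal R ?G" if i: "i \<in> {1..<n}" for i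
  proof -
    have "commutator_entry n i i \<in> ?G" unfolding G by (rule UnI1, rule imageI) (rule i)
    then show ?thesis using G_sub by blast
  qed
  have diag: "commutator_entry n i i \<in> genideal R ?G" if i: "1 \<le> i" "i \<le> n" for i
  proof (cases "i = n")
    case False
    then show ?thesis using i by (intro below) simp
  next
    case True
    have "{1..n} = insert n {1..<n}" using i True by auto
    then have "commutator_entry n n n + (\<Sum>i = 1..<n. commutator_entry n i i) = (0 :: (matrix_var, 'k) mpoly)"
      using sum_diagonal_commutator_entries[of n, where 'k = 'k] by simp
    then have "commutator_entry n n n = 0 - (\<Sum>i = 1..<n. commutator_entry n i i :: (matrix_var, 'k) mpoly)"
      by (simp add: eq_neg_iff_add_eq_0)
    moreover have "(\<Sum>i = 1..<n. commutator_entry n i i :: (matrix_var, 'k) mpoly) \<in> genideal R ?G"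
      by (rule ideal_sum[OF idG]) (rule below)
    ultimately show ?thesis
      unfolding True using ideal_diff[OF idG ideal_zero[OF idG]] by (simp only:)
  qed
  have "commutator_entry n i (n + 1 - i) \<in> genideal R ?G" if "1 \<le> i" "i \<le> n" for i
  proof -
    have "commutator_entry n i (n + 1 - i) \<in> ?G" unfolding G using that by auto
    then show ?thesis using G_sub by blast
  qed
  with diag have H_sub: "?H \<subseteq> genideal R ?G" by blast
  have "genideal R ?H = genideal R ?G"
  proof
    show "genideal R ?H \<subseteq> genideal R ?G" by (rule R.genideal_minimal[OF idG H_sub])
    have "ideal (genideal R ?H) R" by (rule R.genideal_ideal[OF H_carrier])
    moreover have "?G \<subseteq> genideal R ?H" by (rule subset_trans[OF G_H R.genideal_self[OF H_carrier]])
    ultimately show "genideal R ?G \<subseteq> genideal R ?H" by (rule R.genideal_minimal)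
  qed
  then show ?thesis unfolding diag_antidiag_ideal_def poly_ring_eq_R .
qed

theorem theorem2p2:
  fixes n k :: nat
  assumes "n = 2 * k" and "k \<ge> 2" and "CHAR('k::field) \<noteq> 2"
  shows "homogeneous_sop (matrix_vars n) (diag_antidiag_ideal n)
    (map (\<lambda>f. diag_antidiag_ideal n +>\<^bsub>poly_ring (matrix_vars n)\<^esub> f)
      (parameter_polys k :: (matrix_var, 'k) mpoly list))"
proof -
  interpret poly_vars "matrix_vars n" "TYPE('k)"
    by unfold_locales (rule finite_matrix_vars)
  have two: "(2 :: 'k) \<noteq> 0"
  proof
    assume "(2 :: 'k) = 0"
    then have "of_nat 2 = (0 :: 'k)" by simp
    then have "CHAR('k) dvd 2" by (simp only: of_nat_eq_0_iff_char_dvd)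
    then have "CHAR('k) \<le> 2" "CHAR('k) \<noteq> 0" by (auto dest: dvd_imp_le intro!: Nat.gr0I)
    then have "CHAR('k) = 1 \<or> CHAR('k) = 2" by linarith
    then show False using assms(3) CHAR_not_1[where 'a = 'k] by simp
  qed
  have I_eq: "diag_antidiag_ideal n = genideal (poly_ring (matrix_vars n))
    (set (commutator_generators n :: (matrix_var, 'k) mpoly list))"
    by (rule diag_antidiag_ideal_eq)
  have hs: "positive_forms (commutator_generators n)"
    unfolding positive_forms_def
  proof
    fix f :: "(matrix_var, 'k) mpoly" assume "f \<in> set (commutator_generators n)"
    then have "\<exists>i\<in>{1..n}. \<exists>j\<in>{1..n}. f = commutator_entry n i j"
      unfolding commutator_generators_def set_append set_map set_upt
    proof (elim UnE imageE)
      fix i assume "f = commutator_entry n i i" "i \<in> {1..<n}"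
      moreover from this have "i \<in> {1..n}" by simp
      ultimately show ?thesis by blast
    next
      fix i assume "f = commutator_entry n i (n + 1 - i)" "i \<in> {1..<n + 1}"
      moreover from this have "i \<in> {1..n}" "n + 1 - i \<in> {1..n}" by auto
      ultimately show ?thesis by blast
    qed
    then obtain i j where ij: "i \<in> {1..n}" "j \<in> {1..n}" "f = commutator_entry n i j" by blast
    have "homogeneous 2 f" "f \<in> C"
      unfolding ij(3) by (rule homogeneous_commutator_entry, rule commutator_entry_in_polys[OF ij(1,2)])
    then show "f \<in> C \<and> (\<exists>e>0. homogeneous e f)" by (intro conjI exI[of _ 2]) simp_all
  qed
  have fs: "positive_forms (parameter_polys k)"
    unfolding positive_forms_def
  proof
    fix f :: "(matrix_var, 'k) mpoly" assume f: "f \<in> set (parameter_polys k)"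
    have x_form: "x_var i j \<in> C \<and> homogeneous 1 (x_var i j :: (matrix_var, 'k) mpoly)"
      and y_form: "y_var i j \<in> C \<and> homogeneous 1 (y_var i j :: (matrix_var, 'k) mpoly)"
      if "i \<in> {1..n}" "j \<in> {1..n}" for i j
    proof -
      have v: "Xvar i j \<in> matrix_vars n" "Yvar i j \<in> matrix_vars n"
        using that unfolding matrix_vars_def by blast+
      show "x_var i j \<in> C \<and> homogeneous 1 (x_var i j :: (matrix_var, 'k) mpoly)"
        unfolding x_var_def by (intro conjI poly_var_in_C homogeneous_poly_var v)
      show "y_var i j \<in> C \<and> homogeneous 1 (y_var i j :: (matrix_var, 'k) mpoly)"
        unfolding y_var_def by (intro conjI poly_var_in_C homogeneous_poly_var v)
    qed
    have diff: "g - h \<in> C \<and> homogeneous 1 (g - h)"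
      if "g \<in> C \<and> homogeneous 1 g" "h \<in> C \<and> homogeneous 1 h" for g h
      using that diff_in homogeneous_diff by blast
    have k1: "1 \<le> k" using assms(2) by simp
    have Omega_n: "i \<in> {1..n} \<and> j \<in> {1..n}" if "(i, j) \<in> Omega k" for i j
      using subsetD[OF Omega_subset[OF k1] that] unfolding assms(1) by blast
    have "f \<in> C \<and> homogeneous 1 f"
      using f unfolding set_parameter_polys[OF k1] Un_iff
    proof (elim disjE imageE)
      fix p assume p: "f = (case p of (i, j) \<Rightarrow> x_var i j)" "p \<in> Omega k"
      obtain i j where ij: "p = (i, j)" by fastforce
      show ?thesis using x_form Omega_n p(2) unfolding p(1) ij prod.case by blast
    next
      fix p assume p: "f = (case p of (i, j) \<Rightarrow> y_var j i)" "p \<in> Omega k"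
      obtain i j where ij: "p = (i, j)" by fastforce
      show ?thesis using y_form Omega_n p(2) unfolding p(1) ij prod.case by blast
    next
      fix s assume f: "f = x_var k s - y_var (2 * k + 1 - s) k"
        and s: "s \<in> {s \<in> {1..2 * k}. s \<noteq> k \<and> s \<noteq> k + 1}"
      have "2 * k + 1 - s \<in> {1..n}" "s \<in> {1..n}" "k \<in> {1..n}" using s assms(1,2) by auto
      then show ?thesis unfolding f by (intro diff x_form y_form)
    next
      fix s assume f: "f = x_var (k + 1) s - y_var s (k + 1)" and s: "s \<in> {s \<in> {1..k + 2}. s \<noteq> k + 1}"
      have "s \<in> {1..n}" "k + 1 \<in> {1..n}" using s assms(1,2) by auto
      then show ?thesis unfolding f by (intro diff x_form y_form)
    next
      assume f: "f \<in> {x_var (k + 2) k - y_var (k + 1) (k + 2), x_var (k + 2) (k + 1) - y_var k (k + 2)}"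
      have in_n: "k \<in> {1..n}" "k + 1 \<in> {1..n}" "k + 2 \<in> {1..n}" using assms(1,2) by auto
      from f consider "f = x_var (k + 2) k - y_var (k + 1) (k + 2)"
        | "f = x_var (k + 2) (k + 1) - y_var k (k + 2)" by blast
      then show ?thesis
      proof cases
        case 1
        show ?thesis unfolding 1 by (intro diff x_form y_form in_n)
      next
        case 2
        show ?thesis unfolding 2 by (intro diff x_form y_form in_n)
      qed
    next
      fix s assume f: "f = x_var s k - y_var k s" and s: "s \<in> {k + 3..2 * k}"
      have "s \<in> {1..n}" "k \<in> {1..n}" using s assms(1,2) by auto
      then show ?thesis unfolding f by (intro diff x_form y_form)
    qed
    then show "f \<in> C \<and> (\<exists>e>0. homogeneous e f)" by (metis zero_less_one)
  qed
  have len: "length (commutator_generators n :: (matrix_var, 'k) mpoly list) +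
    length (parameter_polys k :: (matrix_var, 'k) mpoly list) = card (matrix_vars n)"
  proof -
    have "length (commutator_generators n :: (matrix_var, 'k) mpoly list) = 4 * k - 1"
      unfolding commutator_generators_def assms(1) using assms(2) by simp
    then show ?thesis
      using length_parameter_polys[OF assms(2), where 'k = 'k] unfolding card_matrix_vars assms(1) by simp
  qed
  show ?thesis
  proof (rule homogeneous_sop_if_primes_contain_variables[OF hs fs len _ I_eq])
    fix P :: "(matrix_var, 'k) mpoly set" and v
    assume P: "primeideal P R" "set (commutator_generators n) \<subseteq> P" "set (parameter_polys k) \<subseteq> P"
      and v: "v \<in> matrix_vars n"
    interpret R: cring R by (rule cring_R)
    have I_P: "diag_antidiag_ideal n \<subseteq> P"
      unfolding I_eq poly_ring_eq_R
      by (rule R.genideal_minimal[OF primeideal_imp_ideal[OF P(1)] P(2)])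
    have sub: "{commutator_entry n i i | i. 1 \<le> i \<and> i \<le> n} \<union>
       {commutator_entry n i (n + 1 - i) | i. 1 \<le> i \<and> i \<le> n} \<subseteq> P"
    proof (rule subset_trans[OF _ I_P])
      show "{commutator_entry n i i | i. 1 \<le> i \<and> i \<le> n} \<union>
        {commutator_entry n i (n + 1 - i) | i. 1 \<le> i \<and> i \<le> n} \<subseteq>
        (diag_antidiag_ideal n :: (matrix_var, 'k) mpoly set)"
        unfolding diag_antidiag_ideal_def genideal_def by blast
    qed
    have "parameter_prime k P"
    proof (rule parameter_prime.intro)
      show "2 \<le> k" by fact
      show "(2 :: 'k) \<noteq> 0" by (rule two)
      show "primeideal P (poly_ring (matrix_vars (2 * k)))"
        using P(1) unfolding poly_ring_eq assms(1) .
      show "commutator_entry (2 * k) i i \<in> P" if "1 \<le> i" "i \<le> 2 * k" for i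
        using sub that unfolding assms(1) by blast
      show "commutator_entry (2 * k) i (2 * k + 1 - i) \<in> P" if "1 \<le> i" "i \<le> 2 * k" for i
        using sub that unfolding assms(1) by blast
      show "set (parameter_polys k) \<subseteq> P" by fact
    qed
    then show "poly_var v \<in> P"
      by (rule parameter_prime.all_variables) (use v in \<open>simp only: assms(1)\<close>)
  qed
qed

end
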